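(* Let $(id,id,\gamma):(H,A,C)\to(H,A,C')$ be a monoidal morphism of monoidal Doi-Hopf data, with associated functors $F:{}_A\mathcal{M}(H)^C\to{}_A\mathcal{M}(H)^{C'}$, $F(M)=A\otimes_AM$, and $G:{}_A\mathcal{M}(H)^{C'}\to{}_A\mathcal{M}(H)^C$, $G(N)=N\square_{C'}C$. Then $G(C')\cong C$ in ${}_A\mathcal{M}(H)^C$. Furthermore, let $M\in{}_A\mathcal{M}(H)^C$ and $N\in{}_A\mathcal{M}(H)^{C'}$ be arbitrary. If $(C,\alpha_C)$ is a Hom-Hopf algebra, then there is an isomorphism in ${}_A\mathcal{M}(H)^C$ $$M\otimes G(N)\simeq G(F(M)\otimes N).$$ If $(C,\alpha_C)$ has a twisted antipode, then there is an isomorphism in ${}_A\mathcal{M}(H)^C$ $$G(N)\otimes M\simeq G(N\otimes F(M)).$$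
   Context: Work over a field $k$, $\otimes=\otimes_k$. All structure maps $\alpha$ below are assumed bijective. Hom-algebra $(A,\alpha_A)$: a linear multiplication, a unit $1_A$ and a linear $\alpha_A:A\to A$ with $\alpha_A(ab)=\alpha_A(a)\alpha_A(b)$, $\alpha_A(1_A)=1_A$, $1_Aa=\alpha_A(a)=a1_A$, $\alpha_A(a)(bc)=(ab)\alpha_A(c)$. Hom-coalgebra $(C,\alpha_C)$: linear $\Delta:C\to C\otimes C$, $\Delta(c)=c_1\otimes c_2$, $\varepsilon:C\to k$ and $\alpha_C$ with $\varepsilon\circ\alpha_C=\varepsilon$, $(\alpha_C\otimes\alpha_C)\Delta=\Delta\alpha_C$, $(\varepsilon\otimes id)\Delta=\alpha_C=(id\otimes\varepsilon)\Delta$, $(\Delta\otimes\alpha_C)\Delta=(\alpha_C\otimes\Delta)\Delta$. Morphisms preserve all structure and commute with the $\alpha$'s. Hom-bialgebra: a Hom-algebra and Hom-coalgebra with the same $\alpha$ such that $\Delta,\varepsilon$ are Hom-algebra morphisms. Hom-Hopf algebra: a Hom-bialgebra with a linear $S$, $S\alpha=\alpha S$, $S(h_1)h_2=h_1S(h_2)=\varepsilon(h)1$. A twisted antipode of a Hom-bialgebra $C$ is a linear $\bar S:C\to C$ with $\bar S\alpha_C=\alpha_C\bar S$, $\bar S(c_2)c_1=c_2\bar S(c_1)=\varepsilon(c)1$. Left $A$-module $(M,\alpha_M)$: linear $A\otimes M\to M$ with $1_A\cdot m=\alpha_M(m)$, $\alpha_M(a\cdot m)=\alpha_A(a)\cdot\alpha_M(m)$,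 $\alpha_A(a)\cdot(b\cdot m)=(ab)\cdot\alpha_M(m)$. Right $C$-comodule $(M,\alpha_M)$: linear $\rho:M\to M\otimes C$, $\rho(m)=m_{(0)}\otimes m_{(1)}$, with $(id\otimes\varepsilon)\rho=\alpha_M$, $(\alpha_M\otimes\alpha_C)\rho=\rho\alpha_M$, $(\rho\otimes\alpha_C)\rho=(\alpha_M\otimes\Delta)\rho$. (Co)module maps are (co)linear and commute with the $\alpha$'s. A (Hom-type) Doi-Hopf datum $(H,A,C)$ consists of a Hom-Hopf algebra $(H,\alpha_H)$, a right $H$-comodule algebra $(A,\alpha_A)$ (a Hom-algebra and right $H$-comodule, $\rho(a)=a_{(0)}\otimes a_{(1)}$, with $\rho(ab)=\rho(a)\rho(b)$, $\rho(1_A)=1_A\otimes1_H$) and a left $H$-module coalgebra $(C,\alpha_C)$ (a Hom-coalgebra and left $H$-module with $\Delta_C(h\cdot c)=h_1\cdot c_1\otimes h_2\cdot c_2$, $\varepsilon_C(h\cdot c)=\varepsilon_H(h)\varepsilon_C(c)$). A Doi-Hopf module over $(H,A,C)$ is $(M,\alpha_M)$ that is a left $A$-module and a right $C$-comodule with $\rho(a\cdot m)=a_{(0)}\cdot m_{(0)}\otimes a_{(1)}\cdot m_{(1)}$. ${}_A\mathcal{M}(H)^C$ is the category of these, with $A$-linear $C$-colinear maps. The datum is monoidal if $A$ and $C$ are Hom-bialgebras and $a_{(0)1}\otimes a_{(0)2}\otimes\alpha_H^2(a_{(1)})\cdot(cd)=a_{1(0)}\otimes a_{2(0)}\otimes(a_{1(1)}\cdot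 c)(a_{2(1)}\cdot d)$, $\varepsilon(a)1_C=\varepsilon(a_{(0)})a_{(1)}\cdot1_C$ for all $a\in A$, $c,d\in C$. Then for Doi-Hopf modules $M,N$, $(M\otimes N,\alpha_M\otimes\alpha_N)$ is a Doi-Hopf module via $a\cdot(m\otimes n)=a_1\cdot m\otimes a_2\cdot n$, $\rho(m\otimes n)=m_{(0)}\otimes n_{(0)}\otimes\alpha_C^{-2}(m_{(1)}n_{(1)})$, and $C$ is a Doi-Hopf module via $a\cdot c=\varepsilon(a_{(0)})a_{(1)}\cdot c$, $\rho(c)=c_1\otimes\alpha_C^{-1}(c_2)$ (likewise $C'$ over $(H,A,C')$). That $(id,id,\gamma)$ is a monoidal morphism means: $(H,A,C)$, $(H,A,C')$ are monoidal Doi-Hopf data and $\gamma:C\to C'$ is a Hom-bialgebra map with $\gamma(h\cdot c)=h\cdot\gamma(c)$. $F(M)=A\otimes_AM$ is the quotient of $A\otimes M$ by the span of all $ba\otimes\alpha_M(m)-\alpha_A(b)\otimes a\cdot m$, with structure map $\alpha_A\otimes\alpha_M$, action $a\cdot(b\otimes m)=\alpha_A(a)b\otimes\alpha_M(m)$ and coaction $\rho(b\otimes m)=b_{(0)}\otimes m_{(0)}\otimes\alpha_{C'}^{-2}(b_{(1)}\cdot\gamma(m_{(1)}))$. $G(N)=N\square_{C'}C=\{\sum n\otimes c\in N\otimes C\mid\sum\alpha_N(n)\otimes\gamma(c_1)\otimes c_2=\sum n_{(0)}\otimes n_{(1)}\otimes\alpha_C(c)\}$, with structure map $\alpha_N\otimes\alpha_C$,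 action $a\cdot(n\otimes c)=a_{(0)}\cdot n\otimes a_{(1)}\cdot c$ and coaction $\rho(n\otimes c)=\alpha_N(n)\otimes c_1\otimes\alpha_C^{-1}(c_2)$. *)

theory Defs
  imports "HOL-Algebra.Module" "HOL-Algebra.AbelCoset"
begin

text \<open>
  Vector spaces over a field \<open>K\<close> are \<open>module K V\<close>. The fields \<open>mult\<close> and \<open>one\<close> of the record
  \<open>module\<close> play a role only when the space carries a Hom-algebra structure; in the
  constructions below they are left unspecified.
\<close>

section \<open>Linear algebra\<close>

definition ground_module :: "('k, 'z) ring_scheme \<Rightarrow> ('k, 'k) module" where
  "ground_module K =
     \<lparr>carrier = carrier K, mult = mult K, one = one K, zero = zero K, add = add K,
      smult = mult K\<rparr>"

definition linear_map ::
  "('k, 'z) ring_scheme \<Rightarrow> ('k, 'v, 'x) module_scheme \<Rightarrow> ('k, 'w, 'y) module_scheme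
    \<Rightarrow> ('v \<Rightarrow> 'w) \<Rightarrow> bool" where
  "linear_map K V W f \<longleftrightarrow>
     f \<in> carrier V \<rightarrow> carrier W \<and>
     (\<forall>x\<in>carrier V. \<forall>y\<in>carrier V. f (x \<oplus>\<^bsub>V\<^esub> y) = f x \<oplus>\<^bsub>W\<^esub> f y) \<and>
     (\<forall>a\<in>carrier K. \<forall>x\<in>carrier V. f (a \<odot>\<^bsub>V\<^esub> x) = a \<odot>\<^bsub>W\<^esub> f x)"

definition bilinear_map ::
  "('k, 'z) ring_scheme \<Rightarrow> ('k, 'v, 'x) module_scheme \<Rightarrow> ('k, 'w, 'y) module_scheme
    \<Rightarrow> ('k, 'u, 'q) module_scheme \<Rightarrow> ('v \<Rightarrow> 'w \<Rightarrow> 'u) \<Rightarrow> bool" where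
  "bilinear_map K V W U f \<longleftrightarrow>
     (\<forall>v\<in>carrier V. linear_map K W U (\<lambda>w. f v w)) \<and>
     (\<forall>w\<in>carrier W. linear_map K V U (\<lambda>v. f v w))"

definition span_in :: "('k, 'z) ring_scheme \<Rightarrow> ('k, 'v, 'x) module_scheme \<Rightarrow> 'v set \<Rightarrow> 'v set" where
  "span_in K V S = \<Inter>{N. submodule N K V \<and> S \<subseteq> N}"

definition quotient_module ::
  "('k, 'v, 'x) module_scheme \<Rightarrow> 'v set \<Rightarrow> ('k, 'v set) module" where
  "quotient_module V N =
     \<lparr>carrier = a_rcosets\<^bsub>V\<^esub> N, mult = undefined, one = undefined, zero = N, add = set_add V,
      smult = (\<lambda>a X. \<Union>x\<in>X. N +>\<^bsub>V\<^esub> (a \<odot>\<^bsub>V\<^esub> x))\<rparr>"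

definition free_module :: "('k, 'z) ring_scheme \<Rightarrow> 's set \<Rightarrow> ('k, 's \<Rightarrow> 'k) module" where
  "free_module K S =
     \<lparr>carrier = {f. (\<forall>s. f s \<in> carrier K) \<and> finite {s. f s \<noteq> \<zero>\<^bsub>K\<^esub>} \<and> {s. f s \<noteq> \<zero>\<^bsub>K\<^esub>} \<subseteq> S},
      mult = undefined, one = undefined, zero = (\<lambda>_. \<zero>\<^bsub>K\<^esub>), add = (\<lambda>f g s. f s \<oplus>\<^bsub>K\<^esub> g s),
      smult = (\<lambda>a f s. a \<otimes>\<^bsub>K\<^esub> f s)\<rparr>"

definition free_gen :: "('k, 'z) ring_scheme \<Rightarrow> 's \<Rightarrow> ('s \<Rightarrow> 'k)" where
  "free_gen K s = (\<lambda>t. if t = s then \<one>\<^bsub>K\<^esub> else \<zero>\<^bsub>K\<^esub>)"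


section \<open>Tensor products over the ground field\<close>

type_synonym ('k, 'v, 'w) tensor = "('v \<times> 'w \<Rightarrow> 'k) set"

definition bilinear_relations ::
  "('k, 'z) ring_scheme \<Rightarrow> ('k, 'v, 'x) module_scheme \<Rightarrow> ('k, 'w, 'y) module_scheme
    \<Rightarrow> ('v \<times> 'w \<Rightarrow> 'k) set" where
  "bilinear_relations K V W =
    (let L = free_module K (carrier V \<times> carrier W) in
      {free_gen K (v \<oplus>\<^bsub>V\<^esub> v', w) \<ominus>\<^bsub>L\<^esub> (free_gen K (v, w) \<oplus>\<^bsub>L\<^esub> free_gen K (v', w)) | v v' w.
         v \<in> carrier V \<and> v' \<in> carrier V \<and> w \<in> carrier W} \<union>
      {free_gen K (v, w \<oplus>\<^bsub>W\<^esub> w') \<ominus>\<^bsub>L\<^esub> (free_gen K (v, w) \<oplus>\<^bsub>L\<^esub> free_gen K (v, w')) | v w w'.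
         v \<in> carrier V \<and> w \<in> carrier W \<and> w' \<in> carrier W} \<union>
      {free_gen K (a \<odot>\<^bsub>V\<^esub> v, w) \<ominus>\<^bsub>L\<^esub> (a \<odot>\<^bsub>L\<^esub> free_gen K (v, w)) | a v w.
         a \<in> carrier K \<and> v \<in> carrier V \<and> w \<in> carrier W} \<union>
      {free_gen K (v, a \<odot>\<^bsub>W\<^esub> w) \<ominus>\<^bsub>L\<^esub> (a \<odot>\<^bsub>L\<^esub> free_gen K (v, w)) | a v w.
         a \<in> carrier K \<and> v \<in> carrier V \<and> w \<in> carrier W})"

definition tensor_relations ::
  "('k, 'z) ring_scheme \<Rightarrow> ('k, 'v, 'x) module_scheme \<Rightarrow> ('k, 'w, 'y) module_scheme
    \<Rightarrow> ('v \<times> 'w \<Rightarrow> 'k) set" where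
  "tensor_relations K V W =
     span_in K (free_module K (carrier V \<times> carrier W)) (bilinear_relations K V W)"

definition tensor ::
  "('k, 'z) ring_scheme \<Rightarrow> ('k, 'v, 'x) module_scheme \<Rightarrow> ('k, 'w, 'y) module_scheme
    \<Rightarrow> ('k, ('k, 'v, 'w) tensor) module" where
  "tensor K V W =
     quotient_module (free_module K (carrier V \<times> carrier W)) (tensor_relations K V W)"

definition tens ::
  "('k, 'z) ring_scheme \<Rightarrow> ('k, 'v, 'x) module_scheme \<Rightarrow> ('k, 'w, 'y) module_scheme
    \<Rightarrow> 'v \<Rightarrow> 'w \<Rightarrow> ('k, 'v, 'w) tensor" where
  "tens K V W v w =
     tensor_relations K V W +>\<^bsub>free_module K (carrier V \<times> carrier W)\<^esub> free_gen K (v, w)"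

text \<open>
  The value at \<open>X \<in> V \<otimes> W\<close> of the linear map \<open>V \<otimes> W \<rightarrow> U\<close> induced by a bilinear map
  \<open>f : V \<times> W \<rightarrow> U\<close>: if \<open>X = \<Sum> v\<^sub>i \<otimes> w\<^sub>i\<close> then \<open>sweedler K U X f = \<Sum> f v\<^sub>i w\<^sub>i\<close>. It is evaluated
  on the representatives of the class \<open>X\<close>, all of which give the same result.
  With it, an expression in Sweedler notation such as \<open>g(c\<^sub>1, c\<^sub>2)\<close> becomes
  \<open>sweedler K U (\<Delta> c) (\<lambda>c\<^sub>1 c\<^sub>2. g c\<^sub>1 c\<^sub>2)\<close>.
\<close>
definition sweedler ::
  "('k, 'z) ring_scheme \<Rightarrow> ('k, 'u, 'q) module_scheme \<Rightarrow> ('k, 'v, 'w) tensor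
    \<Rightarrow> ('v \<Rightarrow> 'w \<Rightarrow> 'u) \<Rightarrow> 'u" where
  "sweedler K U X f =
     the_elem ((\<lambda>r. \<Oplus>\<^bsub>U\<^esub>p\<in>{p. r p \<noteq> \<zero>\<^bsub>K\<^esub>}. r p \<odot>\<^bsub>U\<^esub> f (fst p) (snd p)) ` X)"

definition tensor_map ::
  "('k, 'z) ring_scheme \<Rightarrow> ('k, 'v, 'x) module_scheme \<Rightarrow> ('k, 'w, 'y) module_scheme
    \<Rightarrow> ('a \<Rightarrow> 'v) \<Rightarrow> ('b \<Rightarrow> 'w) \<Rightarrow> ('k, 'a, 'b) tensor \<Rightarrow> ('k, 'v, 'w) tensor" where
  "tensor_map K V W f g X = sweedler K (tensor K V W) X (\<lambda>a b. tens K V W (f a) (g b))"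

definition tensor_mult ::
  "('k, 'z) ring_scheme \<Rightarrow> ('k, 'a, 'x) module_scheme \<Rightarrow> ('k, 'b, 'y) module_scheme
    \<Rightarrow> ('k, 'a, 'b) tensor \<Rightarrow> ('k, 'a, 'b) tensor \<Rightarrow> ('k, 'a, 'b) tensor" where
  "tensor_mult K A B X Y =
     sweedler K (tensor K A B) X (\<lambda>a b.
       sweedler K (tensor K A B) Y (\<lambda>a' b'. tens K A B (a \<otimes>\<^bsub>A\<^esub> a') (b \<otimes>\<^bsub>B\<^esub> b')))"

text \<open>Triple tensor products are bracketed to the left throughout.\<close>
definition tensor3 ::
  "('k, 'z) ring_scheme \<Rightarrow> ('k, 'v, 'x) module_scheme \<Rightarrow> ('k, 'w, 'y) module_scheme
    \<Rightarrow> ('k, 'u, 'q) module_scheme \<Rightarrow> ('k, ('k, ('k, 'v, 'w) tensor, 'u) tensor) module" where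
  "tensor3 K V W U = tensor K (tensor K V W) U"

definition tens3 ::
  "('k, 'z) ring_scheme \<Rightarrow> ('k, 'v, 'x) module_scheme \<Rightarrow> ('k, 'w, 'y) module_scheme
    \<Rightarrow> ('k, 'u, 'q) module_scheme \<Rightarrow> 'v \<Rightarrow> 'w \<Rightarrow> 'u \<Rightarrow> ('k, ('k, 'v, 'w) tensor, 'u) tensor" where
  "tens3 K V W U v w u = tens K (tensor K V W) U (tens K V W v w) u"


section \<open>Hom-algebras, Hom-coalgebras and Hom-Hopf algebras\<close>

record ('k, 'v) hom_space = "('k, 'v) module" +
  twist :: "'v \<Rightarrow> 'v"

record ('k, 'v) hom_coalgebra = "('k, 'v) hom_space" +
  comult :: "'v \<Rightarrow> ('k, 'v, 'v) tensor"
  counit :: "'v \<Rightarrow> 'k"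

definition untwist :: "('k, 'v, 'x) hom_space_scheme \<Rightarrow> 'v \<Rightarrow> 'v" where
  "untwist V = inv_into (carrier V) (twist V)"

locale hom_space = K?: field K + V?: module K V
  for K :: "('k, 'z) ring_scheme" (structure)
  and V :: "('k, 'v, 'x) hom_space_scheme" (structure) +
  assumes twist_linear: "linear_map K V V (twist V)"
    and twist_bij: "bij_betw (twist V) (carrier V) (carrier V)"

locale hom_algebra = hom_space K A
  for K :: "('k, 'z) ring_scheme" (structure)
  and A :: "('k, 'a, 'x) hom_space_scheme" (structure) +
  assumes mult_bilinear: "bilinear_map K A A A (mult A)"
    and unit_closed: "\<one>\<^bsub>A\<^esub> \<in> carrier A"
    and twist_mult: "\<lbrakk>a \<in> carrier A; b \<in> carrier A\<rbrakk> \<Longrightarrow> twist A (a \<otimes>\<^bsub>A\<^esub> b) = twist A a \<otimes>\<^bsub>A\<^esub> twist A b"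
    and twist_unit: "twist A \<one>\<^bsub>A\<^esub> = \<one>\<^bsub>A\<^esub>"
    and unit_left: "a \<in> carrier A \<Longrightarrow> \<one>\<^bsub>A\<^esub> \<otimes>\<^bsub>A\<^esub> a = twist A a"
    and unit_right: "a \<in> carrier A \<Longrightarrow> a \<otimes>\<^bsub>A\<^esub> \<one>\<^bsub>A\<^esub> = twist A a"
    and hom_assoc: "\<lbrakk>a \<in> carrier A; b \<in> carrier A; c \<in> carrier A\<rbrakk>
      \<Longrightarrow> twist A a \<otimes>\<^bsub>A\<^esub> (b \<otimes>\<^bsub>A\<^esub> c) = (a \<otimes>\<^bsub>A\<^esub> b) \<otimes>\<^bsub>A\<^esub> twist A c"

locale hom_coalgebra = hom_space K C
  for K :: "('k, 'z) ring_scheme" (structure)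
  and C :: "('k, 'c, 'x) hom_coalgebra_scheme" (structure) +
  assumes comult_linear: "linear_map K C (tensor K C C) (comult C)"
    and counit_linear: "linear_map K C (ground_module K) (counit C)"
    and counit_twist: "c \<in> carrier C \<Longrightarrow> counit C (twist C c) = counit C c"
    and comult_twist: "c \<in> carrier C
      \<Longrightarrow> tensor_map K C C (twist C) (twist C) (comult C c) = comult C (twist C c)"
    and counit_left: "c \<in> carrier C
      \<Longrightarrow> sweedler K C (comult C c) (\<lambda>c1 c2. counit C c1 \<odot>\<^bsub>C\<^esub> c2) = twist C c"
    and counit_right: "c \<in> carrier C
      \<Longrightarrow> sweedler K C (comult C c) (\<lambda>c1 c2. counit C c2 \<odot>\<^bsub>C\<^esub> c1) = twist C c"
    and hom_coassoc: "c \<in> carrier C \<Longrightarrow>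
      sweedler K (tensor3 K C C C) (comult C c) (\<lambda>c1 c2.
        sweedler K (tensor3 K C C C) (comult C c1) (\<lambda>c11 c12. tens3 K C C C c11 c12 (twist C c2))) =
      sweedler K (tensor3 K C C C) (comult C c) (\<lambda>c1 c2.
        sweedler K (tensor3 K C C C) (comult C c2) (\<lambda>c21 c22. tens3 K C C C (twist C c1) c21 c22))"

locale hom_bialgebra = hom_algebra K B + hom_coalgebra K B
  for K :: "('k, 'z) ring_scheme" (structure)
  and B :: "('k, 'b, 'x) hom_coalgebra_scheme" (structure) +
  assumes comult_mult: "\<lbrakk>a \<in> carrier B; b \<in> carrier B\<rbrakk>
      \<Longrightarrow> comult B (a \<otimes>\<^bsub>B\<^esub> b) = tensor_mult K B B (comult B a) (comult B b)"
    and comult_unit: "comult B \<one>\<^bsub>B\<^esub> = tens K B B \<one>\<^bsub>B\<^esub> \<one>\<^bsub>B\<^esub>"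
    and counit_mult: "\<lbrakk>a \<in> carrier B; b \<in> carrier B\<rbrakk>
      \<Longrightarrow> counit B (a \<otimes>\<^bsub>B\<^esub> b) = counit B a \<otimes>\<^bsub>K\<^esub> counit B b"
    and counit_unit: "counit B \<one>\<^bsub>B\<^esub> = \<one>\<^bsub>K\<^esub>"

definition antipode ::
  "('k, 'z) ring_scheme \<Rightarrow> ('k, 'b, 'x) hom_coalgebra_scheme \<Rightarrow> ('b \<Rightarrow> 'b) \<Rightarrow> bool" where
  "antipode K B S \<longleftrightarrow>
     linear_map K B B S \<and>
     (\<forall>b\<in>carrier B. S (twist B b) = twist B (S b)) \<and>
     (\<forall>b\<in>carrier B.
        sweedler K B (comult B b) (\<lambda>b1 b2. S b1 \<otimes>\<^bsub>B\<^esub> b2) = counit B b \<odot>\<^bsub>B\<^esub> \<one>\<^bsub>B\<^esub> \<and>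
        sweedler K B (comult B b) (\<lambda>b1 b2. b1 \<otimes>\<^bsub>B\<^esub> S b2) = counit B b \<odot>\<^bsub>B\<^esub> \<one>\<^bsub>B\<^esub>)"

definition twisted_antipode ::
  "('k, 'z) ring_scheme \<Rightarrow> ('k, 'b, 'x) hom_coalgebra_scheme \<Rightarrow> ('b \<Rightarrow> 'b) \<Rightarrow> bool" where
  "twisted_antipode K B S \<longleftrightarrow>
     linear_map K B B S \<and>
     (\<forall>b\<in>carrier B. S (twist B b) = twist B (S b)) \<and>
     (\<forall>b\<in>carrier B.
        sweedler K B (comult B b) (\<lambda>b1 b2. S b2 \<otimes>\<^bsub>B\<^esub> b1) = counit B b \<odot>\<^bsub>B\<^esub> \<one>\<^bsub>B\<^esub> \<and>
        sweedler K B (comult B b) (\<lambda>b1 b2. b2 \<otimes>\<^bsub>B\<^esub> S b1) = counit B b \<odot>\<^bsub>B\<^esub> \<one>\<^bsub>B\<^esub>)"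

locale hom_hopf_algebra = hom_bialgebra K B
  for K :: "('k, 'z) ring_scheme" (structure)
  and B :: "('k, 'b, 'x) hom_coalgebra_scheme" (structure) +
  assumes antipode_exists: "\<exists>S. antipode K B S"

definition hom_bialgebra_map ::
  "('k, 'z) ring_scheme \<Rightarrow> ('k, 'b, 'x) hom_coalgebra_scheme \<Rightarrow> ('k, 'd, 'y) hom_coalgebra_scheme
    \<Rightarrow> ('b \<Rightarrow> 'd) \<Rightarrow> bool" where
  "hom_bialgebra_map K B D g \<longleftrightarrow>
     linear_map K B D g \<and>
     (\<forall>b\<in>carrier B. g (twist B b) = twist D (g b)) \<and>
     (\<forall>a\<in>carrier B. \<forall>b\<in>carrier B. g (a \<otimes>\<^bsub>B\<^esub> b) = g a \<otimes>\<^bsub>D\<^esub> g b) \<and>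
     g \<one>\<^bsub>B\<^esub> = \<one>\<^bsub>D\<^esub> \<and>
     (\<forall>b\<in>carrier B. comult D (g b) = tensor_map K D D g g (comult B b)) \<and>
     (\<forall>b\<in>carrier B. counit D (g b) = counit B b)"


section \<open>Modules and comodules\<close>

locale hom_left_module = A: hom_algebra K A + M: hom_space K M
  for K :: "('k, 'z) ring_scheme"
  and A :: "('k, 'a, 'x) hom_space_scheme"
  and M :: "('k, 'm, 'y) hom_space_scheme"
  and actM :: "'a \<Rightarrow> 'm \<Rightarrow> 'm" +
  assumes act_bilinear: "bilinear_map K A M M actM"
    and act_unit: "m \<in> carrier M \<Longrightarrow> actM \<one>\<^bsub>A\<^esub> m = twist M m"
    and act_twist: "\<lbrakk>a \<in> carrier A; m \<in> carrier M\<rbrakk>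
      \<Longrightarrow> twist M (actM a m) = actM (twist A a) (twist M m)"
    and act_assoc: "\<lbrakk>a \<in> carrier A; b \<in> carrier A; m \<in> carrier M\<rbrakk>
      \<Longrightarrow> actM (twist A a) (actM b m) = actM (a \<otimes>\<^bsub>A\<^esub> b) (twist M m)"

locale hom_right_comodule = C: hom_coalgebra K C + M: hom_space K M
  for K :: "('k, 'z) ring_scheme"
  and C :: "('k, 'c, 'x) hom_coalgebra_scheme"
  and M :: "('k, 'm, 'y) hom_space_scheme"
  and coactM :: "'m \<Rightarrow> ('k, 'm, 'c) tensor" +
  assumes coact_linear: "linear_map K M (tensor K M C) coactM"
    and coact_counit: "m \<in> carrier M
      \<Longrightarrow> sweedler K M (coactM m) (\<lambda>m0 m1. counit C m1 \<odot>\<^bsub>M\<^esub> m0) = twist M m"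
    and coact_twist: "m \<in> carrier M
      \<Longrightarrow> tensor_map K M C (twist M) (twist C) (coactM m) = coactM (twist M m)"
    and coact_coassoc: "m \<in> carrier M \<Longrightarrow>
      sweedler K (tensor3 K M C C) (coactM m) (\<lambda>m0 m1.
        sweedler K (tensor3 K M C C) (coactM m0) (\<lambda>m00 m01. tens3 K M C C m00 m01 (twist C m1))) =
      sweedler K (tensor3 K M C C) (coactM m) (\<lambda>m0 m1.
        sweedler K (tensor3 K M C C) (comult C m1) (\<lambda>m11 m12. tens3 K M C C (twist M m0) m11 m12))"

locale hom_comodule_algebra = hom_algebra K A + hom_right_comodule K H A rhoA
  for K :: "('k, 'z) ring_scheme"
  and H :: "('k, 'h, 'x) hom_coalgebra_scheme"
  and A :: "('k, 'a, 'y) hom_space_scheme"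
  and rhoA :: "'a \<Rightarrow> ('k, 'a, 'h) tensor" +
  assumes coact_mult: "\<lbrakk>a \<in> carrier A; b \<in> carrier A\<rbrakk>
      \<Longrightarrow> rhoA (a \<otimes>\<^bsub>A\<^esub> b) = tensor_mult K A H (rhoA a) (rhoA b)"
    and coact_unit: "rhoA \<one>\<^bsub>A\<^esub> = tens K A H \<one>\<^bsub>A\<^esub> \<one>\<^bsub>H\<^esub>"

locale hom_module_coalgebra = hom_coalgebra K C + hom_left_module K H C actC
  for K :: "('k, 'z) ring_scheme"
  and H :: "('k, 'h, 'x) hom_coalgebra_scheme"
  and C :: "('k, 'c, 'y) hom_coalgebra_scheme"
  and actC :: "'h \<Rightarrow> 'c \<Rightarrow> 'c" +
  assumes act_comult: "\<lbrakk>h \<in> carrier H; c \<in> carrier C\<rbrakk> \<Longrightarrow>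
      comult C (actC h c) =
      sweedler K (tensor K C C) (comult H h) (\<lambda>h1 h2.
        sweedler K (tensor K C C) (comult C c) (\<lambda>c1 c2. tens K C C (actC h1 c1) (actC h2 c2)))"
    and act_counit: "\<lbrakk>h \<in> carrier H; c \<in> carrier C\<rbrakk>
      \<Longrightarrow> counit C (actC h c) = counit H h \<otimes>\<^bsub>K\<^esub> counit C c"


section \<open>Doi-Hopf data and Doi-Hopf modules\<close>

locale doi_hopf_datum =
  H: hom_hopf_algebra K H + A: hom_comodule_algebra K H A rhoA + C: hom_module_coalgebra K H C actC
  for K :: "('k, 'z) ring_scheme"
  and H :: "('k, 'h, 'w) hom_coalgebra_scheme"
  and A :: "('k, 'a, 'x) hom_space_scheme"
  and rhoA :: "'a \<Rightarrow> ('k, 'a, 'h) tensor"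
  and C :: "('k, 'c, 'y) hom_coalgebra_scheme"
  and actC :: "'h \<Rightarrow> 'c \<Rightarrow> 'c"

record ('k, 'a, 'c, 'm) doi_hopf_module = "('k, 'm) hom_space" +
  act :: "'a \<Rightarrow> 'm \<Rightarrow> 'm"
  coact :: "'m \<Rightarrow> ('k, 'm, 'c) tensor"

locale doi_hopf_module =
  D: doi_hopf_datum K H A rhoA C actC + M: hom_left_module K A M "act M" +
  M: hom_right_comodule K C M "coact M"
  for K :: "('k, 'z) ring_scheme"
  and H :: "('k, 'h, 'w) hom_coalgebra_scheme"
  and A :: "('k, 'a, 'x) hom_space_scheme"
  and rhoA :: "'a \<Rightarrow> ('k, 'a, 'h) tensor"
  and C :: "('k, 'c, 'y) hom_coalgebra_scheme"
  and actC :: "'h \<Rightarrow> 'c \<Rightarrow> 'c"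
  and M :: "('k, 'a, 'c, 'm) doi_hopf_module" +
  assumes coact_act: "\<lbrakk>a \<in> carrier A; m \<in> carrier M\<rbrakk> \<Longrightarrow>
      coact M (act M a m) =
      sweedler K (tensor K M C) (rhoA a) (\<lambda>a0 a1.
        sweedler K (tensor K M C) (coact M m) (\<lambda>m0 m1. tens K M C (act M a0 m0) (actC a1 m1)))"

definition doi_hopf_hom ::
  "('k, 'z) ring_scheme \<Rightarrow> ('k, 'a, 'x) hom_space_scheme \<Rightarrow> ('k, 'c, 'y) hom_coalgebra_scheme
    \<Rightarrow> ('k, 'a, 'c, 'm) doi_hopf_module \<Rightarrow> ('k, 'a, 'c, 'n) doi_hopf_module \<Rightarrow> ('m \<Rightarrow> 'n) \<Rightarrow> bool" where
  "doi_hopf_hom K A C M N f \<longleftrightarrow>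
     linear_map K M N f \<and>
     (\<forall>m\<in>carrier M. f (twist M m) = twist N (f m)) \<and>
     (\<forall>a\<in>carrier A. \<forall>m\<in>carrier M. f (act M a m) = act N a (f m)) \<and>
     (\<forall>m\<in>carrier M. coact N (f m) = tensor_map K N C f (\<lambda>c. c) (coact M m))"

definition doi_hopf_iso ::
  "('k, 'z) ring_scheme \<Rightarrow> ('k, 'h, 'w) hom_coalgebra_scheme \<Rightarrow> ('k, 'a, 'x) hom_space_scheme
    \<Rightarrow> ('a \<Rightarrow> ('k, 'a, 'h) tensor) \<Rightarrow> ('k, 'c, 'y) hom_coalgebra_scheme \<Rightarrow> ('h \<Rightarrow> 'c \<Rightarrow> 'c)
    \<Rightarrow> ('k, 'a, 'c, 'm) doi_hopf_module \<Rightarrow> ('k, 'a, 'c, 'n) doi_hopf_module \<Rightarrow> bool" where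
  "doi_hopf_iso K H A rhoA C actC M N \<longleftrightarrow>
     doi_hopf_module K H A rhoA C actC M \<and>
     doi_hopf_module K H A rhoA C actC N \<and>
     (\<exists>f g. doi_hopf_hom K A C M N f \<and> doi_hopf_hom K A C N M g \<and>
        (\<forall>m\<in>carrier M. g (f m) = m) \<and> (\<forall>n\<in>carrier N. f (g n) = n))"

definition make_doi_hopf_module ::
  "('k, 'm, 'x) module_scheme \<Rightarrow> ('m \<Rightarrow> 'm) \<Rightarrow> ('a \<Rightarrow> 'm \<Rightarrow> 'm) \<Rightarrow> ('m \<Rightarrow> ('k, 'm, 'c) tensor)
    \<Rightarrow> ('k, 'a, 'c, 'm) doi_hopf_module" where
  "make_doi_hopf_module V t a r =
     \<lparr>carrier = carrier V, mult = mult V, one = one V, zero = zero V, add = add V,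
      smult = smult V, twist = t, act = a, coact = r\<rparr>"


section \<open>Monoidal Doi-Hopf data\<close>

locale monoidal_doi_hopf_datum =
  doi_hopf_datum K H A rhoA C actC + A: hom_bialgebra K A + C: hom_bialgebra K C
  for K :: "('k, 'z) ring_scheme"
  and H :: "('k, 'h, 'w) hom_coalgebra_scheme"
  and A :: "('k, 'a, 'x) hom_coalgebra_scheme"
  and rhoA :: "'a \<Rightarrow> ('k, 'a, 'h) tensor"
  and C :: "('k, 'c, 'y) hom_coalgebra_scheme"
  and actC :: "'h \<Rightarrow> 'c \<Rightarrow> 'c" +
  assumes monoidal_mult: "\<lbrakk>a \<in> carrier A; c \<in> carrier C; d \<in> carrier C\<rbrakk> \<Longrightarrow>
      sweedler K (tensor3 K A A C) (rhoA a) (\<lambda>a0 a1.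
        sweedler K (tensor3 K A A C) (comult A a0) (\<lambda>a01 a02.
          tens3 K A A C a01 a02 (actC (twist H (twist H a1)) (c \<otimes>\<^bsub>C\<^esub> d)))) =
      sweedler K (tensor3 K A A C) (comult A a) (\<lambda>a1 a2.
        sweedler K (tensor3 K A A C) (rhoA a1) (\<lambda>a10 a11.
          sweedler K (tensor3 K A A C) (rhoA a2) (\<lambda>a20 a21.
            tens3 K A A C a10 a20 (actC a11 c \<otimes>\<^bsub>C\<^esub> actC a21 d))))"
    and monoidal_unit: "a \<in> carrier A \<Longrightarrow>
      counit A a \<odot>\<^bsub>C\<^esub> \<one>\<^bsub>C\<^esub> =
      sweedler K C (rhoA a) (\<lambda>a0 a1. counit A a0 \<odot>\<^bsub>C\<^esub> actC a1 \<one>\<^bsub>C\<^esub>)"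

text \<open>The triple \<open>(id, id, \<gamma>)\<close> is a monoidal morphism \<open>(H, A, C) \<rightarrow> (H, A, C')\<close>.\<close>
locale monoidal_doi_hopf_morphism =
  D: monoidal_doi_hopf_datum K H A rhoA C actC + D': monoidal_doi_hopf_datum K H A rhoA C' actC'
  for K :: "('k, 'z) ring_scheme"
  and H :: "('k, 'h, 'w) hom_coalgebra_scheme"
  and A :: "('k, 'a, 'x) hom_coalgebra_scheme"
  and rhoA :: "'a \<Rightarrow> ('k, 'a, 'h) tensor"
  and C :: "('k, 'c, 'y) hom_coalgebra_scheme"
  and actC :: "'h \<Rightarrow> 'c \<Rightarrow> 'c"
  and C' :: "('k, 'd, 'q) hom_coalgebra_scheme"
  and actC' :: "'h \<Rightarrow> 'd \<Rightarrow> 'd"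
  and \<gamma> :: "'c \<Rightarrow> 'd" +
  assumes \<gamma>_bialgebra_map: "hom_bialgebra_map K C C' \<gamma>"
    and \<gamma>_act: "\<lbrakk>h \<in> carrier H; c \<in> carrier C\<rbrakk> \<Longrightarrow> \<gamma> (actC h c) = actC' h (\<gamma> c)"

definition doi_hopf_tensor ::
  "('k, 'z) ring_scheme \<Rightarrow> ('k, 'a, 'x) hom_coalgebra_scheme \<Rightarrow> ('k, 'c, 'y) hom_coalgebra_scheme
    \<Rightarrow> ('k, 'a, 'c, 'm) doi_hopf_module \<Rightarrow> ('k, 'a, 'c, 'n) doi_hopf_module
    \<Rightarrow> ('k, 'a, 'c, ('k, 'm, 'n) tensor) doi_hopf_module" where
  "doi_hopf_tensor K A C M N =
     make_doi_hopf_module (tensor K M N)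
       (tensor_map K M N (twist M) (twist N))
       (\<lambda>a X. sweedler K (tensor K M N) (comult A a) (\<lambda>a1 a2.
          tensor_map K M N (act M a1) (act N a2) X))
       (\<lambda>X. sweedler K (tensor3 K M N C) X (\<lambda>m n.
          sweedler K (tensor3 K M N C) (coact M m) (\<lambda>m0 m1.
            sweedler K (tensor3 K M N C) (coact N n) (\<lambda>n0 n1.
              tens3 K M N C m0 n0 (untwist C (untwist C (m1 \<otimes>\<^bsub>C\<^esub> n1)))))))"

text \<open>\<open>C\<close> as a Doi-Hopf module over \<open>(H, A, C)\<close>.\<close>
definition doi_hopf_self ::
  "('k, 'z) ring_scheme \<Rightarrow> ('k, 'a, 'x) hom_coalgebra_scheme \<Rightarrow> ('a \<Rightarrow> ('k, 'a, 'h) tensor)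
    \<Rightarrow> ('k, 'c, 'y) hom_coalgebra_scheme \<Rightarrow> ('h \<Rightarrow> 'c \<Rightarrow> 'c)
    \<Rightarrow> ('k, 'a, 'c, 'c) doi_hopf_module" where
  "doi_hopf_self K A rhoA C actC =
     make_doi_hopf_module C
       (twist C)
       (\<lambda>a c. sweedler K C (rhoA a) (\<lambda>a0 a1. counit A a0 \<odot>\<^bsub>C\<^esub> actC a1 c))
       (\<lambda>c. tensor_map K C C (\<lambda>c1. c1) (untwist C) (comult C c))"


section \<open>The functors \<open>F\<close> and \<open>G\<close>\<close>

text \<open>\<open>F(M) = A \<otimes>\<^sub>A M\<close>. Maps out of the quotient are evaluated on representatives.\<close>

definition balanced_relations ::
  "('k, 'z) ring_scheme \<Rightarrow> ('k, 'a, 'x) hom_space_scheme \<Rightarrow> ('k, 'a, 'c, 'm) doi_hopf_module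
    \<Rightarrow> ('k, 'a, 'm) tensor set" where
  "balanced_relations K A M =
     span_in K (tensor K A M)
       {tens K A M (b \<otimes>\<^bsub>A\<^esub> a) (twist M m) \<ominus>\<^bsub>tensor K A M\<^esub> tens K A M (twist A b) (act M a m) | a b m.
          a \<in> carrier A \<and> b \<in> carrier A \<and> m \<in> carrier M}"

definition balanced_tensor ::
  "('k, 'z) ring_scheme \<Rightarrow> ('k, 'a, 'x) hom_space_scheme \<Rightarrow> ('k, 'a, 'c, 'm) doi_hopf_module
    \<Rightarrow> ('k, ('k, 'a, 'm) tensor set) module" where
  "balanced_tensor K A M = quotient_module (tensor K A M) (balanced_relations K A M)"

definition balanced_class ::
  "('k, 'z) ring_scheme \<Rightarrow> ('k, 'a, 'x) hom_space_scheme \<Rightarrow> ('k, 'a, 'c, 'm) doi_hopf_module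
    \<Rightarrow> ('k, 'a, 'm) tensor \<Rightarrow> ('k, 'a, 'm) tensor set" where
  "balanced_class K A M X = balanced_relations K A M +>\<^bsub>tensor K A M\<^esub> X"

definition induction_functor ::
  "('k, 'z) ring_scheme \<Rightarrow> ('k, 'a, 'x) hom_space_scheme \<Rightarrow> ('a \<Rightarrow> ('k, 'a, 'h) tensor)
    \<Rightarrow> ('k, 'd, 'y) hom_coalgebra_scheme \<Rightarrow> ('h \<Rightarrow> 'd \<Rightarrow> 'd) \<Rightarrow> ('c \<Rightarrow> 'd)
    \<Rightarrow> ('k, 'a, 'c, 'm) doi_hopf_module
    \<Rightarrow> ('k, 'a, 'd, ('k, 'a, 'm) tensor set) doi_hopf_module" where
  "induction_functor K A rhoA C' actC' \<gamma> M =
    (let F = balanced_tensor K A M; cls = balanced_class K A M in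
     make_doi_hopf_module F
       (\<lambda>Y. the_elem ((\<lambda>X. cls (tensor_map K A M (twist A) (twist M) X)) ` Y))
       (\<lambda>a Y. the_elem ((\<lambda>X. cls (tensor_map K A M (\<lambda>b. twist A a \<otimes>\<^bsub>A\<^esub> b) (twist M) X)) ` Y))
       (\<lambda>Y. the_elem ((\<lambda>X.
          sweedler K (tensor K F C') X (\<lambda>b m.
            sweedler K (tensor K F C') (rhoA b) (\<lambda>b0 b1.
              sweedler K (tensor K F C') (coact M m) (\<lambda>m0 m1.
                tens K F C' (cls (tens K A M b0 m0))
                  (untwist C' (untwist C' (actC' b1 (\<gamma> m1)))))))) ` Y)))"

text \<open>
  \<open>G(N) = N \<box> C\<close> is a subspace of \<open>N \<otimes> C\<close>. The formula for its coaction gives elements of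
  \<open>(N \<otimes> C) \<otimes> C\<close>; they are pulled back along the map \<open>G(N) \<otimes> C \<rightarrow> (N \<otimes> C) \<otimes> C\<close> induced by the
  inclusion, which is injective because \<open>K\<close> is a field.
\<close>

definition cotensor ::
  "('k, 'z) ring_scheme \<Rightarrow> ('k, 'c, 'x) hom_coalgebra_scheme \<Rightarrow> ('k, 'd, 'y) hom_coalgebra_scheme
    \<Rightarrow> ('c \<Rightarrow> 'd) \<Rightarrow> ('k, 'a, 'd, 'n) doi_hopf_module \<Rightarrow> ('k, ('k, 'n, 'c) tensor) module" where
  "cotensor K C C' \<gamma> N = (tensor K N C)\<lparr>carrier :=
     {X \<in> carrier (tensor K N C).
        sweedler K (tensor3 K N C' C) X (\<lambda>n c.
          sweedler K (tensor3 K N C' C) (comult C c) (\<lambda>c1 c2.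
            tens3 K N C' C (twist N n) (\<gamma> c1) c2)) =
        sweedler K (tensor3 K N C' C) X (\<lambda>n c.
          sweedler K (tensor3 K N C' C) (coact N n) (\<lambda>n0 n1.
            tens3 K N C' C n0 n1 (twist C c)))}\<rparr>"

definition cotensor_functor ::
  "('k, 'z) ring_scheme \<Rightarrow> ('a \<Rightarrow> ('k, 'a, 'h) tensor)
    \<Rightarrow> ('k, 'c, 'x) hom_coalgebra_scheme \<Rightarrow> ('h \<Rightarrow> 'c \<Rightarrow> 'c) \<Rightarrow> ('k, 'd, 'y) hom_coalgebra_scheme
    \<Rightarrow> ('c \<Rightarrow> 'd) \<Rightarrow> ('k, 'a, 'd, 'n) doi_hopf_module
    \<Rightarrow> ('k, 'a, 'c, ('k, 'n, 'c) tensor) doi_hopf_module" where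
  "cotensor_functor K rhoA C actC C' \<gamma> N =
    (let G = cotensor K C C' \<gamma> N in
     make_doi_hopf_module G
       (tensor_map K N C (twist N) (twist C))
       (\<lambda>a X. sweedler K (tensor K N C) (rhoA a) (\<lambda>a0 a1.
          tensor_map K N C (act N a0) (actC a1) X))
       (\<lambda>X. inv_into (carrier (tensor K G C)) (tensor_map K (tensor K N C) C (\<lambda>Y. Y) (\<lambda>c. c))
          (sweedler K (tensor3 K N C C) X (\<lambda>n c.
             sweedler K (tensor3 K N C C) (comult C c) (\<lambda>c1 c2.
               tens3 K N C C (twist N n) c1 (untwist C c2))))))"

end

theory Submission
  imports Defs
begin

text \<open>
  The theorem is a projection formula. The functor \<open>F\<close> only pushes the coaction forward along
  \<open>\<gamma>\<close>: the map \<open>b \<otimes> m \<mapsto> \<alpha>\<^sup>-\<^sup>1(b \<cdot> m)\<close> identifies \<open>A \<otimes>\<^sub>A M\<close> with the space \<open>M\<close> itself, now with action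
  \<open>\<alpha>(a) \<cdot> m\<close> and coaction \<open>m\<^sub>0 \<otimes> \<alpha>\<^sup>-\<^sup>1(\<gamma>(m\<^sub>1))\<close> (\<open>twisted_module\<close>, \<open>induction_iso_twisted\<close>). Write
  \<open>M'\<close> for it. On the other side, \<open>G(N)\<close> is the equalizer of two maps \<open>L, R : N \<otimes> C \<rightarrow> N \<otimes> C' \<otimes> C\<close>
  inside the cofree Doi-Hopf module \<open>P(N) = N \<otimes> C\<close> (\<open>cofree_module\<close>, \<open>cotensor_doi_hopf_module\<close>).

  For \<open>N = C'\<close> the map \<open>\<epsilon> \<otimes> id\<close> sends \<open>G(C')\<close> to \<open>C\<close>, with inverse
  \<open>c \<mapsto> \<gamma>(c\<^sub>1) \<otimes> \<alpha>\<^sup>-\<^sup>1(c\<^sub>2)\<close> (\<open>cotensor_self_iso\<close>).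

  For the second isomorphism consider
  \<open>\<Phi> : M \<otimes> P(N) \<rightarrow> P(M' \<otimes> N)\<close>, \<open>m \<otimes> (n \<otimes> c) \<mapsto> (\<alpha>(m\<^sub>0) \<otimes> n) \<otimes> \<alpha>\<^sup>-\<^sup>2(m\<^sub>1 c)\<close>.
  It is a morphism of Doi-Hopf modules (\<open>left_transfer_hom\<close>), and it is bijective when \<open>C\<close> has an
  antipode, because \<open>m \<otimes> c \<mapsto> m\<^sub>0 \<otimes> S(m\<^sub>1) c\<close> inverts \<open>m \<otimes> c \<mapsto> m\<^sub>0 \<otimes> m\<^sub>1 c\<close> up to twists
  (\<open>untranslate_translate\<close>, \<open>translate_untranslate\<close>). It remains to see that \<open>\<Phi>\<close> carries
  \<open>M \<otimes> G(N)\<close> onto \<open>G(M' \<otimes> N)\<close>. Over a field, tensoring with \<open>M\<close> preserves equalizers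
  (\<open>kernel_splitting\<close>, \<open>splitting_tensor_right\<close>), so \<open>M \<otimes> G(N)\<close> is the equalizer of \<open>id \<otimes> L\<close> and
  \<open>id \<otimes> R\<close>. The maps \<open>L', R'\<close> that define \<open>G(M' \<otimes> N)\<close> satisfy \<open>L' \<Phi> = \<Theta> (id \<otimes> L)\<close> and
  \<open>R' \<Phi> = \<Theta> (id \<otimes> R)\<close> with the same map
  \<open>\<Theta>(m \<otimes> (n \<otimes> d \<otimes> c)) = \<alpha>(m\<^sub>0\<^sub>0) \<otimes> n \<otimes> \<alpha>\<^sup>-\<^sup>2(\<gamma>(m\<^sub>0\<^sub>1) d) \<otimes> \<alpha>\<^sup>-\<^sup>2(\<alpha>(m\<^sub>1) c)\<close>,
  and \<open>\<Theta>\<close> is injective, being a composite of two maps of the same kind as \<open>\<Phi>\<close>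
  (\<open>double_translate_inj\<close>, \<open>transfer_bijective\<close>). Arguing with \<open>\<Theta>\<close> instead of with
  \<open>\<Phi>\<^sup>-\<^sup>1\<close> keeps the comultiplication from ever being applied to a value of \<open>S\<close>. With \<open>c m\<^sub>1\<close> in place
  of \<open>m\<^sub>1 c\<close> and a twisted antipode, the same argument gives the third isomorphism.

  All identities between these maps are calculations with Sweedler sums. The function \<open>sw\<close>
  evaluates such a sum and carries the spaces as explicit arguments; linear maps pass through it,
  it evaluates on simple tensors, and nested sums flatten. These laws are rewrite rules whose side
  conditions are closure and linearity, so that a calculation is a simplification, guided by
  coassociativity and by chosen instances of the exchange of two independent sums.
\<close>

section \<open>Vector spaces, quotients and free modules\<close>

lemma linear_mapI:
  assumes "\<And>x. x \<in> carrier V \<Longrightarrow> f x \<in> carrier W"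
    and "\<And>x y. x \<in> carrier V \<Longrightarrow> y \<in> carrier V \<Longrightarrow> f (x \<oplus>\<^bsub>V\<^esub> y) = f x \<oplus>\<^bsub>W\<^esub> f y"
    and "\<And>a x. a \<in> carrier K \<Longrightarrow> x \<in> carrier V \<Longrightarrow> f (a \<odot>\<^bsub>V\<^esub> x) = a \<odot>\<^bsub>W\<^esub> f x"
  shows "linear_map K V W f"
  using assms unfolding linear_map_def by auto

lemma linear_mapD:
  assumes "linear_map K V W f"
  shows "x \<in> carrier V \<Longrightarrow> f x \<in> carrier W"
    and "x \<in> carrier V \<Longrightarrow> y \<in> carrier V \<Longrightarrow> f (x \<oplus>\<^bsub>V\<^esub> y) = f x \<oplus>\<^bsub>W\<^esub> f y"
    and "a \<in> carrier K \<Longrightarrow> x \<in> carrier V \<Longrightarrow> f (a \<odot>\<^bsub>V\<^esub> x) = a \<odot>\<^bsub>W\<^esub> f x"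
  using assms unfolding linear_map_def by auto

lemma linear_map_zero:
  assumes "module K V" "module K W" "linear_map K V W f"
  shows "f \<zero>\<^bsub>V\<^esub> = \<zero>\<^bsub>W\<^esub>"
proof -
  interpret V: module K V by fact
  interpret W: module K W by fact
  have "f (\<zero>\<^bsub>K\<^esub> \<odot>\<^bsub>V\<^esub> \<zero>\<^bsub>V\<^esub>) = \<zero>\<^bsub>K\<^esub> \<odot>\<^bsub>W\<^esub> f \<zero>\<^bsub>V\<^esub>"
    using linear_mapD[OF assms(3)] by blast
  then show ?thesis using linear_mapD(1)[OF assms(3)] by simp
qed

lemma linear_map_minus:
  assumes "module K V" "module K W" "linear_map K V W f" "x \<in> carrier V" "y \<in> carrier V"
  shows "f (x \<ominus>\<^bsub>V\<^esub> y) = f x \<ominus>\<^bsub>W\<^esub> f y"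
proof -
  interpret V: module K V by fact
  interpret W: module K W by fact
  have "f (\<ominus>\<^bsub>V\<^esub> y) = f ((\<ominus>\<^bsub>K\<^esub> \<one>\<^bsub>K\<^esub>) \<odot>\<^bsub>V\<^esub> y)"
    using assms V.smult_l_minus[of "\<one>\<^bsub>K\<^esub>" y] by simp
  also have "\<dots> = \<ominus>\<^bsub>W\<^esub> f y"
    using assms(5) linear_mapD[OF assms(3)] W.smult_l_minus[of "\<one>\<^bsub>K\<^esub>" "f y"] by simp
  finally show ?thesis
    using assms(4,5) linear_mapD[OF assms(3)] by (simp add: V.minus_eq W.minus_eq)
qed

lemma linear_map_cong:
  assumes "module K V" "\<And>x. x \<in> carrier V \<Longrightarrow> f x = g x"
  shows "linear_map K V W f = linear_map K V W g"
proof -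
  interpret V: module K V by fact
  show ?thesis unfolding linear_map_def using assms(2) by (auto simp: Pi_def)
qed

lemma linear_map_comp:
  assumes "linear_map K V W f" "linear_map K W U g"
  shows "linear_map K V U (\<lambda>x. g (f x))"
  using assms unfolding linear_map_def by (auto simp: Pi_def)

lemma submodule_kernel:
  assumes "module K V" "module K W" "linear_map K V W f" "linear_map K V W g"
  shows "submodule {x \<in> carrier V. f x = g x} K V"
proof -
  interpret V: module K V by fact
  interpret W: module K W by fact
  note lin = linear_mapD[OF assms(3)] linear_mapD[OF assms(4)]
  have neg: "h (\<ominus>\<^bsub>V\<^esub> x) = \<ominus>\<^bsub>W\<^esub> h x" if "linear_map K V W h" "x \<in> carrier V" for h x
    using linear_map_minus[OF assms(1,2) that(1) V.zero_closed that(2)]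
      linear_map_zero[OF assms(1,2) that(1)] linear_mapD(1)[OF that(1)] that(2)
    by (simp add: V.minus_eq W.minus_eq)
  show ?thesis
    by (rule V.submoduleI)
      (auto simp: lin neg assms(3,4) linear_map_zero[OF assms(1,2)])
qed

lemma span_in_least: "submodule N K V \<Longrightarrow> S \<subseteq> N \<Longrightarrow> span_in K V S \<subseteq> N"
  by (auto simp: span_in_def)

lemma span_in_superset: "S \<subseteq> span_in K V S"
  by (auto simp: span_in_def)

lemma span_in_submodule:
  assumes "module K V" "S \<subseteq> carrier V"
  shows "submodule (span_in K V S) K V"
proof -
  interpret V: module K V by fact
  note E = V.submoduleE
  have c: "submodule (carrier V) K V" by (rule V.carrier_is_submodule)
  have z: "\<zero>\<^bsub>V\<^esub> \<in> N" if "submodule N K V" for N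
    using subgroup.one_closed[OF submodule.axioms(1)[OF that]] by simp
  show ?thesis
    by (rule V.submoduleI) (use assms(2) c E z in \<open>auto simp: span_in_def\<close>)
qed

locale submodule_of = V: module K V for K and V (structure) +
  fixes N assumes sub: "submodule N K V"
begin

sublocale N: abelian_subgroup N V
  using submodule.axioms(1)[OF sub] V.abelian_group_axioms
  by (intro abelian_subgroupI3 additive_subgroup.intro)

lemma coset_eq_iff:
  assumes "x \<in> carrier V" "y \<in> carrier V"
  shows "N +> x = N +> y \<longleftrightarrow> x \<ominus> y \<in> N"
proof
  assume "N +> x = N +> y"
  then have "x \<in> N +> y" using N.a_rcos_self[OF assms(1)] by simp
  then show "x \<ominus> y \<in> N" using assms N.a_rcos_module[OF assms(2,1)]
    by (simp add: V.minus_eq)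
next
  assume "x \<ominus> y \<in> N"
  then have "x \<in> N +> y" using assms N.a_rcos_module[OF assms(2,1)]
    by (simp add: V.minus_eq)
  then show "N +> x = N +> y" using assms N.a_repr_independence' by metis
qed

lemma coset_smult:
  assumes "a \<in> carrier K" "x \<in> carrier V"
  shows "(\<Union>y\<in>N +> x. N +> (a \<odot> y)) = N +> (a \<odot> x)"
proof -
  have "N +> (a \<odot> y) = N +> (a \<odot> x)" if y: "y \<in> N +> x" for y
  proof -
    have yc: "y \<in> carrier V" using y assms(2) N.a_elemrcos_carrier by blast
    have "N +> x = N +> y" using N.a_repr_independence'[OF y assms(2)] .
    then have "y \<ominus> x \<in> N" using coset_eq_iff[OF yc assms(2)] by simp
    then have "a \<odot> (y \<ominus> x) \<in> N" using V.submoduleE(4)[OF sub assms(1)] by blast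
    moreover have "a \<odot> (y \<ominus> x) = a \<odot> y \<ominus> a \<odot> x"
      using assms yc by (simp add: V.minus_eq V.smult_r_distr V.smult_r_minus)
    ultimately show ?thesis using coset_eq_iff assms yc by simp
  qed
  then show ?thesis using N.a_rcos_self[OF assms(2)] by blast
qed

abbreviation Q where "Q \<equiv> quotient_module V N"

lemma quotient_carrier: "carrier Q = (\<lambda>x. N +> x) ` carrier V"
  by (auto simp: quotient_module_def A_RCOSETS_def')

lemma quotient_add: "x \<in> carrier V \<Longrightarrow> y \<in> carrier V \<Longrightarrow> (N +> x) \<oplus>\<^bsub>Q\<^esub> (N +> y) = N +> (x \<oplus> y)"
  by (simp add: quotient_module_def N.a_rcos_sum)

lemma quotient_smult: "a \<in> carrier K \<Longrightarrow> x \<in> carrier V \<Longrightarrow> a \<odot>\<^bsub>Q\<^esub> (N +> x) = N +> (a \<odot> x)"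
  by (simp add: quotient_module_def coset_smult)

lemma quotient_zero: "\<zero>\<^bsub>Q\<^esub> = N +> \<zero>"
  using V.a_coset_add_zero[OF N.a_subset] by (simp add: quotient_module_def)

lemma quotient_module: "module K Q"
proof (rule moduleI)
  show "cring K" by (rule V.R.cring_axioms)
  show "abelian_group Q"
  proof (rule abelian_groupI)
    fix X assume "X \<in> carrier Q"
    then obtain x where x: "X = N +> x" "x \<in> carrier V" by (auto simp: quotient_carrier)
    show "\<exists>Y\<in>carrier Q. Y \<oplus>\<^bsub>Q\<^esub> X = \<zero>\<^bsub>Q\<^esub>"
      by (rule bexI[of _ "N +> (\<ominus> x)"]) (use x in \<open>auto simp: quotient_add quotient_carrier quotient_zero V.l_neg\<close>)
  qed (auto simp: quotient_carrier quotient_add quotient_zero V.a_ac)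
qed (auto simp: quotient_carrier quotient_add quotient_smult V.smult_l_distr V.smult_r_distr V.smult_assoc1)

lemma projection_linear: "linear_map K V Q (\<lambda>x. N +> x)"
  by (rule linear_mapI) (auto simp: quotient_carrier quotient_add quotient_smult)

end

lemma free_module_module:
  assumes "field K"
  shows "module K (free_module K S)"
proof -
  interpret K: field K by fact
  let ?L = "free_module K S"
  have fin: "finite {s. f s \<oplus>\<^bsub>K\<^esub> g s \<noteq> \<zero>\<^bsub>K\<^esub>} \<and> {s. f s \<oplus>\<^bsub>K\<^esub> g s \<noteq> \<zero>\<^bsub>K\<^esub>} \<subseteq> S"
    if "f \<in> carrier ?L" "g \<in> carrier ?L" for f g
  proof -
    have sub: "{s. f s \<oplus>\<^bsub>K\<^esub> g s \<noteq> \<zero>\<^bsub>K\<^esub>} \<subseteq> {s. f s \<noteq> \<zero>\<^bsub>K\<^esub>} \<union> {s. g s \<noteq> \<zero>\<^bsub>K\<^esub>}"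
      by auto
    have "finite ({s. f s \<noteq> \<zero>\<^bsub>K\<^esub>} \<union> {s. g s \<noteq> \<zero>\<^bsub>K\<^esub>})"
      "{s. f s \<noteq> \<zero>\<^bsub>K\<^esub>} \<union> {s. g s \<noteq> \<zero>\<^bsub>K\<^esub>} \<subseteq> S"
      using that by (auto simp: free_module_def)
    then show ?thesis using finite_subset[OF sub] sub by blast
  qed
  have fin2: "finite {s. a \<otimes>\<^bsub>K\<^esub> f s \<noteq> \<zero>\<^bsub>K\<^esub>} \<and> {s. a \<otimes>\<^bsub>K\<^esub> f s \<noteq> \<zero>\<^bsub>K\<^esub>} \<subseteq> S"
    if "f \<in> carrier ?L" "a \<in> carrier K" for f a
  proof -
    have sub: "{s. a \<otimes>\<^bsub>K\<^esub> f s \<noteq> \<zero>\<^bsub>K\<^esub>} \<subseteq> {s. f s \<noteq> \<zero>\<^bsub>K\<^esub>}"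
      using that by auto
    have "finite {s. f s \<noteq> \<zero>\<^bsub>K\<^esub>}" "{s. f s \<noteq> \<zero>\<^bsub>K\<^esub>} \<subseteq> S"
      using that by (auto simp: free_module_def)
    then show ?thesis using finite_subset[OF sub] sub by blast
  qed
  show ?thesis
  proof (rule moduleI)
    show "cring K" by (rule K.cring_axioms)
    show "abelian_group ?L"
    proof (rule abelian_groupI)
      fix x assume x: "x \<in> carrier ?L"
      then show "\<exists>y\<in>carrier ?L. y \<oplus>\<^bsub>?L\<^esub> x = \<zero>\<^bsub>?L\<^esub>"
        by (intro bexI[of _ "\<lambda>s. (\<ominus>\<^bsub>K\<^esub> \<one>\<^bsub>K\<^esub>) \<otimes>\<^bsub>K\<^esub> x s"])
          (use fin2[OF x, of "\<ominus>\<^bsub>K\<^esub> \<one>\<^bsub>K\<^esub>"] in \<open>auto simp: free_module_def K.l_minus K.l_neg\<close>)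
    next
      fix x y assume "x \<in> carrier ?L" "y \<in> carrier ?L"
      then show "x \<oplus>\<^bsub>?L\<^esub> y \<in> carrier ?L" using fin[of x y]
        by (simp add: free_module_def)
    qed (auto simp: free_module_def K.a_ac)
  next
    fix a x assume "a \<in> carrier K" "x \<in> carrier ?L"
    then show "a \<odot>\<^bsub>?L\<^esub> x \<in> carrier ?L" using fin2[of x a]
      by (simp add: free_module_def)
  qed (auto simp: free_module_def K.l_distr K.r_distr K.m_assoc)
qed

lemma free_gen_closed:
  assumes "field K" "s \<in> S"
  shows "free_gen K s \<in> carrier (free_module K S)"
proof -
  interpret K: field K by fact
  show ?thesis using assms(2) by (auto simp: free_gen_def free_module_def)
qed

text \<open>The linear map on the free module that extends \<open>f\<close>.\<close>
definition free_eval :: "('k, 'z) ring_scheme \<Rightarrow> ('k, 'u, 'q) module_scheme \<Rightarrow> ('s \<Rightarrow> 'u) \<Rightarrow> ('s \<Rightarrow> 'k) \<Rightarrow> 'u"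
  where "free_eval K U f r = (\<Oplus>\<^bsub>U\<^esub>p\<in>{p. r p \<noteq> \<zero>\<^bsub>K\<^esub>}. r p \<odot>\<^bsub>U\<^esub> f p)"

lemma free_eval_superset:
  assumes "field K" "module K U" "r \<in> carrier (free_module K S)" "f \<in> S \<rightarrow> carrier U"
    and T: "finite T" "{p. r p \<noteq> \<zero>\<^bsub>K\<^esub>} \<subseteq> T" "T \<subseteq> S"
  shows "free_eval K U f r = (\<Oplus>\<^bsub>U\<^esub>p\<in>T. r p \<odot>\<^bsub>U\<^esub> f p)"
proof -
  interpret K: field K by fact
  interpret U: module K U by fact
  show ?thesis unfolding free_eval_def
    by (rule U.add.finprod_mono_neutral_cong_left) (use assms in \<open>auto simp: free_module_def Pi_iff subset_iff\<close>)
qed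

lemma free_eval_linear:
  assumes "field K" "module K U" "f \<in> S \<rightarrow> carrier U"
  shows "linear_map K (free_module K S) U (free_eval K U f)"
proof -
  interpret K: field K by fact
  interpret U: module K U by fact
  interpret L: module K "free_module K S" by (rule free_module_module) fact
  note sup = free_eval_superset[OF assms(1,2) _ assms(3)]
  have rK: "r s \<in> carrier K" if "r \<in> carrier (free_module K S)" for r s
    using that by (simp add: free_module_def)
  show ?thesis
  proof (rule linear_mapI)
    fix r assume r: "r \<in> carrier (free_module K S)"
    then show "free_eval K U f r \<in> carrier U" unfolding free_eval_def
      using assms(3) by (intro U.finsum_closed) (auto simp: free_module_def)
    fix a assume a: "a \<in> carrier K"
    let ?T = "{p. r p \<noteq> \<zero>\<^bsub>K\<^esub>}"
    have T: "finite ?T" "?T \<subseteq> S" using r by (auto simp: free_module_def)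
    have "free_eval K U f (a \<odot>\<^bsub>free_module K S\<^esub> r)
        = (\<Oplus>\<^bsub>U\<^esub>p\<in>?T. (a \<odot>\<^bsub>free_module K S\<^esub> r) p \<odot>\<^bsub>U\<^esub> f p)"
    proof (rule sup)
      show "a \<odot>\<^bsub>free_module K S\<^esub> r \<in> carrier (free_module K S)" using a r by blast
    qed (use a r T in \<open>auto simp: free_module_def\<close>)
    also have "\<dots> = (\<Oplus>\<^bsub>U\<^esub>p\<in>?T. a \<odot>\<^bsub>U\<^esub> (r p \<odot>\<^bsub>U\<^esub> f p))"
    proof (rule U.finsum_cong')
      fix p assume "p \<in> ?T"
      then have "f p \<in> carrier U" using T assms(3) by blast
      then show "(a \<odot>\<^bsub>free_module K S\<^esub> r) p \<odot>\<^bsub>U\<^esub> f p = a \<odot>\<^bsub>U\<^esub> (r p \<odot>\<^bsub>U\<^esub> f p)"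
        using a rK[OF r] by (simp add: free_module_def U.smult_assoc1)
    next
      show "(\<lambda>p. a \<odot>\<^bsub>U\<^esub> (r p \<odot>\<^bsub>U\<^esub> f p)) \<in> ?T \<rightarrow> carrier U"
        using a T(2) rK[OF r] assms(3) by (auto simp: Pi_def subset_iff)
    qed (rule refl)
    also have "\<dots> = a \<odot>\<^bsub>U\<^esub> free_eval K U f r" unfolding free_eval_def
      by (rule U.finsum_smult_ldistr[symmetric]) (use a T rK[OF r] assms(3) in \<open>auto simp: Pi_def subset_iff\<close>)
    finally show "free_eval K U f (a \<odot>\<^bsub>free_module K S\<^esub> r) = a \<odot>\<^bsub>U\<^esub> free_eval K U f r" .
  next
    fix r r' assume r: "r \<in> carrier (free_module K S)" and r': "r' \<in> carrier (free_module K S)"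
    let ?T = "{p. r p \<noteq> \<zero>\<^bsub>K\<^esub>} \<union> {p. r' p \<noteq> \<zero>\<^bsub>K\<^esub>}"
    have T: "finite ?T" "?T \<subseteq> S" using r r' by (auto simp: free_module_def)
    have fT: "f p \<in> carrier U" if "p \<in> ?T" for p
      using T(2) assms(3) that by blast
    have cl: "(\<lambda>p. r p \<odot>\<^bsub>U\<^esub> f p) \<in> ?T \<rightarrow> carrier U" "(\<lambda>p. r' p \<odot>\<^bsub>U\<^esub> f p) \<in> ?T \<rightarrow> carrier U"
      using fT rK[OF r] rK[OF r'] by (simp_all add: Pi_def)
    have "free_eval K U f (r \<oplus>\<^bsub>free_module K S\<^esub> r')
        = (\<Oplus>\<^bsub>U\<^esub>p\<in>?T. (r \<oplus>\<^bsub>free_module K S\<^esub> r') p \<odot>\<^bsub>U\<^esub> f p)"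
    proof (rule sup)
      show "r \<oplus>\<^bsub>free_module K S\<^esub> r' \<in> carrier (free_module K S)" using r r' by blast
    qed (use r r' T in \<open>auto simp: free_module_def\<close>)
    also have "\<dots> = (\<Oplus>\<^bsub>U\<^esub>p\<in>?T. r p \<odot>\<^bsub>U\<^esub> f p \<oplus>\<^bsub>U\<^esub> r' p \<odot>\<^bsub>U\<^esub> f p)"
    proof (rule U.finsum_cong')
      fix p assume "p \<in> ?T"
      then have "f p \<in> carrier U" using T assms(3) by blast
      then show "(r \<oplus>\<^bsub>free_module K S\<^esub> r') p \<odot>\<^bsub>U\<^esub> f p = r p \<odot>\<^bsub>U\<^esub> f p \<oplus>\<^bsub>U\<^esub> r' p \<odot>\<^bsub>U\<^esub> f p"
        using U.smult_l_distr[OF rK[OF r] rK[OF r']] by (simp add: free_module_def)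
    next
      show "(\<lambda>p. r p \<odot>\<^bsub>U\<^esub> f p \<oplus>\<^bsub>U\<^esub> r' p \<odot>\<^bsub>U\<^esub> f p) \<in> ?T \<rightarrow> carrier U"
        using cl by (auto intro!: U.a_closed simp: Pi_def)
    qed (rule refl)
    also have "\<dots> = (\<Oplus>\<^bsub>U\<^esub>p\<in>?T. r p \<odot>\<^bsub>U\<^esub> f p) \<oplus>\<^bsub>U\<^esub> (\<Oplus>\<^bsub>U\<^esub>p\<in>?T. r' p \<odot>\<^bsub>U\<^esub> f p)"
      by (rule U.finsum_addf) (rule cl T(1))+
    also have "(\<Oplus>\<^bsub>U\<^esub>p\<in>?T. r p \<odot>\<^bsub>U\<^esub> f p) = free_eval K U f r"
      by (rule sup[symmetric]) (use r T in auto)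
    also have "(\<Oplus>\<^bsub>U\<^esub>p\<in>?T. r' p \<odot>\<^bsub>U\<^esub> f p) = free_eval K U f r'"
      by (rule sup[symmetric]) (use r' T in auto)
    finally show "free_eval K U f (r \<oplus>\<^bsub>free_module K S\<^esub> r') = free_eval K U f r \<oplus>\<^bsub>U\<^esub> free_eval K U f r'" .
  qed
qed

lemma free_eval_gen:
  assumes "field K" "module K U" "f s \<in> carrier U"
  shows "free_eval K U f (free_gen K s) = f s"
proof -
  interpret K: field K by fact
  interpret U: module K U by fact
  have *: "{p. free_gen K s p \<noteq> \<zero>\<^bsub>K\<^esub>} = {s}" by (auto simp: free_gen_def)
  show ?thesis unfolding free_eval_def *
    using assms(3) by (simp add: free_gen_def)
qed

lemma free_module_induct:
  assumes "field K" "r \<in> carrier (free_module K S)" "submodule N K (free_module K S)"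
    and gen: "\<And>s. s \<in> S \<Longrightarrow> free_gen K s \<in> N"
  shows "r \<in> N"
proof -
  interpret K: field K by fact
  let ?L = "free_module K S"
  interpret L: module K ?L by (rule free_module_module) fact
  have *: "r \<in> N" if "finite T" "T \<subseteq> S" "r \<in> carrier ?L" "{s. r s \<noteq> \<zero>\<^bsub>K\<^esub>} \<subseteq> T" for T r
    using that
  proof (induct T arbitrary: r)
    case empty
    then have "r = \<zero>\<^bsub>?L\<^esub>" by (auto simp: free_module_def)
    then show ?case using subgroup.one_closed[OF submodule.axioms(1)[OF assms(3)]] by simp
  next
    case (insert s T)
    let ?r = "r(s := \<zero>\<^bsub>K\<^esub>)"
    have sT: "{t. ?r t \<noteq> \<zero>\<^bsub>K\<^esub>} \<subseteq> T" using insert(6) by auto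
    have 1: "?r \<in> N"
      using finite_subset[OF sT insert(1)] sT insert(4,5)
      by (intro insert(3)) (auto simp: free_module_def)
    have "r s \<in> carrier K" using insert(5) by (simp add: free_module_def)
    then have 2: "r s \<odot>\<^bsub>?L\<^esub> free_gen K s \<in> N"
      using L.submoduleE(4)[OF assms(3)] insert(4) gen by blast
    have 3: "r = ?r \<oplus>\<^bsub>?L\<^esub> (r s \<odot>\<^bsub>?L\<^esub> free_gen K s)"
      using insert(5) by (auto simp: free_module_def free_gen_def fun_eq_iff)
    show ?case by (subst 3) (rule L.submoduleE(5)[OF assms(3) 1 2])
  qed
  have "finite {s. r s \<noteq> \<zero>\<^bsub>K\<^esub>}" "{s. r s \<noteq> \<zero>\<^bsub>K\<^esub>} \<subseteq> S"
    using assms(2) by (auto simp: free_module_def)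
  from *[OF this assms(2)] show ?thesis by simp
qed

section \<open>Tensor products\<close>

lemma module_minus_eq_zero:
  assumes "module K V" "x \<in> carrier V" "y \<in> carrier V"
  shows "x \<ominus>\<^bsub>V\<^esub> y = \<zero>\<^bsub>V\<^esub> \<longleftrightarrow> x = y"
proof -
  interpret V: module K V by fact
  have "x = y" if "x \<oplus>\<^bsub>V\<^esub> \<ominus>\<^bsub>V\<^esub> y = \<zero>\<^bsub>V\<^esub>"
    using V.minus_equality[OF that] assms by simp
  then show ?thesis using assms by (auto simp: V.minus_eq V.r_neg)
qed

lemma bilinear_mapI:
  assumes "\<And>v. v \<in> carrier V \<Longrightarrow> linear_map K W U (f v)"
    and "\<And>w. w \<in> carrier W \<Longrightarrow> linear_map K V U (\<lambda>v. f v w)"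
  shows "bilinear_map K V W U f"
  using assms unfolding bilinear_map_def by auto

lemma bilinear_mapD:
  assumes "bilinear_map K V W U f"
  shows "v \<in> carrier V \<Longrightarrow> linear_map K W U (f v)"
    and "w \<in> carrier W \<Longrightarrow> linear_map K V U (\<lambda>v. f v w)"
    and "v \<in> carrier V \<Longrightarrow> w \<in> carrier W \<Longrightarrow> f v w \<in> carrier U"
  using assms unfolding bilinear_map_def linear_map_def by auto

lemma linear_map_add:
  assumes "module K W" "linear_map K V W f" "linear_map K V W g"
  shows "linear_map K V W (\<lambda>x. f x \<oplus>\<^bsub>W\<^esub> g x)"
proof -
  interpret W: module K W by fact
  note lin = linear_mapD[OF assms(2)] linear_mapD[OF assms(3)]
  show ?thesis
    by (rule linear_mapI) (simp_all add: lin W.smult_r_distr W.a_ac)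
qed

lemma linear_map_smult:
  assumes "module K W" "linear_map K V W f" "a \<in> carrier K"
  shows "linear_map K V W (\<lambda>x. a \<odot>\<^bsub>W\<^esub> f x)"
proof -
  interpret W: module K W by fact
  note lin = linear_mapD[OF assms(2)]
  show ?thesis
    by (rule linear_mapI)
      (simp_all add: lin assms(3) W.smult_r_distr W.smult_assoc1[symmetric] W.R.m_comm)
qed

lemma free_ext:
  assumes "field K" "module K U"
    and "linear_map K (free_module K S) U f" "linear_map K (free_module K S) U g"
    and "\<And>s. s \<in> S \<Longrightarrow> f (free_gen K s) = g (free_gen K s)" "r \<in> carrier (free_module K S)"
  shows "f r = g r"
proof -
  have "r \<in> {x \<in> carrier (free_module K S). f x = g x}"
    by (rule free_module_induct[OF assms(1,6)
          submodule_kernel[OF free_module_module[OF assms(1)] assms(2-4)]])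
      (simp add: assms(5) free_gen_closed[OF assms(1)])
  then show ?thesis by simp
qed

text \<open>The guard makes \<open>tensor_rep\<close> a formal combination of pairs of vectors unconditionally:
  congruence, closure, linearity in \<open>f\<close> and interchange of two sums then need no hypothesis on
  \<open>X\<close>.\<close>
definition tensor_rep :: "('k, 'z) ring_scheme \<Rightarrow> ('k, 'v, 'x) module_scheme \<Rightarrow> ('k, 'w, 'y) module_scheme
    \<Rightarrow> ('k, 'v, 'w) tensor \<Rightarrow> ('v \<times> 'w \<Rightarrow> 'k)" where
  "tensor_rep K V W X = (if module K V \<and> module K W \<and> X \<in> carrier (tensor K V W)
     then SOME r. r \<in> X else (\<lambda>_. \<zero>\<^bsub>K\<^esub>))"

text \<open>The Sweedler sum \<open>\<Sum> f v\<^sub>i w\<^sub>i\<close> for \<open>X = \<Sum> v\<^sub>i \<otimes> w\<^sub>i\<close>. The spaces \<open>V\<close> and \<open>W\<close> are arguments so that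
  rewriting can read off the term where the bound variables live.\<close>
definition sw :: "('k, 'z) ring_scheme \<Rightarrow> ('k, 'v, 'x) module_scheme \<Rightarrow> ('k, 'w, 'y) module_scheme \<Rightarrow> ('k, 'u, 'q) module_scheme
    \<Rightarrow> ('k, 'v, 'w) tensor \<Rightarrow> ('v \<Rightarrow> 'w \<Rightarrow> 'u) \<Rightarrow> 'u" where
  "sw K V W U X f = free_eval K U (\<lambda>p. f (fst p) (snd p)) (tensor_rep K V W X)"

locale ground_field =
  fixes K :: "('k, 'z) ring_scheme" (structure)
  assumes K_field: "field K"
begin

lemma tensor_relations_locale:
  assumes "module K V" "module K W"
  shows "submodule_of K (free_module K (carrier V \<times> carrier W)) (tensor_relations K V W)"
proof -
  let ?L = "free_module K (carrier V \<times> carrier W)"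
  interpret V: module K V by fact
  interpret W: module K W by fact
  interpret L: module K ?L by (rule free_module_module[OF K_field])
  have "bilinear_relations K V W \<subseteq> carrier ?L"
    by (auto simp: bilinear_relations_def Let_def free_gen_closed[OF K_field])
  then have "submodule (tensor_relations K V W) K ?L"
    unfolding tensor_relations_def by (rule span_in_submodule[OF L.module_axioms])
  then show ?thesis
    by (intro submodule_of.intro submodule_of_axioms.intro L.module_axioms)
qed

lemma tensor_module [simp]:
  assumes "module K V" "module K W"
  shows "module K (tensor K V W)"
  unfolding tensor_def by (rule submodule_of.quotient_module[OF tensor_relations_locale[OF assms]])

lemma tensor_carrier:
  assumes "module K V" "module K W"
  shows "carrier (tensor K V W) =
    (\<lambda>r. tensor_relations K V W +>\<^bsub>free_module K (carrier V \<times> carrier W)\<^esub> r)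
      ` carrier (free_module K (carrier V \<times> carrier W))"
  unfolding tensor_def by (rule submodule_of.quotient_carrier[OF tensor_relations_locale[OF assms]])

lemma tens_bilinear:
  assumes "module K V" "module K W"
  shows "bilinear_map K V W (tensor K V W) (tens K V W)"
proof -
  let ?L = "free_module K (carrier V \<times> carrier W)"
  let ?N = "tensor_relations K V W"
  interpret V: module K V by fact
  interpret W: module K W by fact
  interpret T: submodule_of K ?L ?N by (rule tensor_relations_locale[OF assms])
  have rel: "x \<ominus>\<^bsub>?L\<^esub> y \<in> bilinear_relations K V W \<Longrightarrow> x \<in> carrier ?L \<Longrightarrow> y \<in> carrier ?L
    \<Longrightarrow> ?N +>\<^bsub>?L\<^esub> x = ?N +>\<^bsub>?L\<^esub> y" for x y
    using T.coset_eq_iff[of x y] span_in_superset[of "bilinear_relations K V W" K ?L]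
    unfolding tensor_relations_def by blast
  have gc: "free_gen K (v, w) \<in> carrier ?L" if "v \<in> carrier V" "w \<in> carrier W" for v w
    using free_gen_closed[OF K_field, of _ "carrier V \<times> carrier W"] that by simp
  have 1: "tens K V W (v \<oplus>\<^bsub>V\<^esub> v') w = tens K V W v w \<oplus>\<^bsub>tensor K V W\<^esub> tens K V W v' w"
    if v: "v \<in> carrier V" "v' \<in> carrier V" "w \<in> carrier W" for v v' w
  proof -
    have "tens K V W (v \<oplus>\<^bsub>V\<^esub> v') w = ?N +>\<^bsub>?L\<^esub> (free_gen K (v, w) \<oplus>\<^bsub>?L\<^esub> free_gen K (v', w))"
      unfolding tens_def
      by (rule rel) (use v in \<open>auto simp: gc bilinear_relations_def Let_def\<close>)
    then show ?thesis using T.quotient_add[OF gc gc, of v w v' w] v by (simp add: tens_def tensor_def)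
  qed
  have 2: "tens K V W v (w \<oplus>\<^bsub>W\<^esub> w') = tens K V W v w \<oplus>\<^bsub>tensor K V W\<^esub> tens K V W v w'"
    if v: "v \<in> carrier V" "w \<in> carrier W" "w' \<in> carrier W" for v w w'
  proof -
    have "tens K V W v (w \<oplus>\<^bsub>W\<^esub> w') = ?N +>\<^bsub>?L\<^esub> (free_gen K (v, w) \<oplus>\<^bsub>?L\<^esub> free_gen K (v, w'))"
      unfolding tens_def
      by (rule rel) (use v in \<open>auto simp: gc bilinear_relations_def Let_def\<close>)
    then show ?thesis using T.quotient_add[OF gc gc, of v w v w'] v by (simp add: tens_def tensor_def)
  qed
  have 3: "tens K V W (a \<odot>\<^bsub>V\<^esub> v) w = a \<odot>\<^bsub>tensor K V W\<^esub> tens K V W v w"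
    if v: "v \<in> carrier V" "a \<in> carrier K" "w \<in> carrier W" for v a w
  proof -
    have "tens K V W (a \<odot>\<^bsub>V\<^esub> v) w = ?N +>\<^bsub>?L\<^esub> (a \<odot>\<^bsub>?L\<^esub> free_gen K (v, w))"
      unfolding tens_def
      by (rule rel) (use v in \<open>auto simp: gc bilinear_relations_def Let_def\<close>)
    then show ?thesis using T.quotient_smult[OF v(2) gc, of v w] v by (simp add: tens_def tensor_def)
  qed
  have 4: "tens K V W v (a \<odot>\<^bsub>W\<^esub> w) = a \<odot>\<^bsub>tensor K V W\<^esub> tens K V W v w"
    if v: "v \<in> carrier V" "a \<in> carrier K" "w \<in> carrier W" for v a w
  proof -
    have "tens K V W v (a \<odot>\<^bsub>W\<^esub> w) = ?N +>\<^bsub>?L\<^esub> (a \<odot>\<^bsub>?L\<^esub> free_gen K (v, w))"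
      unfolding tens_def
      by (rule rel) (use v in \<open>auto simp: gc bilinear_relations_def Let_def\<close>)
    then show ?thesis using T.quotient_smult[OF v(2) gc, of v w] v by (simp add: tens_def tensor_def)
  qed
  have 0: "tens K V W v w \<in> carrier (tensor K V W)" if "v \<in> carrier V" "w \<in> carrier W" for v w
    unfolding tens_def tensor_carrier[OF assms] using that gc by auto
  show ?thesis by (intro bilinear_mapI linear_mapI) (auto simp: 0 1 2 3 4)
qed

lemma tensor_induct:
  assumes "module K V" "module K W" "X \<in> carrier (tensor K V W)"
    and "submodule N K (tensor K V W)"
    and "\<And>v w. v \<in> carrier V \<Longrightarrow> w \<in> carrier W \<Longrightarrow> tens K V W v w \<in> N"
  shows "X \<in> N"
proof -
  let ?L = "free_module K (carrier V \<times> carrier W)"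
  interpret R: submodule_of K ?L "tensor_relations K V W" by (rule tensor_relations_locale[OF assms(1,2)])
  interpret T: module K "tensor K V W" using assms by simp
  let ?P = "{r \<in> carrier ?L. tensor_relations K V W +>\<^bsub>?L\<^esub> r \<in> N}"
  note lin = linear_mapD[OF R.projection_linear, folded tensor_def]
  obtain r where r: "r \<in> carrier ?L" "X = tensor_relations K V W +>\<^bsub>?L\<^esub> r"
    using assms(3) by (auto simp: tensor_carrier[OF assms(1,2)])
  have neg: "tensor_relations K V W +>\<^bsub>?L\<^esub> (\<ominus>\<^bsub>?L\<^esub> r) = \<ominus>\<^bsub>tensor K V W\<^esub> (tensor_relations K V W +>\<^bsub>?L\<^esub> r)"
    if "r \<in> carrier ?L" for r
    using lin(3)[of "\<ominus> \<one>" r] that R.V.smult_l_minus[of \<one> r] T.smult_l_minus[OF R.V.R.one_closed lin(1)]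
    by (simp add: lin(1))
  have "submodule ?P K ?L"
  proof (rule R.V.submoduleI)
    show "\<zero>\<^bsub>?L\<^esub> \<in> ?P"
      using subgroup.one_closed[OF submodule.axioms(1)[OF assms(4)]] R.quotient_zero
      by (simp add: tensor_def)
  qed (auto simp: lin neg T.submoduleE[OF assms(4)])
  then have "r \<in> ?P"
    by (rule free_module_induct[OF K_field r(1)])
      (use assms(5) in \<open>auto simp: tens_def free_gen_closed[OF K_field]\<close>)
  then show ?thesis using r by simp
qed

lemma tensor_ext:
  assumes "module K V" "module K W" "module K U" "X \<in> carrier (tensor K V W)"
    and "linear_map K (tensor K V W) U f" "linear_map K (tensor K V W) U g"
    and "\<And>v w. v \<in> carrier V \<Longrightarrow> w \<in> carrier W \<Longrightarrow> f (tens K V W v w) = g (tens K V W v w)"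
  shows "f X = g X"
proof -
  have "X \<in> {x \<in> carrier (tensor K V W). f x = g x}"
    by (rule tensor_induct[OF assms(1,2,4) submodule_kernel[OF _ assms(3,5,6)]])
      (use assms bilinear_mapD(3)[OF tens_bilinear] in auto)
  then show ?thesis by simp
qed

text \<open>Evaluation of formal combinations at a bilinear map kills the relations of the tensor product, so
  every representative of a tensor gives the same value.\<close>
lemma sweedler_coset:
  assumes "module K V" "module K W" "module K U" "bilinear_map K V W U f"
    and r: "r \<in> carrier (free_module K (carrier V \<times> carrier W))"
    and X: "X = tensor_relations K V W +>\<^bsub>free_module K (carrier V \<times> carrier W)\<^esub> r" "r' \<in> X"
  shows "free_eval K U (\<lambda>p. f (fst p) (snd p)) r' = free_eval K U (\<lambda>p. f (fst p) (snd p)) r"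
proof -
  let ?L = "free_module K (carrier V \<times> carrier W)"
  let ?N = "tensor_relations K V W"
  let ?e = "free_eval K U (\<lambda>p. f (fst p) (snd p))"
  interpret V: module K V by fact
  interpret W: module K W by fact
  interpret U: module K U by fact
  interpret T: submodule_of K ?L ?N by (rule tensor_relations_locale[OF assms(1,2)])
  have f: "(\<lambda>p. f (fst p) (snd p)) \<in> carrier V \<times> carrier W \<rightarrow> carrier U"
    using bilinear_mapD(3)[OF assms(4)] by auto
  note e = free_eval_linear[OF K_field assms(3) f]
  have gen: "?e (free_gen K (v, w)) = f v w" if "v \<in> carrier V" "w \<in> carrier W" for v w
    using free_eval_gen[OF K_field assms(3), of "\<lambda>p. f (fst p) (snd p)" "(v, w)"] that
      bilinear_mapD(3)[OF assms(4)] by simp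
  note gc = free_gen_closed[OF K_field, of _ "carrier V \<times> carrier W"]
  note b = linear_mapD[OF bilinear_mapD(1)[OF assms(4)]] linear_mapD[OF bilinear_mapD(2)[OF assms(4)]]
  have zero: "linear_map K ?L U (\<lambda>_. \<zero>\<^bsub>U\<^esub>)" by (rule linear_mapI) auto
  have "?N \<subseteq> {x \<in> carrier ?L. ?e x = \<zero>\<^bsub>U\<^esub>}"
    unfolding tensor_relations_def
  proof (rule span_in_least[OF submodule_kernel[OF T.V.module_axioms assms(3) e zero]])
    have "?e (x \<ominus>\<^bsub>?L\<^esub> y) = \<zero>\<^bsub>U\<^esub>" if "x \<in> carrier ?L" "y \<in> carrier ?L" "?e x = ?e y" for x y
      using that linear_map_minus[OF T.V.module_axioms assms(3) e that(1,2)] linear_mapD(1)[OF e]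
      by (simp add: U.minus_eq U.r_neg)
    then show "bilinear_relations K V W \<subseteq> {x \<in> carrier ?L. ?e x = \<zero>\<^bsub>U\<^esub>}"
      by (auto simp: bilinear_relations_def Let_def gc gen linear_mapD[OF e] b)
  qed
  moreover have r': "r' \<in> carrier ?L" using X r T.N.a_elemrcos_carrier by blast
  moreover have "r' \<ominus>\<^bsub>?L\<^esub> r \<in> ?N"
    using X T.coset_eq_iff[OF r' r] T.N.a_repr_independence' r by blast
  ultimately have "?e (r' \<ominus>\<^bsub>?L\<^esub> r) = \<zero>\<^bsub>U\<^esub>" by blast
  then show ?thesis
    using linear_map_minus[OF T.V.module_axioms assms(3) e r' r] linear_mapD(1)[OF e] r r'
      module_minus_eq_zero[OF assms(3)]
    by simp
qed

lemma representative:
  assumes "module K V" "module K W" "X \<in> carrier (tensor K V W)"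
  shows "(SOME r. r \<in> X) \<in> carrier (free_module K (carrier V \<times> carrier W))"
    and "X = tensor_relations K V W +>\<^bsub>free_module K (carrier V \<times> carrier W)\<^esub> (SOME r. r \<in> X)"
proof -
  let ?L = "free_module K (carrier V \<times> carrier W)"
  interpret T: submodule_of K ?L "tensor_relations K V W" by (rule tensor_relations_locale[OF assms(1,2)])
  obtain r where r: "r \<in> carrier ?L" "X = tensor_relations K V W +>\<^bsub>?L\<^esub> r"
    using assms(3) by (auto simp: tensor_carrier[OF assms(1,2)])
  have *: "(SOME r. r \<in> X) \<in> X"
    unfolding r(2) by (rule someI[of "\<lambda>s. s \<in> tensor_relations K V W +>\<^bsub>?L\<^esub> r", OF T.N.a_rcos_self[OF r(1)]])
  show "(SOME r. r \<in> X) \<in> carrier ?L" using * r(1,2) T.N.a_elemrcos_carrier by blast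
  show "X = tensor_relations K V W +>\<^bsub>?L\<^esub> (SOME r. r \<in> X)"
    using T.N.a_repr_independence'[OF _ r(1)] * r(2) by blast
qed

lemma sweedler_sw:
  assumes "module K V" "module K W" "module K U" "X \<in> carrier (tensor K V W)" "bilinear_map K V W U f"
  shows "sweedler K U X f = sw K V W U X f"
proof -
  let ?L = "free_module K (carrier V \<times> carrier W)"
  interpret T: submodule_of K ?L "tensor_relations K V W" by (rule tensor_relations_locale[OF assms(1,2)])
  note rep = representative[OF assms(1,2,4)]
  let ?r = "SOME r. r \<in> X"
  let ?e = "\<lambda>r. free_eval K U (\<lambda>p. f (fst p) (snd p)) r"
  have r: "?r \<in> X" using T.N.a_rcos_self[OF rep(1)] rep(2) by simp
  have "?e ` X = (\<lambda>_. ?e ?r) ` X"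
    by (rule image_cong[OF refl sweedler_coset[OF assms(1-3,5) rep]])
  also have "\<dots> = {?e ?r}" by (rule image_constant[OF r])
  finally show ?thesis using assms by (simp add: sweedler_def sw_def tensor_rep_def free_eval_def)
qed

lemma tensor_rep_closed: "tensor_rep K V W X \<in> carrier (free_module K (carrier V \<times> carrier W))"
proof -
  interpret K: field K by (rule K_field)
  have "(\<lambda>_. \<zero>) \<in> carrier (free_module K (carrier V \<times> carrier W))"
    by (simp add: free_module_def)
  then show ?thesis using representative(1)[of V W X] by (auto simp: tensor_rep_def)
qed

text \<open>A sum only looks at \<open>f\<close> on \<open>A\<close>, whether or not its values lie in \<open>U\<close>. Congruence for Sweedler
  sums has to be of this kind, since it is used on bodies whose closure is not yet established.\<close>
lemma finsum_cong_strong: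
  assumes "\<And>x. x \<in> A \<Longrightarrow> f x = g x"
  shows "finsum U f A = finsum U g A"
proof -
  have sub: "(B, y) \<in> foldSetD D h' e"
    if "(B, y) \<in> foldSetD D h e" "B \<subseteq> A" "\<And>x. x \<in> A \<Longrightarrow> h x = h' x" for B y D e h h'
    using that
  proof (induct rule: foldSetD.induct)
    case (insertI x B y)
    then have "(insert x B, h' x y) \<in> foldSetD D h' e" by (intro foldSetD.insertI) auto
    then show ?case using insertI by simp
  qed (auto intro: foldSetD.emptyI)
  have "(A, y) \<in> foldSetD D (\<lambda>x. add U (f x)) e \<longleftrightarrow> (A, y) \<in> foldSetD D (\<lambda>x. add U (g x)) e" for y D e
    using sub[of A y D "\<lambda>x. add U (f x)" e "\<lambda>x. add U (g x)"]
      sub[of A y D "\<lambda>x. add U (g x)" e "\<lambda>x. add U (f x)"] assms by auto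
  then show ?thesis by (simp add: finsum_def finprod_def foldD_def comp_def)
qed

lemma free_eval_cong:
  assumes "r \<in> carrier (free_module K S)" "\<And>s. s \<in> S \<Longrightarrow> f s = g s"
  shows "free_eval K U f r = free_eval K U g r"
  unfolding free_eval_def
  by (rule finsum_cong_strong) (use assms in \<open>auto simp: free_module_def subset_iff\<close>)

lemma sw_cong:
  assumes "X = X'" "\<And>a b. a \<in> carrier V \<Longrightarrow> b \<in> carrier W \<Longrightarrow> f a b = g a b"
  shows "sw K V W U X f = sw K V W U X' g"
  unfolding sw_def assms(1)
  by (rule free_eval_cong[OF tensor_rep_closed]) (use assms(2) in auto)

lemma sw_closed:
  assumes "module K U" "\<And>a b. a \<in> carrier V \<Longrightarrow> b \<in> carrier W \<Longrightarrow> f a b \<in> carrier U"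
  shows "sw K V W U X f \<in> carrier U"
  unfolding sw_def[of K V W]
  by (rule linear_mapD(1)[OF free_eval_linear[OF K_field assms(1)] tensor_rep_closed[of V W X]])
    (use assms(2) in auto)

lemma linear_sw:
  assumes "module K U" "module K U'" "linear_map K U U' g"
    and "\<And>a b. a \<in> carrier V \<Longrightarrow> b \<in> carrier W \<Longrightarrow> f a b \<in> carrier U"
  shows "g (sw K V W U X f) = sw K V W U' X (\<lambda>a b. g (f a b))"
proof -
  note r = tensor_rep_closed[of V W X]
  have f: "(\<lambda>p. f (fst p) (snd p)) \<in> carrier V \<times> carrier W \<rightarrow> carrier U" using assms(4) by auto
  have gf: "(\<lambda>p. g (f (fst p) (snd p))) \<in> carrier V \<times> carrier W \<rightarrow> carrier U'"
    using assms(4) linear_mapD(1)[OF assms(3)] by auto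
  show ?thesis unfolding sw_def
    by (rule free_ext[OF K_field assms(2) linear_map_comp[OF free_eval_linear[OF K_field assms(1) f] assms(3)]
        free_eval_linear[OF K_field assms(2) gf] _ r])
      (use f gf in \<open>auto simp: free_eval_gen[OF K_field] assms linear_mapD(1)[OF assms(3)]\<close>)
qed

lemma sw_linear_fun:
  assumes "module K U" "module K Z"
    and lin: "\<And>a b. a \<in> carrier V \<Longrightarrow> b \<in> carrier W \<Longrightarrow> linear_map K Z U (\<lambda>x. f x a b)"
  shows "linear_map K Z U (\<lambda>x. sw K V W U X (f x))"
proof -
  let ?r = "tensor_rep K V W X"
  note r = tensor_rep_closed[of V W X]
  interpret U: module K U by fact
  interpret Z: module K Z by fact
  note l = linear_mapD[OF lin]
  have f: "(\<lambda>p. f x (fst p) (snd p)) \<in> carrier V \<times> carrier W \<rightarrow> carrier U" if "x \<in> carrier Z" for x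
    using that l by auto
  note e = free_eval_linear[OF K_field assms(1) f]
  note g = free_eval_gen[OF K_field assms(1)]
  show ?thesis unfolding sw_def[of K V W]
  proof (rule linear_mapI)
    fix x assume x: "x \<in> carrier Z"
    show "free_eval K U (\<lambda>p. f x (fst p) (snd p)) ?r \<in> carrier U"
      by (rule linear_mapD(1)[OF e r]) fact
    fix a assume a: "a \<in> carrier K"
    have ax: "a \<odot>\<^bsub>Z\<^esub> x \<in> carrier Z" using x a by simp
    show "free_eval K U (\<lambda>p. f (a \<odot>\<^bsub>Z\<^esub> x) (fst p) (snd p)) ?r = a \<odot>\<^bsub>U\<^esub> free_eval K U (\<lambda>p. f x (fst p) (snd p)) ?r"
      by (rule free_ext[OF K_field assms(1) e[OF ax] linear_map_smult[OF assms(1) e[OF x] a] _ r])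
        (use x a ax l in \<open>auto simp: g\<close>)
  next
    fix x y assume x: "x \<in> carrier Z" and y: "y \<in> carrier Z"
    have xy: "x \<oplus>\<^bsub>Z\<^esub> y \<in> carrier Z" using x y by simp
    show "free_eval K U (\<lambda>p. f (x \<oplus>\<^bsub>Z\<^esub> y) (fst p) (snd p)) ?r =
      free_eval K U (\<lambda>p. f x (fst p) (snd p)) ?r \<oplus>\<^bsub>U\<^esub> free_eval K U (\<lambda>p. f y (fst p) (snd p)) ?r"
      by (rule free_ext[OF K_field assms(1) e[OF xy] linear_map_add[OF assms(1) e[OF x] e[OF y]] _ r])
        (use x y xy l in \<open>auto simp: g\<close>)
  qed
qed

text \<open>As a rewrite rule this would loop. The calculations below use instances in which \<open>X\<close> and \<open>Y\<close> are
  fixed patterns, such as a coaction and a comultiplication, and which thereby have a direction.\<close>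
lemma sw_exchange:
  assumes "module K U"
    and "\<And>a b c d. a \<in> carrier V \<Longrightarrow> b \<in> carrier W \<Longrightarrow> c \<in> carrier V' \<Longrightarrow> d \<in> carrier W' \<Longrightarrow> f a b c d \<in> carrier U"
  shows "sw K V W U X (\<lambda>a b. sw K V' W' U Y (\<lambda>c d. f a b c d)) = sw K V' W' U Y (\<lambda>c d. sw K V W U X (\<lambda>a b. f a b c d))"
proof -
  note r = tensor_rep_closed[of V W X]
  let ?L = "free_module K (carrier V \<times> carrier W)"
  have lin: "linear_map K ?L U (\<lambda>r. sw K V' W' U Y (\<lambda>c d. free_eval K U (\<lambda>p. f (fst p) (snd p) c d) r))"
    by (intro sw_linear_fun assms(1) free_module_module[OF K_field] free_eval_linear[OF K_field])
      (use assms(2) in auto)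
  have cl: "sw K V' W' U Y (f a b) \<in> carrier U" if "a \<in> carrier V" "b \<in> carrier W" for a b
    using that assms by (auto intro: sw_closed)
  show ?thesis unfolding sw_def[of K V W]
  proof (rule free_ext[OF K_field assms(1) free_eval_linear[OF K_field assms(1)] lin _ r])
    fix s assume s: "s \<in> carrier V \<times> carrier W"
    have "free_eval K U (\<lambda>p. sw K V' W' U Y (f (fst p) (snd p))) (free_gen K s) = sw K V' W' U Y (f (fst s) (snd s))"
      by (rule free_eval_gen[OF K_field assms(1)]) (use s cl in auto)
    also have "\<dots> = sw K V' W' U Y (\<lambda>c d. free_eval K U (\<lambda>p. f (fst p) (snd p) c d) (free_gen K s))"
      by (rule sw_cong[OF refl], rule free_eval_gen[OF K_field assms(1), symmetric]) (use s assms(2) in auto)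
    finally show "free_eval K U (\<lambda>p. sw K V' W' U Y (f (fst p) (snd p))) (free_gen K s) = \<dots>" .
  qed (use cl in auto)
qed

lemma sw_linear_arg:
  assumes "module K V" "module K W" "module K U" "bilinear_map K V W U f"
  shows "linear_map K (tensor K V W) U (\<lambda>X. sw K V W U X f)"
proof -
  let ?L = "free_module K (carrier V \<times> carrier W)"
  let ?e = "free_eval K U (\<lambda>p. f (fst p) (snd p))"
  interpret T: submodule_of K ?L "tensor_relations K V W" by (rule tensor_relations_locale[OF assms(1,2)])
  have f: "(\<lambda>p. f (fst p) (snd p)) \<in> carrier V \<times> carrier W \<rightarrow> carrier U"
    using bilinear_mapD(3)[OF assms(4)] by auto
  note e = linear_mapD[OF free_eval_linear[OF K_field assms(3) f]]
  note q = linear_mapD[OF T.projection_linear, folded tensor_def]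
  have *: "sw K V W U (tensor_relations K V W +>\<^bsub>?L\<^esub> r) f = ?e r" if r: "r \<in> carrier ?L" for r
  proof -
    let ?X = "tensor_relations K V W +>\<^bsub>?L\<^esub> r"
    have X: "?X \<in> carrier (tensor K V W)" using q(1) r .
    have "(SOME r. r \<in> ?X) \<in> ?X" by (rule someI[of "\<lambda>r. r \<in> ?X", OF T.N.a_rcos_self[OF r]])
    then show ?thesis using X assms sweedler_coset[OF assms r refl] by (simp add: sw_def tensor_rep_def)
  qed
  show ?thesis
    by (rule linear_mapI) (auto simp: tensor_carrier[OF assms(1,2)] * e q(1) q(2,3)[symmetric])
qed

lemma sw_tens:
  assumes "module K V" "module K W" "module K U" "bilinear_map K V W U f" "v \<in> carrier V" "w \<in> carrier W"
  shows "sw K V W U (tens K V W v w) f = f v w"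
proof -
  let ?L = "free_module K (carrier V \<times> carrier W)"
  interpret T: submodule_of K ?L "tensor_relations K V W" by (rule tensor_relations_locale[OF assms(1,2)])
  let ?X = "tens K V W v w"
  have X: "?X \<in> carrier (tensor K V W)"
    by (rule bilinear_mapD(3)[OF tens_bilinear[OF assms(1,2)] assms(5,6)])
  have g: "free_gen K (v, w) \<in> carrier ?L" by (rule free_gen_closed[OF K_field]) (use assms(5,6) in simp)
  have "free_gen K (v, w) \<in> ?X" using T.N.a_rcos_self[OF g] by (simp add: tens_def)
  then have some: "(SOME r. r \<in> ?X) \<in> ?X" by (rule someI[of "\<lambda>r. r \<in> ?X"])
  have rep: "tensor_rep K V W ?X = (SOME r. r \<in> ?X)" using assms(1,2) X by (simp add: tensor_rep_def)
  have "sw K V W U ?X f = free_eval K U (\<lambda>p. f (fst p) (snd p)) (free_gen K (v, w))"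
    unfolding sw_def rep by (rule sweedler_coset[OF assms(1-4) g _ some]) (simp add: tens_def)
  also have "\<dots> = f v w"
    using free_eval_gen[OF K_field assms(3), of "\<lambda>p. f (fst p) (snd p)" "(v, w)"]
      bilinear_mapD(3)[OF assms(4)] assms(5,6) by simp
  finally show ?thesis .
qed

lemma sw_same:
  assumes "module K V" "module K W" "X \<in> carrier (tensor K V W)"
  shows "sw K V W (tensor K V W) X (tens K V W) = X"
  by (rule tensor_ext[OF assms(1,2) tensor_module[OF assms(1,2)] assms(3)
        sw_linear_arg[OF assms(1,2) tensor_module[OF assms(1,2)] tens_bilinear[OF assms(1,2)]]])
    (auto simp: sw_tens tens_bilinear assms linear_map_def)

lemma sw_sw:
  assumes "module K V" "module K W" "module K U" "bilinear_map K V W U f"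
    and "\<And>a b. a \<in> carrier V' \<Longrightarrow> b \<in> carrier W' \<Longrightarrow> h a b \<in> carrier (tensor K V W)"
  shows "sw K V W U (sw K V' W' (tensor K V W) Y h) f = sw K V' W' U Y (\<lambda>a b. sw K V W U (h a b) f)"
  by (rule linear_sw[OF tensor_module[OF assms(1,2)] assms(3) sw_linear_arg[OF assms(1-4)] assms(5)])

end

lemma ground_module_module:
  assumes "field K" shows "module K (ground_module K)"
proof -
  interpret field K by fact
  show ?thesis
  proof (rule moduleI)
    show "abelian_group (ground_module K)"
      by (rule abelian_groupI) (auto simp: ground_module_def a_ac intro: l_neg bexI[of _ "\<ominus>\<^bsub>K\<^esub> x" for x])
  qed (auto simp: cring_axioms ground_module_def l_distr r_distr m_assoc)
qed

section \<open>Complements\<close>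

text \<open>By Zorn's lemma there is a maximal subspace meeting \<open>U\<close> trivially. Maximality forces it to be a
  complement of \<open>U\<close>, and \<open>p\<close> projects along it.\<close>
lemma subspace_projection:
  assumes "field K" "module K V" "submodule U K V"
  obtains p where "linear_map K V V p" "\<And>x. x \<in> carrier V \<Longrightarrow> p x \<in> U" "\<And>x. x \<in> U \<Longrightarrow> p x = x"
proof -
  interpret K: field K by fact
  interpret V: module K V by fact
  note U = V.submoduleE[OF assms(3)]
  have z: "\<zero>\<^bsub>V\<^esub> \<in> W" if "submodule W K V" for W
    using subgroup.one_closed[OF submodule.axioms(1)[OF that]] by simp
  define \<W> where "\<W> = {W. submodule W K V \<and> W \<inter> U = {\<zero>\<^bsub>V\<^esub>}}"
  have "{\<zero>\<^bsub>V\<^esub>} \<in> \<W>" using z[OF assms(3)] by (auto simp: \<W>_def intro!: V.submoduleI)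
  then have ne: "\<W> \<noteq> {}" by blast
  have "\<Union>\<C> \<in> \<W>" if C: "\<C> \<noteq> {}" "subset.chain \<W> \<C>" for \<C>
  proof -
    have mem: "submodule W K V \<and> W \<inter> U = {\<zero>\<^bsub>V\<^esub>}" if "W \<in> \<C>" for W
      using C(2) that by (auto simp: \<W>_def subset.chain_def)
    have common: "\<exists>W\<in>\<C>. x \<in> W \<and> y \<in> W" if xy: "x \<in> \<Union>\<C>" "y \<in> \<Union>\<C>" for x y
    proof -
      obtain X Y where XY: "X \<in> \<C>" "x \<in> X" "Y \<in> \<C>" "y \<in> Y" using xy by blast
      have "X \<subseteq> Y \<or> Y \<subseteq> X" using C(2) XY(1,3) by (metis subset_chain_def)
      then show ?thesis using XY by blast
    qed
    have "submodule (\<Union>\<C>) K V"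
    proof (rule V.submoduleI)
      show "\<Union>\<C> \<subseteq> carrier V" using mem V.submoduleE(1) by blast
      show "\<zero>\<^bsub>V\<^esub> \<in> \<Union>\<C>" using C(1) mem z by blast
      show "\<ominus>\<^bsub>V\<^esub> a \<in> \<Union>\<C>" if "a \<in> \<Union>\<C>" for a using that mem V.submoduleE(3) by blast
      show "a \<odot>\<^bsub>V\<^esub> x \<in> \<Union>\<C>" if "a \<in> carrier K" "x \<in> \<Union>\<C>" for a x using that mem V.submoduleE(4) by blast
      show "a \<oplus>\<^bsub>V\<^esub> b \<in> \<Union>\<C>" if "a \<in> \<Union>\<C>" "b \<in> \<Union>\<C>" for a b
        using common[OF that] mem V.submoduleE(5) by blast
    qed
    moreover have "\<Union>\<C> \<inter> U = {\<zero>\<^bsub>V\<^esub>}" using mem C(1) by blast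
    ultimately show ?thesis by (simp add: \<W>_def)
  qed
  then obtain W where W: "W \<in> \<W>" and max: "\<And>X. X \<in> \<W> \<Longrightarrow> W \<subseteq> X \<Longrightarrow> X = W"
    using subset_Zorn_nonempty[OF ne] by blast
  have subW: "submodule W K V" and WU: "W \<inter> U = {\<zero>\<^bsub>V\<^esub>}" using W by (auto simp: \<W>_def)
  note WE = V.submoduleE[OF subW]
  have ex: "\<exists>u\<in>U. \<exists>w\<in>W. v = u \<oplus>\<^bsub>V\<^esub> w" if v: "v \<in> carrier V" for v
  proof -
    define X where "X = {w \<oplus>\<^bsub>V\<^esub> a \<odot>\<^bsub>V\<^esub> v | w a. w \<in> W \<and> a \<in> carrier K}"
    have XI: "w \<oplus>\<^bsub>V\<^esub> a \<odot>\<^bsub>V\<^esub> v \<in> X" if "w \<in> W" "a \<in> carrier K" for w a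
      using that by (auto simp: X_def)
    have WX: "W \<subseteq> X"
    proof
      fix w assume w: "w \<in> W"
      then have "w \<in> carrier V" using WE(1) by blast
      then show "w \<in> X" using XI[OF w K.zero_closed] v by simp
    qed
    have vX: "v \<in> X" using XI[OF z[OF subW] K.one_closed] v by simp
    have Wc: "w \<in> carrier V" if "w \<in> W" for w using WE(1) that by blast
    have "submodule X K V"
    proof (rule V.submoduleI)
      show "X \<subseteq> carrier V" using Wc v by (auto simp: X_def)
      show "\<zero>\<^bsub>V\<^esub> \<in> X" using WX z[OF subW] by blast
      fix x assume "x \<in> X"
      then obtain w a where x: "x = w \<oplus>\<^bsub>V\<^esub> a \<odot>\<^bsub>V\<^esub> v" "w \<in> W" "a \<in> carrier K" by (auto simp: X_def)
      note wc = Wc[OF x(2)]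
      have "\<ominus>\<^bsub>V\<^esub> x = (\<ominus>\<^bsub>V\<^esub> w) \<oplus>\<^bsub>V\<^esub> (\<ominus>\<^bsub>K\<^esub> a) \<odot>\<^bsub>V\<^esub> v"
        using wc x v by (simp add: V.minus_add V.smult_l_minus)
      then show "\<ominus>\<^bsub>V\<^esub> x \<in> X" using XI[OF WE(3)[OF x(2)] K.a_inv_closed[OF x(3)]] by simp
      show "c \<odot>\<^bsub>V\<^esub> x \<in> X" if c: "c \<in> carrier K" for c
      proof -
        have "c \<odot>\<^bsub>V\<^esub> x = c \<odot>\<^bsub>V\<^esub> w \<oplus>\<^bsub>V\<^esub> (c \<otimes>\<^bsub>K\<^esub> a) \<odot>\<^bsub>V\<^esub> v"
          using wc x v c by (simp add: V.smult_r_distr V.smult_assoc1)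
        then show ?thesis using XI[OF WE(4)[OF c x(2)] K.m_closed[OF c x(3)]] by simp
      qed
      fix y assume "y \<in> X"
      then obtain w' b where y: "y = w' \<oplus>\<^bsub>V\<^esub> b \<odot>\<^bsub>V\<^esub> v" "w' \<in> W" "b \<in> carrier K" by (auto simp: X_def)
      have "x \<oplus>\<^bsub>V\<^esub> y = (w \<oplus>\<^bsub>V\<^esub> w') \<oplus>\<^bsub>V\<^esub> (a \<oplus>\<^bsub>K\<^esub> b) \<odot>\<^bsub>V\<^esub> v"
        using wc Wc[OF y(2)] x y v by (simp add: V.smult_l_distr V.a_ac)
      then show "x \<oplus>\<^bsub>V\<^esub> y \<in> X" using XI[OF WE(5)[OF x(2) y(2)] K.a_closed[OF x(3) y(3)]] by simp
    qed
    then consider "v \<in> W" | u where "u \<in> X" "u \<in> U" "u \<noteq> \<zero>\<^bsub>V\<^esub>"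
      using max[OF _ WX] vX z[OF assms(3)] z by (fastforce simp: \<W>_def)
    then show ?thesis
    proof cases
      case 1
      then show ?thesis using z[OF assms(3)] v by (intro bexI[of _ "\<zero>\<^bsub>V\<^esub>"] bexI[of _ v]) auto
    next
      case 2
      then obtain w a where x: "u = w \<oplus>\<^bsub>V\<^esub> a \<odot>\<^bsub>V\<^esub> v" "w \<in> W" "a \<in> carrier K" by (auto simp: X_def)
      have a0: "a \<noteq> \<zero>\<^bsub>K\<^esub>"
      proof
        assume "a = \<zero>\<^bsub>K\<^esub>"
        then have "u = w" using x v Wc by simp
        then show False using 2 x WU by blast
      qed
      have ai: "inv\<^bsub>K\<^esub> a \<in> carrier K" "inv\<^bsub>K\<^esub> a \<otimes>\<^bsub>K\<^esub> a = \<one>\<^bsub>K\<^esub>"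
        using a0 x(3) K.field_Units by auto
      have uc: "u \<in> carrier V" using 2 U(1) by blast
      have "a \<odot>\<^bsub>V\<^esub> v = u \<oplus>\<^bsub>V\<^esub> \<ominus>\<^bsub>V\<^esub> w"
        using x v Wc[OF x(2)] by (simp add: V.a_ac V.r_neg V.r_neg1 V.r_neg2)
      then have "inv\<^bsub>K\<^esub> a \<odot>\<^bsub>V\<^esub> (a \<odot>\<^bsub>V\<^esub> v) = inv\<^bsub>K\<^esub> a \<odot>\<^bsub>V\<^esub> u \<oplus>\<^bsub>V\<^esub> inv\<^bsub>K\<^esub> a \<odot>\<^bsub>V\<^esub> (\<ominus>\<^bsub>V\<^esub> w)"
        using ai uc Wc[OF x(2)] by (simp add: V.smult_r_distr)
      then have "v = inv\<^bsub>K\<^esub> a \<odot>\<^bsub>V\<^esub> u \<oplus>\<^bsub>V\<^esub> inv\<^bsub>K\<^esub> a \<odot>\<^bsub>V\<^esub> (\<ominus>\<^bsub>V\<^esub> w)"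
        using ai x(3) v by (simp add: V.smult_assoc1[symmetric])
      then show ?thesis using U(4)[OF ai(1) 2(2)] WE(4)[OF ai(1) WE(3)[OF x(2)]] by blast
    qed
  qed
  have uniq: "u = u'" if "u \<in> U" "u' \<in> U" "w \<in> W" "w' \<in> W" "u \<oplus>\<^bsub>V\<^esub> w = u' \<oplus>\<^bsub>V\<^esub> w'" for u u' w w'
  proof -
    have c: "u \<in> carrier V" "u' \<in> carrier V" "w \<in> carrier V" "w' \<in> carrier V" using that U(1) WE(1) by auto
    have "u \<ominus>\<^bsub>V\<^esub> u' = (u \<oplus>\<^bsub>V\<^esub> w) \<oplus>\<^bsub>V\<^esub> (\<ominus>\<^bsub>V\<^esub> w \<oplus>\<^bsub>V\<^esub> \<ominus>\<^bsub>V\<^esub> u')"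
      using c by (simp add: V.minus_eq V.a_ac V.r_neg V.r_neg1 V.r_neg2)
    also have "\<dots> = (u' \<oplus>\<^bsub>V\<^esub> \<ominus>\<^bsub>V\<^esub> u') \<oplus>\<^bsub>V\<^esub> (w' \<oplus>\<^bsub>V\<^esub> \<ominus>\<^bsub>V\<^esub> w)"
      unfolding that(5) using c by (simp add: V.a_ac)
    also have "\<dots> = w' \<oplus>\<^bsub>V\<^esub> \<ominus>\<^bsub>V\<^esub> w"
      using c by (simp add: V.r_neg)
    finally have e: "u \<ominus>\<^bsub>V\<^esub> u' = w' \<oplus>\<^bsub>V\<^esub> \<ominus>\<^bsub>V\<^esub> w" .
    have "u \<ominus>\<^bsub>V\<^esub> u' \<in> U" unfolding V.minus_eq by (rule U(5)[OF that(1) U(3)[OF that(2)]])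
    moreover have "u \<ominus>\<^bsub>V\<^esub> u' \<in> W" unfolding e by (rule WE(5)[OF that(4) WE(3)[OF that(3)]])
    ultimately have "u \<ominus>\<^bsub>V\<^esub> u' = \<zero>\<^bsub>V\<^esub>" using WU by blast
    then show ?thesis using module_minus_eq_zero[OF assms(2) c(1,2)] by simp
  qed
  define p where "p v = (THE u. u \<in> U \<and> (\<exists>w\<in>W. v = u \<oplus>\<^bsub>V\<^esub> w))" for v
  have p: "p (u \<oplus>\<^bsub>V\<^esub> w) = u" if "u \<in> U" "w \<in> W" for u w
    unfolding p_def by (rule the_equality) (use that uniq in blast)+
  show ?thesis
  proof
    show "p x \<in> U" if "x \<in> carrier V" for x using ex[OF that] p by force
    show "p x = x" if "x \<in> U" for x
    proof -
      have "x \<in> carrier V" using U(1) that by blast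
      then show ?thesis using p[OF that z[OF subW]] by simp
    qed
    have Uc: "u \<in> carrier V" if "u \<in> U" for u using U(1) that by blast
    have Wc: "u \<in> carrier V" if "u \<in> W" for u using WE(1) that by blast
    show "linear_map K V V p"
    proof (rule linear_mapI)
      fix x assume x: "x \<in> carrier V"
      obtain u w where u: "u \<in> U" "w \<in> W" "x = u \<oplus>\<^bsub>V\<^esub> w" using ex[OF x] by blast
      show "p x \<in> carrier V" using u p Uc by simp
      show "p (a \<odot>\<^bsub>V\<^esub> x) = a \<odot>\<^bsub>V\<^esub> p x" if a: "a \<in> carrier K" for a
        using p[OF u(1,2)] p[OF U(4)[OF a u(1)] WE(4)[OF a u(2)]] u a Uc Wc by (simp add: V.smult_r_distr)
      fix y assume y: "y \<in> carrier V"
      obtain u' w' where u': "u' \<in> U" "w' \<in> W" "y = u' \<oplus>\<^bsub>V\<^esub> w'" using ex[OF y] by blast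
      have "x \<oplus>\<^bsub>V\<^esub> y = (u \<oplus>\<^bsub>V\<^esub> u') \<oplus>\<^bsub>V\<^esub> (w \<oplus>\<^bsub>V\<^esub> w')"
        using u u' Uc Wc by (simp add: V.a_ac)
      then show "p (x \<oplus>\<^bsub>V\<^esub> y) = p x \<oplus>\<^bsub>V\<^esub> p y"
        using p[OF U(5)[OF u(1) u'(1)] WE(5)[OF u(2) u'(2)]] p u u' by simp
    qed
  qed
qed

section \<open>A calculus for Sweedler sums\<close>

text \<open>The rules for linearity match the syntactic form of \<open>f\<close>; this congruence keeps the simplifier from
  rewriting inside \<open>f\<close> first.\<close>
lemma linear_map_weak_cong [cong]: "V = V' \<Longrightarrow> W = W' \<Longrightarrow> linear_map K V W f = linear_map K V' W' f"
  by simp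

lemma linear_map_id [simp]: "linear_map K V V (\<lambda>x. x)"
  by (rule linear_mapI) auto

context ground_field
begin

text \<open>The body of a sum is simplified under the assumption that the bound variables lie in their
  spaces; the side conditions of all other rules depend on this.\<close>
lemmas sw_cong' [cong] = sw_cong

lemma ground_module [simp]: "module K (ground_module K)"
  by (rule ground_module_module[OF K_field])

lemma ground_carrier [simp]: "carrier (ground_module K) = carrier K"
  by (simp add: ground_module_def)

lemma ground_smult [simp]: "smult (ground_module K) = mult K"
  by (simp add: ground_module_def)

lemma tens_closed [simp]:
  "module K V \<Longrightarrow> module K W \<Longrightarrow> v \<in> carrier V \<Longrightarrow> w \<in> carrier W \<Longrightarrow> tens K V W v w \<in> carrier (tensor K V W)"
  by (rule bilinear_mapD(3)[OF tens_bilinear])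

lemma linear_left:
  assumes "bilinear_map K V W U f" "w \<in> carrier W" "linear_map K Z V g"
  shows "linear_map K Z U (\<lambda>x. f (g x) w)"
  by (rule linear_map_comp[OF assms(3) bilinear_mapD(2)[OF assms(1,2)]])

lemma linear_right:
  assumes "bilinear_map K V W U f" "v \<in> carrier V" "linear_map K Z W g"
  shows "linear_map K Z U (\<lambda>x. f v (g x))"
  by (rule linear_map_comp[OF assms(3) bilinear_mapD(1)[OF assms(1,2)]])

lemma smult_bilinear:
  assumes "module K V"
  shows "bilinear_map K (ground_module K) V V (smult V)"
proof -
  interpret V: module K V by fact
  show ?thesis
    by (intro bilinear_mapI linear_mapI)
      (auto simp: ground_module_def V.smult_l_distr V.smult_r_distr V.smult_assoc1[symmetric] V.R.m_comm)
qed

lemma linear_smult [simp]: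
  "module K U \<Longrightarrow> a \<in> carrier K \<Longrightarrow> linear_map K Z U g \<Longrightarrow> linear_map K Z U (\<lambda>x. a \<odot>\<^bsub>U\<^esub> g x)"
  by (rule linear_map_smult)

lemma linear_scalar [simp]:
  "module K U \<Longrightarrow> u \<in> carrier U \<Longrightarrow> linear_map K Z (ground_module K) g \<Longrightarrow> linear_map K Z U (\<lambda>x. g x \<odot>\<^bsub>U\<^esub> u)"
  by (rule linear_left[OF smult_bilinear])

lemma linear_tens_left [simp]:
  "module K V \<Longrightarrow> module K W \<Longrightarrow> w \<in> carrier W \<Longrightarrow> linear_map K Z V g
    \<Longrightarrow> linear_map K Z (tensor K V W) (\<lambda>x. tens K V W (g x) w)"
  by (rule linear_left[OF tens_bilinear])

lemma linear_tens_right [simp]: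
  "module K V \<Longrightarrow> module K W \<Longrightarrow> v \<in> carrier V \<Longrightarrow> linear_map K Z W g
    \<Longrightarrow> linear_map K Z (tensor K V W) (\<lambda>x. tens K V W v (g x))"
  by (rule linear_right[OF tens_bilinear])

lemma linear_sw_fun [simp]:
  "module K U \<Longrightarrow> module K Z
    \<Longrightarrow> (\<And>a b. a \<in> carrier V \<Longrightarrow> b \<in> carrier W \<Longrightarrow> linear_map K Z U (\<lambda>x. f x a b))
    \<Longrightarrow> linear_map K Z U (\<lambda>x. sw K V W U X (\<lambda>a b. f x a b))"
  by (rule sw_linear_fun)

lemma linear_sw_arg [simp]:
  assumes "module K V" "module K W" "module K U" "linear_map K Z (tensor K V W) g"
    and "\<And>a. a \<in> carrier V \<Longrightarrow> linear_map K W U (\<lambda>b. f a b)"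
    and "\<And>b. b \<in> carrier W \<Longrightarrow> linear_map K V U (\<lambda>a. f a b)"
  shows "linear_map K Z U (\<lambda>x. sw K V W U (g x) (\<lambda>a b. f a b))"
  by (rule linear_map_comp[OF assms(4) sw_linear_arg[OF assms(1-3) bilinear_mapI]]) (simp_all add: assms(5,6))

declare sw_closed [simp]

lemma sw_tens' [simp]:
  assumes "module K V" "module K W" "module K U" "v \<in> carrier V" "w \<in> carrier W"
    and "\<And>a. a \<in> carrier V \<Longrightarrow> linear_map K W U (\<lambda>b. f a b)"
    and "\<And>b. b \<in> carrier W \<Longrightarrow> linear_map K V U (\<lambda>a. f a b)"
  shows "sw K V W U (tens K V W v w) (\<lambda>a b. f a b) = f v w"
  by (rule sw_tens[OF assms(1-3) bilinear_mapI assms(4,5)]) (simp_all add: assms(6,7))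

lemma sw_sw' [simp]:
  assumes "module K V" "module K W" "module K U"
    and "\<And>a b. a \<in> carrier V' \<Longrightarrow> b \<in> carrier W' \<Longrightarrow> h a b \<in> carrier (tensor K V W)"
    and "\<And>a. a \<in> carrier V \<Longrightarrow> linear_map K W U (\<lambda>b. f a b)"
    and "\<And>b. b \<in> carrier W \<Longrightarrow> linear_map K V U (\<lambda>a. f a b)"
  shows "sw K V W U (sw K V' W' (tensor K V W) Y (\<lambda>a b. h a b)) (\<lambda>a b. f a b)
    = sw K V' W' U Y (\<lambda>a b. sw K V W U (h a b) (\<lambda>a b. f a b))"
  by (rule sw_sw[OF assms(1-3) bilinear_mapI assms(4)]) (simp_all add: assms(5,6))

lemma sw_id [simp]:
  "module K V \<Longrightarrow> module K W \<Longrightarrow> X \<in> carrier (tensor K V W)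
    \<Longrightarrow> sw K V W (tensor K V W) X (\<lambda>a b. tens K V W a b) = X"
  using sw_same by simp

lemma sw_smult_out [simp]:
  assumes "module K U" "k \<in> carrier K" "\<And>a b. a \<in> carrier V \<Longrightarrow> b \<in> carrier W \<Longrightarrow> f a b \<in> carrier U"
  shows "sw K V W U X (\<lambda>a b. k \<odot>\<^bsub>U\<^esub> f a b) = k \<odot>\<^bsub>U\<^esub> sw K V W U X (\<lambda>a b. f a b)"
  by (rule linear_sw[OF assms(1,1) linear_map_smult[OF assms(1) linear_map_id assms(2)] assms(3), symmetric])

lemma sw_smult_arg [simp]:
  assumes "module K V" "module K W" "module K U" "k \<in> carrier K" "X \<in> carrier (tensor K V W)"
    and "\<And>a. a \<in> carrier V \<Longrightarrow> linear_map K W U (\<lambda>b. f a b)"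
    and "\<And>b. b \<in> carrier W \<Longrightarrow> linear_map K V U (\<lambda>a. f a b)"
  shows "sw K V W U (k \<odot>\<^bsub>tensor K V W\<^esub> X) (\<lambda>a b. f a b) = k \<odot>\<^bsub>U\<^esub> sw K V W U X (\<lambda>a b. f a b)"
  by (rule linear_mapD(3)[OF sw_linear_arg[OF assms(1-3) bilinear_mapI] assms(4,5)]) (simp_all add: assms(6,7))

text \<open>Makes the counit axioms applicable under an arbitrary linear map \<open>g\<close>.\<close>
lemma sw_scaled_linear:
  assumes z: "sw K V W Z X (\<lambda>a b. k a b \<odot>\<^bsub>Z\<^esub> h a b) = z"
    and "module K Z" "module K U" "linear_map K Z U (\<lambda>x. g x)"
    and "\<And>a b. a \<in> carrier V \<Longrightarrow> b \<in> carrier W \<Longrightarrow> k a b \<in> carrier K"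
    and "\<And>a b. a \<in> carrier V \<Longrightarrow> b \<in> carrier W \<Longrightarrow> h a b \<in> carrier Z"
  shows "sw K V W U X (\<lambda>a b. k a b \<odot>\<^bsub>U\<^esub> g (h a b)) = g z"
proof -
  interpret Z: module K Z by fact
  show ?thesis unfolding z[symmetric]
    by (subst linear_sw[OF assms(2-4)]) (simp_all add: assms(5,6) linear_mapD[OF assms(4)])
qed

lemma tens_smult [simp]:
  assumes "module K V" "module K W" "v \<in> carrier V" "w \<in> carrier W" "k \<in> carrier K"
  shows "tens K V W (k \<odot>\<^bsub>V\<^esub> v) w = k \<odot>\<^bsub>tensor K V W\<^esub> tens K V W v w"
    and "tens K V W v (k \<odot>\<^bsub>W\<^esub> w) = k \<odot>\<^bsub>tensor K V W\<^esub> tens K V W v w"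
  by (rule linear_mapD(3)[OF bilinear_mapD(2)[OF tens_bilinear]] linear_mapD(3)[OF bilinear_mapD(1)[OF tens_bilinear]];
      fact assms)+

lemma bilinear_sw_left:
  assumes "bilinear_map K V W U f" "module K V" "module K U" "w \<in> carrier W"
    and "\<And>a b. a \<in> carrier V' \<Longrightarrow> b \<in> carrier W' \<Longrightarrow> h a b \<in> carrier V"
  shows "f (sw K V' W' V X (\<lambda>a b. h a b)) w = sw K V' W' U X (\<lambda>a b. f (h a b) w)"
  by (rule linear_sw[OF assms(2,3) bilinear_mapD(2)[OF assms(1,4)] assms(5)])

lemma bilinear_sw_right:
  assumes "bilinear_map K V W U f" "module K W" "module K U" "v \<in> carrier V"
    and "\<And>a b. a \<in> carrier V' \<Longrightarrow> b \<in> carrier W' \<Longrightarrow> h a b \<in> carrier W"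
  shows "f v (sw K V' W' W X (\<lambda>a b. h a b)) = sw K V' W' U X (\<lambda>a b. f v (h a b))"
  by (rule linear_sw[OF assms(2,3) bilinear_mapD(1)[OF assms(1,4)] assms(5)])

lemma tens_sw [simp]:
  assumes "module K V" "module K W"
  shows "(\<And>a b. a \<in> carrier V' \<Longrightarrow> b \<in> carrier W' \<Longrightarrow> h a b \<in> carrier V) \<Longrightarrow> w \<in> carrier W \<Longrightarrow>
      tens K V W (sw K V' W' V X (\<lambda>a b. h a b)) w = sw K V' W' (tensor K V W) X (\<lambda>a b. tens K V W (h a b) w)"
    and "(\<And>a b. a \<in> carrier V' \<Longrightarrow> b \<in> carrier W' \<Longrightarrow> h' a b \<in> carrier W) \<Longrightarrow> v \<in> carrier V \<Longrightarrow>
      tens K V W v (sw K V' W' W X (\<lambda>a b. h' a b)) = sw K V' W' (tensor K V W) X (\<lambda>a b. tens K V W v (h' a b))"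
  using assms by (simp_all add: bilinear_sw_left[OF tens_bilinear] bilinear_sw_right[OF tens_bilinear])

lemma tensor_map_sw:
  assumes "module K V'" "module K W'" "module K V" "module K W" "linear_map K V' V f" "linear_map K W' W g"
    and "X \<in> carrier (tensor K V' W')"
  shows "tensor_map K V W f g X = sw K V' W' (tensor K V W) X (\<lambda>a b. tens K V W (f a) (g b))"
  unfolding tensor_map_def
  by (rule sweedler_sw[OF assms(1,2) tensor_module[OF assms(3,4)] assms(7)], rule bilinear_mapI)
    (simp_all add: assms linear_mapD(1)[OF assms(5)] linear_mapD(1)[OF assms(6)])

lemma sweedler_sw':
  assumes "module K V" "module K W" "module K U" "X \<in> carrier (tensor K V W)"
    and "\<And>a. a \<in> carrier V \<Longrightarrow> linear_map K W U (\<lambda>b. f a b)"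
    and "\<And>b. b \<in> carrier W \<Longrightarrow> linear_map K V U (\<lambda>a. f a b)"
  shows "sweedler K U X (\<lambda>a b. f a b) = sw K V W U X (\<lambda>a b. f a b)"
  by (rule sweedler_sw[OF assms(1-4) bilinear_mapI]) (simp_all add: assms(5,6))

lemma sweedler_cong:
  assumes "module K V" "module K W" "X \<in> carrier (tensor K V W)"
    and "\<And>a b. a \<in> carrier V \<Longrightarrow> b \<in> carrier W \<Longrightarrow> f a b = g a b"
  shows "sweedler K U X f = sweedler K U X g"
proof -
  let ?L = "free_module K (carrier V \<times> carrier W)"
  interpret T: submodule_of K ?L "tensor_relations K V W" by (rule tensor_relations_locale[OF assms(1,2)])
  have "r \<in> carrier ?L" if "r \<in> X" for r
    using that assms(3) T.N.a_elemrcos_carrier by (auto simp: tensor_carrier[OF assms(1,2)])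
  then have "free_eval K U (\<lambda>p. f (fst p) (snd p)) r = free_eval K U (\<lambda>p. g (fst p) (snd p)) r" if "r \<in> X" for r
    using that by (intro free_eval_cong) (auto simp: assms(4))
  then show ?thesis unfolding sweedler_def
    by (intro arg_cong[where f = the_elem] image_cong refl) (simp add: free_eval_def)
qed

end

text \<open>Tensor products and sums depend on a Doi-Hopf module only through its underlying space. Rewriting
  to that space makes terms over the modules constructed below comparable.\<close>

lemma make_simps [simp]:
  "carrier (make_doi_hopf_module V t a r) = carrier V"
  "add (make_doi_hopf_module V t a r) = add V"
  "zero (make_doi_hopf_module V t a r) = zero V"
  "smult (make_doi_hopf_module V t a r) = smult V"
  "twist (make_doi_hopf_module V t a r) = t"
  "act (make_doi_hopf_module V t a r) = a"
  "coact (make_doi_hopf_module V t a r) = r"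
  by (simp_all add: make_doi_hopf_module_def)

lemma make_module [simp]: "module K (make_doi_hopf_module V t a r) = module K V"
  by (simp add: module_def module_axioms_def abelian_group_def abelian_group_axioms_def abelian_monoid_def
      comm_monoid_def comm_monoid_axioms_def monoid_def comm_group_def group_def group_axioms_def Units_def)

lemma make_linear [simp]:
  "linear_map K (make_doi_hopf_module V t a r) W f = linear_map K V W f"
  "linear_map K U (make_doi_hopf_module V t a r) g = linear_map K U V g"
  by (simp_all add: linear_map_def)

lemma make_tensor_relations [simp]:
  "tensor_relations K (make_doi_hopf_module V t a r) W = tensor_relations K V W"
  "tensor_relations K U (make_doi_hopf_module V t a r) = tensor_relations K U V"
  by (simp_all add: tensor_relations_def bilinear_relations_def)

lemma make_tensor [simp]:
  "tensor K (make_doi_hopf_module V t a r) W = tensor K V W"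
  "tensor K U (make_doi_hopf_module V t a r) = tensor K U V"
  by (simp_all add: tensor_def)

lemma make_tens [simp]:
  "tens K (make_doi_hopf_module V t a r) W = tens K V W"
  "tens K U (make_doi_hopf_module V t a r) = tens K U V"
  by (simp_all add: tens_def fun_eq_iff)

lemma make_free_eval [simp]: "free_eval K (make_doi_hopf_module V t a r) f x = free_eval K V f x"
  by (simp add: free_eval_def finsum_def finprod_def)

lemma make_sw [simp]:
  "sw K (make_doi_hopf_module V t a r) W U X f = sw K V W U X f"
  "sw K W' (make_doi_hopf_module V t a r) U' X' f' = sw K W' V U' X' f'"
  "sw K U'' W'' (make_doi_hopf_module V t a r) X'' f'' = sw K U'' W'' V X'' f''"
  by (simp_all add: sw_def tensor_rep_def)

lemma make_sweedler [simp]: "sweedler K (make_doi_hopf_module V t a r) X f = sweedler K V X f"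
  by (simp add: sweedler_def finsum_def finprod_def)

lemma make_tensor_map [simp]:
  "tensor_map K (make_doi_hopf_module V t a r) W f g X = tensor_map K V W f g X"
  "tensor_map K W' (make_doi_hopf_module V t a r) f' g' X' = tensor_map K W' V f' g' X'"
  by (simp_all add: tensor_map_def)

section \<open>Hom-structures in Sweedler form\<close>

context ground_field
begin

text \<open>The change from \<open>f\<close> to \<open>g\<close> is there for nested sums: the inner sums of \<open>f\<close> are converted first, and
  bilinearity is then checked for the converted body only.\<close>
lemma sweedler_to_sw:
  assumes "module K V" "module K W" "module K U" "X \<in> carrier (tensor K V W)"
    and "\<And>a b. a \<in> carrier V \<Longrightarrow> b \<in> carrier W \<Longrightarrow> f a b = g a b"
    and "\<And>a. a \<in> carrier V \<Longrightarrow> linear_map K W U (\<lambda>b. g a b)"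
    and "\<And>b. b \<in> carrier W \<Longrightarrow> linear_map K V U (\<lambda>a. g a b)"
  shows "sweedler K U X f = sw K V W U X g"
proof -
  have "sweedler K U X f = sweedler K U X g"
    by (rule sweedler_cong[OF assms(1,2,4,5)])
  also have "\<dots> = sw K V W U X g"
    by (rule sweedler_sw'[OF assms(1-4)]) (fact assms)+
  finally show ?thesis .
qed

lemma bilinear_smult_left:
  "bilinear_map K V W U f \<Longrightarrow> w \<in> carrier W \<Longrightarrow> k \<in> carrier K \<Longrightarrow> v \<in> carrier V \<Longrightarrow> f (k \<odot>\<^bsub>V\<^esub> v) w = k \<odot>\<^bsub>U\<^esub> f v w"
  by (rule linear_mapD(3)[OF bilinear_mapD(2)])

lemma bilinear_smult_right:
  "bilinear_map K V W U f \<Longrightarrow> v \<in> carrier V \<Longrightarrow> k \<in> carrier K \<Longrightarrow> w \<in> carrier W \<Longrightarrow> f v (k \<odot>\<^bsub>W\<^esub> w) = k \<odot>\<^bsub>U\<^esub> f v w"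
  by (rule linear_mapD(3)[OF bilinear_mapD(1)])

lemma linear_comp: "linear_map K V W f \<Longrightarrow> linear_map K Z V g \<Longrightarrow> linear_map K Z W (\<lambda>x. f (g x))"
  by (rule linear_map_comp)

lemma linear_sw': "linear_map K U U' g \<Longrightarrow> module K U \<Longrightarrow> module K U' \<Longrightarrow>
  (\<And>a b. a \<in> carrier V \<Longrightarrow> b \<in> carrier W \<Longrightarrow> f a b \<in> carrier U) \<Longrightarrow>
  g (sw K V W U X (\<lambda>a b. f a b)) = sw K V W U' X (\<lambda>a b. g (f a b))"
  by (rule linear_sw)

lemmas bilinear_rules = bilinear_mapD(3) linear_left linear_right bilinear_sw_left bilinear_sw_right
  bilinear_smult_left bilinear_smult_right

lemmas linear_rules = linear_mapD(1) linear_mapD(3) linear_comp linear_sw'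

end

sublocale hom_space \<subseteq> ground_field K
  by unfold_locales

context hom_space
begin

lemma module_space [simp]: "module K V"
  by (rule V.module_axioms)

lemma untwist_twist [simp]: "x \<in> carrier V \<Longrightarrow> untwist V (twist V x) = x"
  unfolding untwist_def by (rule inv_into_f_f[OF bij_betw_imp_inj_on[OF twist_bij]])

lemma twist_untwist [simp]: "x \<in> carrier V \<Longrightarrow> twist V (untwist V x) = x"
  unfolding untwist_def
  by (rule f_inv_into_f) (use twist_bij in \<open>simp add: bij_betw_def\<close>)

lemma untwist_in: "x \<in> carrier V \<Longrightarrow> untwist V x \<in> carrier V"
  unfolding untwist_def using twist_bij by (metis bij_betw_def inv_into_into)

lemma untwist_eq: "x \<in> carrier V \<Longrightarrow> twist V x = y \<Longrightarrow> untwist V y = x"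
  by auto

lemma untwist_linear: "linear_map K V V (untwist V)"
  by (rule linear_mapI; (rule untwist_in untwist_eq)?)
    (simp_all add: untwist_in linear_mapD[OF twist_linear])

lemmas twist_rules [simp] = linear_rules[OF twist_linear]
lemmas untwist_rules [simp] = linear_rules[OF untwist_linear]

end

context hom_algebra
begin

lemmas mult_rules [simp] = bilinear_rules[OF mult_bilinear]
declare unit_closed [simp] twist_mult [simp] twist_unit [simp] unit_left [simp] unit_right [simp]

lemma untwist_mult [simp]:
  "a \<in> carrier A \<Longrightarrow> b \<in> carrier A \<Longrightarrow> untwist A (a \<otimes>\<^bsub>A\<^esub> b) = untwist A a \<otimes>\<^bsub>A\<^esub> untwist A b"
  by (rule untwist_eq) simp_all

lemma untwist_unit [simp]: "untwist A \<one>\<^bsub>A\<^esub> = \<one>\<^bsub>A\<^esub>"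
  by (rule untwist_eq) simp_all

lemma mult_assoc_left: "\<lbrakk>a \<in> carrier A; b \<in> carrier A; c \<in> carrier A\<rbrakk>
      \<Longrightarrow> (a \<otimes>\<^bsub>A\<^esub> b) \<otimes>\<^bsub>A\<^esub> c = twist A a \<otimes>\<^bsub>A\<^esub> (b \<otimes>\<^bsub>A\<^esub> untwist A c)"
  using hom_assoc[of a b "untwist A c"] by simp

end

context hom_coalgebra
begin

lemmas comult_rules [simp] = linear_rules[OF comult_linear]
lemmas counit_rules [simp] = linear_rules[OF counit_linear, unfolded ground_carrier ground_smult]
declare counit_twist [simp]

lemma counit_untwist [simp]: "c \<in> carrier C \<Longrightarrow> counit C (untwist C c) = counit C c"
  using counit_twist[of "untwist C c"] by simp

lemma comult_twist_tensor [simp]: "c \<in> carrier C \<Longrightarrow>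
    comult C (twist C c) = sw K C C (tensor K C C) (comult C c) (\<lambda>x y. tens K C C (twist C x) (twist C y))"
  unfolding comult_twist[symmetric] by (rule tensor_map_sw) simp_all

lemma comult_untwist [simp]:
  assumes "c \<in> carrier C"
  shows "comult C (untwist C c) = sw K C C (tensor K C C) (comult C c) (\<lambda>x y. tens K C C (untwist C x) (untwist C y))"
proof -
  have "sw K C C (tensor K C C) (comult C (twist C (untwist C c))) (\<lambda>x y. tens K C C (untwist C x) (untwist C y))
    = comult C (untwist C c)"
    using assms by (simp del: twist_untwist)
  then show ?thesis using assms by simp
qed

lemma sw_counit_left [simp]:
  assumes "module K U" "c \<in> carrier C" "linear_map K C U (\<lambda>x. g x)"
  shows "sw K C C U (comult C c) (\<lambda>a b. counit C a \<odot>\<^bsub>U\<^esub> g b) = g (twist C c)"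
  by (rule sw_scaled_linear[OF _ module_space assms(1,3)])
    (use assms(2) in \<open>simp_all add: counit_left flip: sweedler_sw'[of C C]\<close>)

lemma sw_counit_right [simp]:
  assumes "module K U" "c \<in> carrier C" "linear_map K C U (\<lambda>x. g x)"
  shows "sw K C C U (comult C c) (\<lambda>a b. counit C b \<odot>\<^bsub>U\<^esub> g a) = g (twist C c)"
  by (rule sw_scaled_linear[OF _ module_space assms(1,3)])
    (use assms(2) in \<open>simp_all add: counit_right flip: sweedler_sw'[of C C]\<close>)

text \<open>Applying the linear map on \<open>C \<otimes> C \<otimes> C\<close> given by \<open>f\<close> to both sides of the coassociativity axiom. The
  orientation pushes repeated comultiplication into the last leg, which gives iterated sums a
  normal form.\<close>
lemma sw_coassoc:
  assumes U: "module K U" and c: "c \<in> carrier C"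
    and f: "\<And>a b. a \<in> carrier C \<Longrightarrow> b \<in> carrier C \<Longrightarrow> linear_map K C U (\<lambda>z. f a b z)"
    "\<And>a b. a \<in> carrier C \<Longrightarrow> b \<in> carrier C \<Longrightarrow> linear_map K C U (\<lambda>z. f a z b)"
    "\<And>a b. a \<in> carrier C \<Longrightarrow> b \<in> carrier C \<Longrightarrow> linear_map K C U (\<lambda>z. f z a b)"
  shows "sw K C C U (comult C c) (\<lambda>c1 c2. sw K C C U (comult C c1) (\<lambda>x y. f x y c2))
    = sw K C C U (comult C c) (\<lambda>c1 c2. sw K C C U (comult C c2) (\<lambda>x y. f (twist C c1) x (untwist C y)))"
proof -
  let ?T = "tensor K (tensor K C C) C"
  let ?F = "\<lambda>Y. sw K (tensor K C C) C U Y (\<lambda>x z. sw K C C U x (\<lambda>v w. f v w (untwist C z)))"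
  have fu: "linear_map K C U (\<lambda>z. f a b (untwist C z))" if "a \<in> carrier C" "b \<in> carrier C" for a b
    by (rule linear_map_comp[OF untwist_linear f(1)[OF that]])
  have "sw K C C ?T (comult C c) (\<lambda>c1 c2. sw K C C ?T (comult C c1) (\<lambda>x y. tens K (tensor K C C) C (tens K C C x y) (twist C c2)))
    = sw K C C ?T (comult C c) (\<lambda>c1 c2. sw K C C ?T (comult C c2) (\<lambda>x y. tens K (tensor K C C) C (tens K C C (twist C c1) x) y))"
    (is "?L = ?R")
    using hom_coassoc[OF c, unfolded tensor3_def tens3_def] c
    by (subst (asm) (1 2) sweedler_to_sw[of C C, OF _ _ _ _ sweedler_to_sw[of C C]])
      simp_all
  then have "?F ?L = ?F ?R" by simp
  then show ?thesis
    using U c f fu by simp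
qed

end

context hom_bialgebra
begin

lemma comult_mult_sw [simp]:
  assumes "a \<in> carrier B" "b \<in> carrier B"
  shows "comult B (a \<otimes>\<^bsub>B\<^esub> b) = sw K B B (tensor K B B) (comult B a) (\<lambda>a1 a2.
    sw K B B (tensor K B B) (comult B b) (\<lambda>b1 b2. tens K B B (a1 \<otimes>\<^bsub>B\<^esub> b1) (a2 \<otimes>\<^bsub>B\<^esub> b2)))"
  unfolding comult_mult[OF assms] tensor_mult_def using assms
  by (subst sweedler_to_sw[of B B, OF _ _ _ _ sweedler_to_sw[of B B]]) simp_all

declare comult_unit [simp] counit_mult [simp] counit_unit [simp]

end

context hom_left_module
begin

lemmas act_rules [simp] = A.bilinear_rules[OF act_bilinear]
declare act_unit [simp] act_twist [simp]

lemma act_untwist [simp]: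
  "a \<in> carrier A \<Longrightarrow> m \<in> carrier M \<Longrightarrow> untwist M (actM a m) = actM (untwist A a) (untwist M m)"
  by (rule M.untwist_eq) simp_all

lemma act_mult:
  "\<lbrakk>a \<in> carrier A; b \<in> carrier A; m \<in> carrier M\<rbrakk>
    \<Longrightarrow> actM (a \<otimes>\<^bsub>A\<^esub> b) m = actM (twist A a) (actM b (untwist M m))"
  using act_assoc[of a b "untwist M m"] by simp

end

context hom_right_comodule
begin

lemmas coact_rules [simp] = C.linear_rules[OF coact_linear]

lemma coact_twist_sw [simp]: "m \<in> carrier M \<Longrightarrow>
    coactM (twist M m) = sw K M C (tensor K M C) (coactM m) (\<lambda>x y. tens K M C (twist M x) (twist C y))"
  unfolding coact_twist[symmetric] by (rule C.tensor_map_sw) simp_all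

lemma coact_untwist [simp]:
  assumes "m \<in> carrier M"
  shows "coactM (untwist M m) = sw K M C (tensor K M C) (coactM m) (\<lambda>x y. tens K M C (untwist M x) (untwist C y))"
proof -
  have "sw K M C (tensor K M C) (coactM (twist M (untwist M m))) (\<lambda>x y. tens K M C (untwist M x) (untwist C y))
    = coactM (untwist M m)"
    using assms by (simp del: M.twist_untwist)
  then show ?thesis using assms by simp
qed

lemma sw_coact_counit [simp]:
  assumes "module K U" "m \<in> carrier M" "linear_map K M U (\<lambda>x. g x)"
  shows "sw K M C U (coactM m) (\<lambda>a b. counit C b \<odot>\<^bsub>U\<^esub> g a) = g (twist M m)"
  by (rule C.sw_scaled_linear[OF _ M.module_space assms(1,3)])
    (use assms(2) in \<open>simp_all add: coact_counit flip: C.sweedler_sw'[of M C]\<close>)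

text \<open>The analogue for comodules: iterated coactions become comultiplications of the last leg.\<close>
lemma sw_coact_coassoc:
  assumes U: "module K U" and m: "m \<in> carrier M"
    and f: "\<And>a b. a \<in> carrier M \<Longrightarrow> b \<in> carrier C \<Longrightarrow> linear_map K C U (\<lambda>z. f a b z)"
    "\<And>a b. a \<in> carrier M \<Longrightarrow> b \<in> carrier C \<Longrightarrow> linear_map K C U (\<lambda>z. f a z b)"
    "\<And>a b. a \<in> carrier C \<Longrightarrow> b \<in> carrier C \<Longrightarrow> linear_map K M U (\<lambda>z. f z a b)"
  shows "sw K M C U (coactM m) (\<lambda>m0 m1. sw K M C U (coactM m0) (\<lambda>x y. f x y m1))
    = sw K M C U (coactM m) (\<lambda>m0 m1. sw K C C U (comult C m1) (\<lambda>x y. f (twist M m0) x (untwist C y)))"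
proof -
  let ?T = "tensor K (tensor K M C) C"
  let ?F = "\<lambda>Y. sw K (tensor K M C) C U Y (\<lambda>x z. sw K M C U x (\<lambda>v w. f v w (untwist C z)))"
  have fu: "linear_map K C U (\<lambda>z. f a b (untwist C z))" if "a \<in> carrier M" "b \<in> carrier C" for a b
    by (rule linear_map_comp[OF C.untwist_linear f(1)[OF that]])
  let ?L = "sw K M C ?T (coactM m) (\<lambda>m0 m1. sw K M C ?T (coactM m0) (\<lambda>x y. tens K (tensor K M C) C (tens K M C x y) (twist C m1)))"
  let ?R = "sw K M C ?T (coactM m) (\<lambda>m0 m1. sw K C C ?T (comult C m1) (\<lambda>x y. tens K (tensor K M C) C (tens K M C (twist M m0) x) y))"
  have L: "sweedler K ?T (coactM m) (\<lambda>m0 m1. sweedler K ?T (coactM m0) (\<lambda>x y. tens K (tensor K M C) C (tens K M C x y) (twist C m1))) = ?L"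
    using m by (intro C.sweedler_to_sw[of M C, OF _ _ _ _ C.sweedler_to_sw[of M C]]) simp_all
  have R: "sweedler K ?T (coactM m) (\<lambda>m0 m1. sweedler K ?T (comult C m1) (\<lambda>x y. tens K (tensor K M C) C (tens K M C (twist M m0) x) y)) = ?R"
    using m by (intro C.sweedler_to_sw[of M C, OF _ _ _ _ C.sweedler_to_sw[of C C]]) simp_all
  have "?L = ?R" by (rule coact_coassoc[OF m, unfolded tensor3_def tens3_def L R])
  then have "?F ?L = ?F ?R" by simp
  then show ?thesis
    using U m f fu by simp
qed

end

context doi_hopf_datum
begin

lemma coact_mult_sw [simp]:
  assumes "a \<in> carrier A" "b \<in> carrier A"
  shows "rhoA (a \<otimes>\<^bsub>A\<^esub> b) = sw K A H (tensor K A H) (rhoA a) (\<lambda>a0 a1.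
    sw K A H (tensor K A H) (rhoA b) (\<lambda>b0 b1. tens K A H (a0 \<otimes>\<^bsub>A\<^esub> b0) (a1 \<otimes>\<^bsub>H\<^esub> b1)))"
  unfolding A.coact_mult[OF assms] tensor_mult_def using assms
  by (subst H.sweedler_to_sw[of A H, OF _ _ _ _ H.sweedler_to_sw[of A H]]) simp_all

declare A.coact_unit [simp]

lemma act_comult_sw [simp]:
  assumes "h \<in> carrier H" "c \<in> carrier C"
  shows "comult C (actC h c) = sw K H H (tensor K C C) (comult H h) (\<lambda>h1 h2.
    sw K C C (tensor K C C) (comult C c) (\<lambda>c1 c2. tens K C C (actC h1 c1) (actC h2 c2)))"
  unfolding C.act_comult[OF assms] using assms
  by (subst H.sweedler_to_sw[of H H, OF _ _ _ _ H.sweedler_to_sw[of C C]]) simp_all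

declare C.act_counit [simp]

end

context doi_hopf_module
begin

lemma coact_act_sw [simp]:
  assumes "a \<in> carrier A" "m \<in> carrier M"
  shows "coact M (act M a m) = sw K A H (tensor K M C) (rhoA a) (\<lambda>a0 a1.
    sw K M C (tensor K M C) (coact M m) (\<lambda>m0 m1. tens K M C (act M a0 m0) (actC a1 m1)))"
  unfolding coact_act[OF assms] using assms
  by (subst D.H.sweedler_to_sw[of A H, OF _ _ _ _ D.H.sweedler_to_sw[of M C]]) simp_all

end

context monoidal_doi_hopf_datum
begin

text \<open>The compatibility axiom for an arbitrary trilinear \<open>f\<close>, obtained by applying the linear map given
  by \<open>f\<close> to both sides of the identity in \<open>A \<otimes> A \<otimes> C\<close>.\<close>
lemma sw_monoidal_mult:
  assumes U: "module K U" and a: "a \<in> carrier A" "c \<in> carrier C" "d \<in> carrier C"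
    and f: "\<And>a b. a \<in> carrier A \<Longrightarrow> b \<in> carrier A \<Longrightarrow> linear_map K C U (\<lambda>z. f a b z)"
    "\<And>a b. a \<in> carrier A \<Longrightarrow> b \<in> carrier C \<Longrightarrow> linear_map K A U (\<lambda>z. f a z b)"
    "\<And>a b. a \<in> carrier A \<Longrightarrow> b \<in> carrier C \<Longrightarrow> linear_map K A U (\<lambda>z. f z a b)"
  shows "sw K A H U (rhoA a) (\<lambda>a0 a1. sw K A A U (comult A a0) (\<lambda>a01 a02.
          f a01 a02 (actC (twist H (twist H a1)) (c \<otimes>\<^bsub>C\<^esub> d))))
    = sw K A A U (comult A a) (\<lambda>a1 a2. sw K A H U (rhoA a1) (\<lambda>a10 a11. sw K A H U (rhoA a2) (\<lambda>a20 a21.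
          f a10 a20 (actC a11 c \<otimes>\<^bsub>C\<^esub> actC a21 d))))"
proof -
  let ?T = "tensor K (tensor K A A) C"
  let ?t = "\<lambda>x y z. tens K (tensor K A A) C (tens K A A x y) z"
  let ?F = "\<lambda>Y. sw K (tensor K A A) C U Y (\<lambda>x z. sw K A A U x (\<lambda>v w. f v w z))"
  have L: "sweedler K ?T (rhoA a) (\<lambda>a0 a1. sweedler K ?T (comult A a0) (\<lambda>a01 a02.
          ?t a01 a02 (actC (twist H (twist H a1)) (c \<otimes>\<^bsub>C\<^esub> d))))
    = sw K A H ?T (rhoA a) (\<lambda>a0 a1. sw K A A ?T (comult A a0) (\<lambda>a01 a02.
          ?t a01 a02 (actC (twist H (twist H a1)) (c \<otimes>\<^bsub>C\<^esub> d))))"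
    using a by (intro H.sweedler_to_sw[of A H, OF _ _ _ _ H.sweedler_to_sw[of A A]]) simp_all
  have R: "sweedler K ?T (comult A a) (\<lambda>a1 a2. sweedler K ?T (rhoA a1) (\<lambda>a10 a11. sweedler K ?T (rhoA a2) (\<lambda>a20 a21.
          ?t a10 a20 (actC a11 c \<otimes>\<^bsub>C\<^esub> actC a21 d))))
    = sw K A A ?T (comult A a) (\<lambda>a1 a2. sw K A H ?T (rhoA a1) (\<lambda>a10 a11. sw K A H ?T (rhoA a2) (\<lambda>a20 a21.
          ?t a10 a20 (actC a11 c \<otimes>\<^bsub>C\<^esub> actC a21 d))))"
    using a by (intro H.sweedler_to_sw[of A A, OF _ _ _ _ H.sweedler_to_sw[of A H, OF _ _ _ _ H.sweedler_to_sw[of A H]]]) simp_all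
  have "?F (sw K A H ?T (rhoA a) (\<lambda>a0 a1. sw K A A ?T (comult A a0) (\<lambda>a01 a02.
          ?t a01 a02 (actC (twist H (twist H a1)) (c \<otimes>\<^bsub>C\<^esub> d)))))
    = ?F (sw K A A ?T (comult A a) (\<lambda>a1 a2. sw K A H ?T (rhoA a1) (\<lambda>a10 a11. sw K A H ?T (rhoA a2) (\<lambda>a20 a21.
          ?t a10 a20 (actC a11 c \<otimes>\<^bsub>C\<^esub> actC a21 d)))))"
    using monoidal_mult[OF a, unfolded tensor3_def tens3_def, unfolded L R] by simp
  then show ?thesis
    using U a f by simp
qed

end

section \<open>Doi-Hopf modules in Sweedler form\<close>

context doi_hopf_datum
begin

text \<open>The constructions define their structure maps \<open>t, a, r\<close> by \<open>sweedler\<close>, while calculation is possible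
  with their forms \<open>t', a', r'\<close> in terms of \<open>sw\<close>, which agree on the carriers only. The explicit
  inverse \<open>u\<close> turns bijectivity of the twist into equations.\<close>
lemma doi_hopf_moduleI:
  assumes V [simp]: "module K V"
    and eq: "\<And>x. x \<in> carrier V \<Longrightarrow> t x = t' x" "\<And>b x. b \<in> carrier A \<Longrightarrow> x \<in> carrier V \<Longrightarrow> a b x = a' b x"
      "\<And>x. x \<in> carrier V \<Longrightarrow> r x = r' x"
    and t: "linear_map K V V t'"
    and u: "\<And>x. x \<in> carrier V \<Longrightarrow> u x \<in> carrier V" "\<And>x. x \<in> carrier V \<Longrightarrow> u (t' x) = x"
      "\<And>x. x \<in> carrier V \<Longrightarrow> t' (u x) = x"
    and a: "bilinear_map K A V V a'"
    and a_unit: "\<And>x. x \<in> carrier V \<Longrightarrow> a' \<one>\<^bsub>A\<^esub> x = t' x"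
    and a_twist: "\<And>b x. b \<in> carrier A \<Longrightarrow> x \<in> carrier V \<Longrightarrow> t' (a' b x) = a' (twist A b) (t' x)"
    and a_assoc: "\<And>b c x. b \<in> carrier A \<Longrightarrow> c \<in> carrier A \<Longrightarrow> x \<in> carrier V \<Longrightarrow>
      a' (twist A b) (a' c x) = a' (b \<otimes>\<^bsub>A\<^esub> c) (t' x)"
    and r: "linear_map K V (tensor K V C) r'"
    and r_counit: "\<And>x. x \<in> carrier V \<Longrightarrow> sw K V C V (r' x) (\<lambda>x0 x1. counit C x1 \<odot>\<^bsub>V\<^esub> x0) = t' x"
    and r_twist: "\<And>x. x \<in> carrier V \<Longrightarrow>
      sw K V C (tensor K V C) (r' x) (\<lambda>x0 x1. tens K V C (t' x0) (twist C x1)) = r' (t' x)"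
    and r_coassoc: "\<And>x. x \<in> carrier V \<Longrightarrow>
      sw K V C (tensor K (tensor K V C) C) (r' x) (\<lambda>x0 x1. sw K V C (tensor K (tensor K V C) C) (r' x0)
        (\<lambda>y z. tens K (tensor K V C) C (tens K V C y z) (twist C x1))) =
      sw K V C (tensor K (tensor K V C) C) (r' x) (\<lambda>x0 x1. sw K C C (tensor K (tensor K V C) C) (comult C x1)
        (\<lambda>y z. tens K (tensor K V C) C (tens K V C (t' x0) y) z))"
    and r_act: "\<And>b x. b \<in> carrier A \<Longrightarrow> x \<in> carrier V \<Longrightarrow>
      r' (a' b x) = sw K A H (tensor K V C) (rhoA b) (\<lambda>b0 b1.
        sw K V C (tensor K V C) (r' x) (\<lambda>x0 x1. tens K V C (a' b0 x0) (actC b1 x1)))"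
  shows "doi_hopf_module K H A rhoA C actC (make_doi_hopf_module V t a r)"
proof -
  let ?T = "tensor K (tensor K V C) C"
  interpret V: module K V by fact
  have tV: "linear_map K V V t" using t by (simp add: linear_map_cong[OF V, of t t'] eq)
  have aV: "bilinear_map K A V V a"
  proof (rule bilinear_mapI)
    show "linear_map K V V (a v)" if "v \<in> carrier A" for v
      by (rule iffD2[OF linear_map_cong[OF V] bilinear_mapD(1)[OF a that]]) (rule eq(2)[OF that])
    show "linear_map K A V (\<lambda>v. a v w)" if "w \<in> carrier V" for w
      by (rule iffD2[OF linear_map_cong[OF A.module_space] bilinear_mapD(2)[OF a that]]) (rule eq(2)[OF _ that])
  qed
  have rV: "linear_map K V (tensor K V C) r" using r by (simp add: linear_map_cong[OF V, of r r'] eq)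
  note t_rules = H.linear_rules[OF t]
  note r_rules = H.linear_rules[OF r]
  note a_rules = H.bilinear_rules[OF a]
  note rules [simp] = t_rules r_rules a_rules
  have bij: "bij_betw t (carrier V) (carrier V)"
    by (rule bij_betw_byWitness[of _ u]) (auto simp: eq u)
  let ?M = "make_doi_hopf_module V t a r"
  have "hom_space K ?M"
    by (intro hom_space.intro hom_space_axioms.intro H.K_field, unfold make_simps make_module make_linear) (fact V tV bij)+
  moreover have "hom_left_module_axioms K A ?M a"
  proof (unfold_locales, unfold make_simps)
    show "bilinear_map K A (make_doi_hopf_module V t a r) (make_doi_hopf_module V t a r) a"
      using aV by (simp add: bilinear_map_def)
    fix x assume x: "x \<in> carrier V"
    show "a \<one>\<^bsub>A\<^esub> x = t x" using x a_unit by (simp add: eq)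
    fix b assume b: "b \<in> carrier A"
    show "t (a b x) = a (twist A b) (t x)" using a_twist[OF b x] b x by (simp add: eq)
    fix c assume c: "c \<in> carrier A"
    show "a (twist A c) (a b x) = a (c \<otimes>\<^bsub>A\<^esub> b) (t x)" using a_assoc[OF c b x] b c x by (simp add: eq)
  qed
  moreover have "hom_right_comodule_axioms K C ?M r"
  proof (unfold_locales, unfold make_simps make_linear make_tensor make_tens make_module make_sweedler make_tensor_map)
    show "linear_map K V (tensor K V C) r" by fact
    fix x assume x: "x \<in> carrier V"
    show "sweedler K V (r x) (\<lambda>m0 m1. counit C m1 \<odot>\<^bsub>V\<^esub> m0) = t x"
      using x r_counit by (simp add: eq H.sweedler_sw'[of V C])
    have "tensor_map K V C t (twist C) (r' x) = sw K V C (tensor K V C) (r' x) (\<lambda>x0 x1. tens K V C (t x0) (twist C x1))"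
      by (rule H.tensor_map_sw) (use tV x in \<open>simp_all add: C.twist_linear\<close>)
    then show "tensor_map K V C t (twist C) (r x) = r (t x)"
      using x r_twist by (simp add: eq cong: H.sw_cong)
    show "sweedler K (tensor3 K (make_doi_hopf_module V t a r) C C) (r x) (\<lambda>m0 m1.
        sweedler K (tensor3 K (make_doi_hopf_module V t a r) C C) (r m0)
          (\<lambda>m00 m01. tens3 K (make_doi_hopf_module V t a r) C C m00 m01 (twist C m1))) =
      sweedler K (tensor3 K (make_doi_hopf_module V t a r) C C) (r x) (\<lambda>m0 m1.
        sweedler K (tensor3 K (make_doi_hopf_module V t a r) C C) (comult C m1)
          (\<lambda>m11 m12. tens3 K (make_doi_hopf_module V t a r) C C (t m0) m11 m12))"
    proof -
      have L: "sweedler K ?T (r x) (\<lambda>x0 x1. sweedler K ?T (r x0)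
        (\<lambda>y z. tens K (tensor K V C) C (tens K V C y z) (twist C x1))) =
        sw K V C ?T (r' x) (\<lambda>x0 x1. sw K V C ?T (r' x0)
        (\<lambda>y z. tens K (tensor K V C) C (tens K V C y z) (twist C x1)))"
        unfolding eq(3)[OF x]
      proof (rule H.sweedler_to_sw)
        fix x0 x1 assume "x0 \<in> carrier V" "x1 \<in> carrier C"
        then show "sweedler K ?T (r x0) (\<lambda>y z. tens K (tensor K V C) C (tens K V C y z) (twist C x1)) =
          sw K V C ?T (r' x0) (\<lambda>y z. tens K (tensor K V C) C (tens K V C y z) (twist C x1))"
          unfolding eq(3)[OF \<open>x0 \<in> carrier V\<close>] by (intro H.sweedler_to_sw) simp_all
      qed (use x in simp_all)
      have R: "sweedler K ?T (r x) (\<lambda>x0 x1. sweedler K ?T (comult C x1)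
        (\<lambda>y z. tens K (tensor K V C) C (tens K V C (t x0) y) z)) =
        sw K V C ?T (r' x) (\<lambda>x0 x1. sw K C C ?T (comult C x1)
        (\<lambda>y z. tens K (tensor K V C) C (tens K V C (t' x0) y) z))"
        unfolding eq(3)[OF x]
      proof (rule H.sweedler_to_sw)
        fix x0 x1 assume "x0 \<in> carrier V" "x1 \<in> carrier C"
        then show "sweedler K ?T (comult C x1) (\<lambda>y z. tens K (tensor K V C) C (tens K V C (t x0) y) z) =
          sw K C C ?T (comult C x1) (\<lambda>y z. tens K (tensor K V C) C (tens K V C (t' x0) y) z)"
          unfolding eq(1)[OF \<open>x0 \<in> carrier V\<close>] by (intro H.sweedler_to_sw) simp_all
      qed (use x in simp_all)
      show ?thesis unfolding tensor3_def tens3_def make_tensor make_tens L R by (rule r_coassoc[OF x])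
    qed
  qed
  moreover have "doi_hopf_module_axioms K A rhoA C actC ?M"
  proof (unfold_locales, unfold make_simps make_linear make_tensor make_tens make_module make_sweedler make_tensor_map)
    fix b x assume b: "b \<in> carrier A" and x: "x \<in> carrier V"
    show "r (a b x) = sweedler K (tensor K V C) (rhoA b) (\<lambda>a0 a1. sweedler K (tensor K V C) (r x)
        (\<lambda>m0 m1. tens K V C (a a0 m0) (actC a1 m1)))"
    proof -
      have "sweedler K (tensor K V C) (rhoA b) (\<lambda>a0 a1. sweedler K (tensor K V C) (r x)
        (\<lambda>m0 m1. tens K V C (a a0 m0) (actC a1 m1))) =
        sw K A H (tensor K V C) (rhoA b) (\<lambda>b0 b1.
        sw K V C (tensor K V C) (r' x) (\<lambda>x0 x1. tens K V C (a' b0 x0) (actC b1 x1)))"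
        unfolding eq(3)[OF x] using b x
        by (intro H.sweedler_to_sw[of A H, OF _ _ _ _ H.sweedler_to_sw[of V C]]) (simp_all add: eq)
      then show ?thesis using r_act[OF b x] b x by (simp add: eq)
    qed
  qed
  ultimately show ?thesis
    by (intro doi_hopf_module.intro doi_hopf_datum_axioms hom_left_module.intro hom_right_comodule.intro
        A.hom_algebra_axioms C.hom_coalgebra_axioms) simp_all
qed

end

context ground_field
begin

lemma smult_mult [simp]:
  "module K U \<Longrightarrow> k \<in> carrier K \<Longrightarrow> l \<in> carrier K \<Longrightarrow> u \<in> carrier U \<Longrightarrow> (k \<otimes>\<^bsub>K\<^esub> l) \<odot>\<^bsub>U\<^esub> u = k \<odot>\<^bsub>U\<^esub> (l \<odot>\<^bsub>U\<^esub> u)"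
  by (rule module.smult_assoc1)

lemma smult_in [simp]: "module K U \<Longrightarrow> k \<in> carrier K \<Longrightarrow> u \<in> carrier U \<Longrightarrow> k \<odot>\<^bsub>U\<^esub> u \<in> carrier U"
  by (rule module.smult_closed)

end

section \<open>Tensor products of Doi-Hopf modules\<close>

context monoidal_doi_hopf_datum
begin

lemma tensor_simps [simp]:
  "carrier (doi_hopf_tensor K A C M N) = carrier (tensor K M N)"
  "module K (doi_hopf_tensor K A C M N) = module K (tensor K M N)"
  "linear_map K (doi_hopf_tensor K A C M N) W f = linear_map K (tensor K M N) W f"
  "linear_map K W (doi_hopf_tensor K A C M N) f' = linear_map K W (tensor K M N) f'"
  "tensor K (doi_hopf_tensor K A C M N) W = tensor K (tensor K M N) W"
  "tensor K W (doi_hopf_tensor K A C M N) = tensor K W (tensor K M N)"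
  "tens K (doi_hopf_tensor K A C M N) W = tens K (tensor K M N) W"
  "tens K W (doi_hopf_tensor K A C M N) = tens K W (tensor K M N)"
  "sw K (doi_hopf_tensor K A C M N) W' U' X f'' = sw K (tensor K M N) W' U' X f''"
  "sw K W'' (doi_hopf_tensor K A C M N) U'' X'' g'' = sw K W'' (tensor K M N) U'' X'' g''"
  by (unfold doi_hopf_tensor_def) simp_all

lemma tensor_structure:
  assumes "doi_hopf_module K H A rhoA C actC M" "doi_hopf_module K H A rhoA C actC N"
    and x: "x \<in> carrier (tensor K M N)"
  shows "twist (doi_hopf_tensor K A C M N) x = sw K M N (tensor K M N) x (\<lambda>m n. tens K M N (twist M m) (twist N n))"
    and "b \<in> carrier A \<Longrightarrow> act (doi_hopf_tensor K A C M N) b x = sw K A A (tensor K M N) (comult A b) (\<lambda>a1 a2.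
      sw K M N (tensor K M N) x (\<lambda>m n. tens K M N (act M a1 m) (act N a2 n)))"
    and "coact (doi_hopf_tensor K A C M N) x = sw K M N (tensor K (tensor K M N) C) x (\<lambda>m n.
      sw K M C (tensor K (tensor K M N) C) (coact M m) (\<lambda>m0 m1. sw K N C (tensor K (tensor K M N) C) (coact N n) (\<lambda>n0 n1.
      tens K (tensor K M N) C (tens K M N m0 n0) (untwist C (untwist C (m1 \<otimes>\<^bsub>C\<^esub> n1))))))"
proof -
  interpret M: doi_hopf_module K H A rhoA C actC M by fact
  interpret N: doi_hopf_module K H A rhoA C actC N by fact
  show "twist (doi_hopf_tensor K A C M N) x = sw K M N (tensor K M N) x (\<lambda>m n. tens K M N (twist M m) (twist N n))"
    unfolding doi_hopf_tensor_def make_simps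
    using x by (intro H.tensor_map_sw) simp_all
  show "act (doi_hopf_tensor K A C M N) b x = sw K A A (tensor K M N) (comult A b) (\<lambda>a1 a2.
      sw K M N (tensor K M N) x (\<lambda>m n. tens K M N (act M a1 m) (act N a2 n)))" if "b \<in> carrier A"
    unfolding doi_hopf_tensor_def make_simps
    using x that by (intro H.sweedler_to_sw H.tensor_map_sw) simp_all
  show "coact (doi_hopf_tensor K A C M N) x = sw K M N (tensor K (tensor K M N) C) x (\<lambda>m n.
      sw K M C (tensor K (tensor K M N) C) (coact M m) (\<lambda>m0 m1. sw K N C (tensor K (tensor K M N) C) (coact N n) (\<lambda>n0 n1.
      tens K (tensor K M N) C (tens K M N m0 n0) (untwist C (untwist C (m1 \<otimes>\<^bsub>C\<^esub> n1))))))"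
    unfolding doi_hopf_tensor_def make_simps tensor3_def tens3_def
    using x by (intro H.sweedler_to_sw[of M N, OF _ _ _ _ H.sweedler_to_sw[of M C, OF _ _ _ _ H.sweedler_to_sw[of N C]]]) simp_all
qed

lemma tensor_doi_hopf_module:
  assumes "doi_hopf_module K H A rhoA C actC M" "doi_hopf_module K H A rhoA C actC N"
  shows "doi_hopf_module K H A rhoA C actC (doi_hopf_tensor K A C M N)"
proof -
  interpret M: doi_hopf_module K H A rhoA C actC M by fact
  interpret N: doi_hopf_module K H A rhoA C actC N by fact
  note ops = tensor_structure[OF assms, unfolded doi_hopf_tensor_def make_simps tensor3_def tens3_def]
  let ?T = "tensor K M N" and ?T3 = "tensor K (tensor K M N) C"
  let ?t = "\<lambda>X. sw K M N ?T X (\<lambda>m n. tens K M N (twist M m) (twist N n))"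
  let ?a = "\<lambda>a X. sw K A A ?T (comult A a) (\<lambda>a1 a2. sw K M N ?T X (\<lambda>m n. tens K M N (act M a1 m) (act N a2 n)))"
  let ?r = "\<lambda>X. sw K M N ?T3 X (\<lambda>m n. sw K M C ?T3 (coact M m) (\<lambda>m0 m1. sw K N C ?T3 (coact N n) (\<lambda>n0 n1.
      tens K ?T C (tens K M N m0 n0) (untwist C (untwist C (m1 \<otimes>\<^bsub>C\<^esub> n1))))))"
  note exch = H.sw_exchange[where V = N and W = C and V' = M and W' = C and X = "coact N n" and Y = "coact M m" for n m]
    H.sw_exchange[where V = N and W = C and V' = C and W' = C and X = "coact N n" and Y = "comult C c" for n c]
  note exchA = H.sw_exchange[where V = A and W = H and V' = M and W' = C and X = "rhoA a" and Y = "coact M m" for a m]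
    H.sw_exchange[where V = A and W = H and V' = N and W' = C and X = "rhoA a" and Y = "coact N n" for a n]
    H.sw_exchange[where V = A and W = A and V' = M and W' = C and X = "comult A a" and Y = "coact M m" for a m]
    H.sw_exchange[where V = A and W = A and V' = N and W' = C and X = "comult A a" and Y = "coact N n" for a n]
    H.sw_exchange[where V = A and W = H and V' = M and W' = N and X = "rhoA a" and Y = x for a x]
    H.sw_exchange[where V = A and W = A and V' = M and W' = N and X = "comult A a" and Y = x for a x]
  show ?thesis
    unfolding doi_hopf_tensor_def tensor3_def tens3_def
  proof (rule doi_hopf_moduleI[where
        t' = ?t and
        u = "\<lambda>X. sw K M N ?T X (\<lambda>m n. tens K M N (untwist M m) (untwist N n))" and
        a' = ?a and
        r' = ?r])
    show "module K (tensor K M N)" by simp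
    show "linear_map K ?T ?T3 ?r" by simp
    fix x assume x: "x \<in> carrier ?T"
    show "sw K ?T C ?T (?r x) (\<lambda>x0 x1. counit C x1 \<odot>\<^bsub>?T\<^esub> x0) = ?t x"
      using x by simp
    show "sw K ?T C ?T3 (?r x) (\<lambda>x0 x1. tens K ?T C (?t x0) (twist C x1))
      = ?r (?t x)"
      using x by simp
    show "sw K ?T C (tensor K ?T3 C) (?r x) (\<lambda>x0 x1. sw K ?T C (tensor K ?T3 C) (?r x0) (\<lambda>y z. tens K ?T3 C (tens K ?T C y z) (twist C x1)))
      = sw K ?T C (tensor K ?T3 C) (?r x) (\<lambda>x0 x1. sw K C C (tensor K ?T3 C) (comult C x1) (\<lambda>y z. tens K ?T3 C (tens K ?T C (?t x0) y) z))"
      using x by (simp add: exch M.M.sw_coact_coassoc N.M.sw_coact_coassoc)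
    \<comment> \<open>The monoidal axiom; after simplification the sums over the coactions of the two components of
      \<open>b\<close> are nested the other way round.\<close>
    have E: "sw K A A ?T3 (comult A b) (\<lambda>a1 a2. sw K A H ?T3 (rhoA a2) (\<lambda>a20 a21. sw K A H ?T3 (rhoA a1) (\<lambda>a10 a11.
        tens K ?T C (tens K M N (act M a10 m) (act N a20 n)) (untwist C (untwist C (actC a11 c \<otimes>\<^bsub>C\<^esub> actC a21 d))))))
      = sw K A H ?T3 (rhoA b) (\<lambda>a0 a1. sw K A A ?T3 (comult A a0) (\<lambda>a01 a02.
        tens K ?T C (tens K M N (act M a01 m) (act N a02 n)) (untwist C (untwist C (actC (twist H (twist H a1)) (c \<otimes>\<^bsub>C\<^esub> d))))))"
      if "b \<in> carrier A" "m \<in> carrier M" "n \<in> carrier N" "c \<in> carrier C" "d \<in> carrier C" for b m n c d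
      by (rule trans[OF H.sw_cong[OF refl H.sw_exchange] sw_monoidal_mult[symmetric]]) (use that in simp_all)
    fix b assume b: "b \<in> carrier A"
    show "?r (?a b x) =
     sw K A H ?T3 (rhoA b) (\<lambda>b0 b1. sw K ?T C ?T3 (?r x) (\<lambda>x0 x1. tens K ?T C (?a b0 x0) (actC b1 x1)))"
      using x b E by (simp add: exchA)
    fix c assume c: "c \<in> carrier A"
    show "?a (twist A c) (?a b x)
     = ?a (c \<otimes>\<^bsub>A\<^esub> b) (?t x)"
      using x b c by (simp add: M.M.act_mult N.M.act_mult)
  qed (simp_all add: ops bilinear_mapI)
qed

end

section \<open>Submodules and isomorphisms\<close>

context doi_hopf_datum
begin

lemma doi_hopf_homI:
  assumes "module K M" "module K N" "linear_map K M N f"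
    and "\<And>m. m \<in> carrier M \<Longrightarrow> f (twist M m) = twist N (f m)"
    and "\<And>a m. a \<in> carrier A \<Longrightarrow> m \<in> carrier M \<Longrightarrow> f (act M a m) = act N a (f m)"
    and "\<And>m. m \<in> carrier M \<Longrightarrow> coact M m \<in> carrier (tensor K M C)"
    and "\<And>m. m \<in> carrier M \<Longrightarrow> coact N (f m) = sw K M C (tensor K N C) (coact M m) (\<lambda>x y. tens K N C (f x) y)"
  shows "doi_hopf_hom K A C M N f"
  using assms by (simp add: doi_hopf_hom_def H.tensor_map_sw[of M C N C f "\<lambda>x. x"])

lemma doi_hopf_homD:
  assumes "doi_hopf_hom K A C M N f" "module K M" "module K N"
  shows "linear_map K M N f"
    and "m \<in> carrier M \<Longrightarrow> f (twist M m) = twist N (f m)"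
    and "a \<in> carrier A \<Longrightarrow> m \<in> carrier M \<Longrightarrow> f (act M a m) = act N a (f m)"
    and "m \<in> carrier M \<Longrightarrow> coact M m \<in> carrier (tensor K M C) \<Longrightarrow>
      coact N (f m) = sw K M C (tensor K N C) (coact M m) (\<lambda>x y. tens K N C (f x) y)"
  using assms by (simp_all add: doi_hopf_hom_def H.tensor_map_sw[of M C N C f "\<lambda>x. x"])

lemma doi_hopf_isoI:
  assumes M: "doi_hopf_module K H A rhoA C actC M" and N: "doi_hopf_module K H A rhoA C actC N"
    and f: "doi_hopf_hom K A C M N f" and bij: "bij_betw f (carrier M) (carrier N)"
  shows "doi_hopf_iso K H A rhoA C actC M N"
proof -
  interpret M: doi_hopf_module K H A rhoA C actC M by fact
  interpret N: doi_hopf_module K H A rhoA C actC N by fact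
  note F = doi_hopf_homD[OF f M.M.M.module_space N.M.M.module_space]
  note [simp] = H.linear_rules[OF F(1)]
  let ?g = "inv_into (carrier M) f"
  have gc: "?g n \<in> carrier M" if "n \<in> carrier N" for n
    using bij that by (metis bij_betw_def inv_into_into)
  have fg: "f (?g n) = n" if "n \<in> carrier N" for n
    using bij that by (metis bij_betw_def f_inv_into_f)
  have gf: "?g (f m) = m" if "m \<in> carrier M" for m
    using bij that by (metis bij_betw_def inv_into_f_f)
  have g: "?g n = m" if "m \<in> carrier M" "f m = n" for m n using gf that by blast
  have gl: "linear_map K N M ?g"
    by (rule linear_mapI; (rule gc g)?) (simp_all add: gc fg linear_mapD[OF F(1)])
  note [simp] = H.linear_rules[OF gl]
  have "doi_hopf_hom K A C N M ?g"
  proof (rule doi_hopf_homI)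
    fix n assume n: "n \<in> carrier N"
    show "?g (twist N n) = twist M (?g n)" by (rule g) (use n in \<open>simp_all add: F(2) fg\<close>)
    show "?g (act N a n) = act M a (?g n)" if "a \<in> carrier A" for a
      by (rule g) (use n that in \<open>simp_all add: F(3) fg\<close>)
    have "coact M (?g n) = sw K N C (tensor K M C) (coact N (f (?g n))) (\<lambda>x y. tens K M C (?g x) y)"
      using n by (simp add: F(4) gf del: fg)
    then show "coact M (?g n) = sw K N C (tensor K M C) (coact N n) (\<lambda>x y. tens K M C (?g x) y)"
      using n by (simp add: fg)
  qed (simp_all add: gl)
  then show ?thesis unfolding doi_hopf_iso_def using M N f fg gf by blast
qed

lemma doi_hopf_hom_compose:
  assumes M: "doi_hopf_module K H A rhoA C actC M" and N: "doi_hopf_module K H A rhoA C actC N"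
    and P: "doi_hopf_module K H A rhoA C actC P"
    and f: "doi_hopf_hom K A C M N f" and g: "doi_hopf_hom K A C N P g"
  shows "doi_hopf_hom K A C M P (\<lambda>x. g (f x))"
proof -
  interpret M: doi_hopf_module K H A rhoA C actC M by fact
  interpret N: doi_hopf_module K H A rhoA C actC N by fact
  interpret P: doi_hopf_module K H A rhoA C actC P by fact
  note F = doi_hopf_homD[OF f M.M.M.module_space N.M.M.module_space]
  note G = doi_hopf_homD[OF g N.M.M.module_space P.M.M.module_space]
  note [simp] = H.linear_rules[OF F(1)] H.linear_rules[OF G(1)]
  show ?thesis
    by (rule doi_hopf_homI) (simp_all add: F(2-4) G(2-4))
qed

text \<open>The maps \<open>f\<close> and \<open>g\<close> present \<open>V\<close> as a linear retract of \<open>P\<close>, and \<open>sub\<close> says that the structure maps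
  of \<open>P\<close> preserve the image of \<open>f\<close>, on which \<open>f \<circ> g\<close> is the identity; for the coaction this means
  that it takes values in the image of \<open>f \<otimes> id\<close>. Every axiom for \<open>V\<close> is then one for \<open>P\<close> between \<open>f\<close> and
  \<open>g\<close>. The cotensor product is of this form inside \<open>N \<otimes> C\<close>, and \<open>A \<otimes>\<^sub>A M\<close> is of this form with \<open>f\<close>
  bijective.\<close>
lemma doi_hopf_submodule:
  assumes P: "doi_hopf_module K H A rhoA C actC P" and V [simp]: "module K V"
    and f: "linear_map K V P f" and g: "linear_map K P V g"
    and gf: "\<And>x. x \<in> carrier V \<Longrightarrow> g (f x) = x"
    and sub: "\<And>x. x \<in> carrier V \<Longrightarrow> f (g (twist P (f x))) = twist P (f x)"
      "\<And>x. x \<in> carrier V \<Longrightarrow> f (g (untwist P (f x))) = untwist P (f x)"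
      "\<And>a x. a \<in> carrier A \<Longrightarrow> x \<in> carrier V \<Longrightarrow> f (g (act P a (f x))) = act P a (f x)"
      "\<And>x. x \<in> carrier V \<Longrightarrow> sw K P C (tensor K P C) (coact P (f x)) (\<lambda>y c. tens K P C (f (g y)) c) = coact P (f x)"
    and eq: "\<And>x. x \<in> carrier V \<Longrightarrow> t x = g (twist P (f x))"
      "\<And>b x. b \<in> carrier A \<Longrightarrow> x \<in> carrier V \<Longrightarrow> a b x = g (act P b (f x))"
      "\<And>x. x \<in> carrier V \<Longrightarrow> r x = sw K P C (tensor K V C) (coact P (f x)) (\<lambda>y c. tens K V C (g y) c)"
  shows "doi_hopf_module K H A rhoA C actC (make_doi_hopf_module V t a r)"
    and "doi_hopf_hom K A C (make_doi_hopf_module V t a r) P f"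
proof -
  interpret P: doi_hopf_module K H A rhoA C actC P by fact
  note [simp] = H.linear_rules[OF f] H.linear_rules[OF g] gf sub(1-3)
  \<comment> \<open>The retraction may be inserted in the first leg of a coaction.\<close>
  have leg: "sw K P C U (coact P (f x)) (\<lambda>y c. h (f (g y)) c) = sw K P C U (coact P (f x)) (\<lambda>y c. h y c)"
    if "x \<in> carrier V" "module K U" "\<And>y. y \<in> carrier P \<Longrightarrow> linear_map K C U (\<lambda>c. h y c)"
      "\<And>c. c \<in> carrier C \<Longrightarrow> linear_map K P U (\<lambda>y. h y c)" for x h and U :: "('k, 'u, 'q) module_scheme"
  proof -
    have "sw K P C U (coact P (f x)) (\<lambda>y c. h y c)
      = sw K P C U (sw K P C (tensor K P C) (coact P (f x)) (\<lambda>y c. tens K P C (f (g y)) c)) (\<lambda>y c. h y c)"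
      using sub(4)[OF that(1)] by simp
    also have "\<dots> = sw K P C U (coact P (f x)) (\<lambda>y c. h (f (g y)) c)"
      using that by simp
    finally show ?thesis by simp
  qed
  show "doi_hopf_module K H A rhoA C actC (make_doi_hopf_module V t a r)"
  proof (rule doi_hopf_moduleI[where t' = "\<lambda>x. g (twist P (f x))" and u = "\<lambda>x. g (untwist P (f x))"
        and a' = "\<lambda>b x. g (act P b (f x))"
        and r' = "\<lambda>x. sw K P C (tensor K V C) (coact P (f x)) (\<lambda>y c. tens K V C (g y) c)"])
    fix x assume x: "x \<in> carrier V"
    let ?T3 = "tensor K (tensor K V C) C"
    let ?r = "\<lambda>x. sw K P C (tensor K V C) (coact P (f x)) (\<lambda>y c. tens K V C (g y) c)"
    show "sw K V C (tensor K V C) (?r x) (\<lambda>x0 x1. tens K V C (g (twist P (f x0))) (twist C x1)) = ?r (g (twist P (f x)))"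
      using x leg[of x "tensor K V C" "\<lambda>y c. tens K V C (g (twist P y)) (twist C c)"] by simp
    show "sw K V C ?T3 (?r x) (\<lambda>x0 x1. sw K V C ?T3 (?r x0) (\<lambda>y z. tens K (tensor K V C) C (tens K V C y z) (twist C x1)))
      = sw K V C ?T3 (?r x) (\<lambda>x0 x1. sw K C C ?T3 (comult C x1) (\<lambda>y z. tens K (tensor K V C) C (tens K V C (g (twist P (f x0))) y) z))"
      using x leg[of x ?T3 "\<lambda>p0 p1. sw K P C ?T3 (coact P p0) (\<lambda>y z. tens K (tensor K V C) C (tens K V C (g y) z) (twist C p1))"]
        leg[of x ?T3 "\<lambda>p0 p1. sw K C C ?T3 (comult C p1) (\<lambda>y z. tens K (tensor K V C) C (tens K V C (g (twist P p0)) y) z)"]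
      by (simp add: P.M.sw_coact_coassoc)
    show "?r (g (act P b (f x))) = sw K A H (tensor K V C) (rhoA b) (\<lambda>b0 b1.
        sw K V C (tensor K V C) (?r x) (\<lambda>x0 x1. tens K V C (g (act P b0 (f x0))) (actC b1 x1)))" if b: "b \<in> carrier A" for b
    proof -
      have "sw K V C (tensor K V C) (?r x) (\<lambda>x0 x1. tens K V C (g (act P b0 (f x0))) (actC b1 x1))
        = sw K P C (tensor K V C) (coact P (f x)) (\<lambda>x0 x1. tens K V C (g (act P b0 x0)) (actC b1 x1))"
        if "b0 \<in> carrier A" "b1 \<in> carrier H" for b0 b1
        using x that leg[of x "tensor K V C" "\<lambda>x0 x1. tens K V C (g (act P b0 x0)) (actC b1 x1)"] by simp
      then show ?thesis using x b by simp
    qed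
  qed (simp_all add: eq bilinear_mapI P.M.act_mult)
  show "doi_hopf_hom K A C (make_doi_hopf_module V t a r) P f"
    by (rule doi_hopf_homI) (simp_all add: f eq sub)
qed

end

section \<open>The self, cofree and twisted modules\<close>

context monoidal_doi_hopf_datum
begin

lemma self_doi_hopf_module: "doi_hopf_module K H A rhoA C actC (doi_hopf_self K A rhoA C actC)"
proof -
  note exch = H.sw_exchange[where V = C and W = C and V' = A and W' = H and X = "comult C c" and Y = "rhoA a" for c a]
    H.sw_exchange[where V = C and W = C and V' = H and W' = H and X = "comult C c" and Y = "comult H h" for c h]
  show ?thesis
    unfolding doi_hopf_self_def
  proof (rule doi_hopf_moduleI[where t' = "twist C" and u = "untwist C" and
        a' = "\<lambda>a c. sw K A H C (rhoA a) (\<lambda>a0 a1. counit A a0 \<odot>\<^bsub>C\<^esub> actC a1 c)" and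
        r' = "\<lambda>c. sw K C C (tensor K C C) (comult C c) (\<lambda>x y. tens K C C x (untwist C y))"])
    fix c assume c: "c \<in> carrier C"
    show "tensor_map K C C (\<lambda>c1. c1) (untwist C) (comult C c) = sw K C C (tensor K C C) (comult C c) (\<lambda>x y. tens K C C x (untwist C y))"
      using c by (intro H.tensor_map_sw) simp_all
    fix a assume a: "a \<in> carrier A"
    show "sweedler K C (rhoA a) (\<lambda>a0 a1. counit A a0 \<odot>\<^bsub>C\<^esub> actC a1 c) = sw K A H C (rhoA a) (\<lambda>a0 a1. counit A a0 \<odot>\<^bsub>C\<^esub> actC a1 c)"
      using a c by (intro H.sweedler_sw') simp_all
  qed (simp_all add: bilinear_mapI C.act_mult C.sw_coassoc exch A.sw_coact_coassoc)
qed

end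

text \<open>The Doi-Hopf module \<open>N \<otimes> C\<close> over \<open>(H, A, C)\<close>, in which of \<open>N\<close> only the action of \<open>A\<close> is used. It is the
  value at \<open>N\<close> of the right adjoint of the functor that forgets the coaction.\<close>
definition cofree_module ::
  "('k, 'z) ring_scheme \<Rightarrow> ('k, 'h, 'w) hom_coalgebra_scheme \<Rightarrow> ('k, 'a, 'x) hom_space_scheme \<Rightarrow> ('a \<Rightarrow> ('k, 'a, 'h) tensor)
    \<Rightarrow> ('k, 'c, 'y) hom_coalgebra_scheme \<Rightarrow> ('h \<Rightarrow> 'c \<Rightarrow> 'c) \<Rightarrow> ('k, 'a, 'd, 'n) doi_hopf_module
    \<Rightarrow> ('k, 'a, 'c, ('k, 'n, 'c) tensor) doi_hopf_module" where
  "cofree_module K H A rhoA C actC N =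
    (let T = tensor K N C in
     make_doi_hopf_module T
       (\<lambda>X. sw K N C T X (\<lambda>n c. tens K N C (twist N n) (twist C c)))
       (\<lambda>a X. sw K A H T (rhoA a) (\<lambda>a0 a1. sw K N C T X (\<lambda>n c. tens K N C (act N a0 n) (actC a1 c))))
       (\<lambda>X. sw K N C (tensor K T C) X (\<lambda>n c. sw K C C (tensor K T C) (comult C c) (\<lambda>c1 c2.
          tens K T C (tens K N C (twist N n) c1) (untwist C c2)))))"

context doi_hopf_datum
begin

lemma cofree_doi_hopf_module:
  fixes N :: "('k, 'a, 'd, 'n) doi_hopf_module"
  assumes "hom_left_module K A N (act N)"
  shows "doi_hopf_module K H A rhoA C actC (cofree_module K H A rhoA C actC N)"
proof -
  interpret N: hom_left_module K A N "act N" by fact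
  let ?T = "tensor K N C"
  note exch = H.sw_exchange[where V = N and W = C and V' = A and W' = H and X = x and Y = "rhoA a" for x a]
    H.sw_exchange[where V = C and W = C and V' = A and W' = H and X = "comult C c" and Y = "rhoA a" for c a]
    H.sw_exchange[where V = C and W = C and V' = H and W' = H and X = "comult C c" and Y = "comult H h" for c h]
    H.sw_exchange[where V = N and W = C and V' = H and W' = H and X = x and Y = "comult H h" for x h]
  show ?thesis
    unfolding cofree_module_def Let_def
    by (rule doi_hopf_moduleI[where t' = "\<lambda>X. sw K N C ?T X (\<lambda>n c. tens K N C (twist N n) (twist C c))" and
          a' = "\<lambda>a X. sw K A H ?T (rhoA a) (\<lambda>a0 a1. sw K N C ?T X (\<lambda>n c. tens K N C (act N a0 n) (actC a1 c)))" and
          r' = "\<lambda>X. sw K N C (tensor K ?T C) X (\<lambda>n c. sw K C C (tensor K ?T C) (comult C c) (\<lambda>c1 c2.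
             tens K ?T C (tens K N C (twist N n) c1) (untwist C c2)))" and
          u = "\<lambda>X. sw K N C ?T X (\<lambda>n c. tens K N C (untwist N n) (untwist C c))"])
      (simp_all add: bilinear_mapI C.act_mult N.act_mult C.sw_coassoc exch A.sw_coact_coassoc)
qed

end

text \<open>The corestriction of \<open>M\<close> along \<open>\<gamma>\<close>. The twist in the action and the inverse twist in the coaction are
  those that make the map \<open>b \<otimes> m \<mapsto> \<alpha>\<^sup>-\<^sup>1(b \<cdot> m)\<close> from \<open>A \<otimes>\<^sub>A M\<close> a morphism.\<close>
definition twisted_module :: "('k, 'z) ring_scheme \<Rightarrow> ('k, 'a, 'x) hom_space_scheme \<Rightarrow> ('k, 'c, 'y) hom_coalgebra_scheme
    \<Rightarrow> ('k, 'd, 'q) hom_coalgebra_scheme \<Rightarrow> ('c \<Rightarrow> 'd)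
    \<Rightarrow> ('k, 'a, 'c, 'm) doi_hopf_module \<Rightarrow> ('k, 'a, 'd, 'm) doi_hopf_module" where
  "twisted_module K A C C' \<gamma> M = make_doi_hopf_module M (twist M) (\<lambda>a. act M (twist A a))
     (\<lambda>m. sw K M C (tensor K M C') (coact M m) (\<lambda>m0 m1. tens K M C' m0 (untwist C' (\<gamma> m1))))"

context monoidal_doi_hopf_morphism
begin

lemma \<gamma>_linear: "linear_map K C C' \<gamma>"
  using \<gamma>_bialgebra_map by (simp add: hom_bialgebra_map_def)

lemmas \<gamma>_rules [simp] = D.H.linear_rules[OF \<gamma>_linear]
declare \<gamma>_act [simp]

lemma \<gamma>_twist [simp]: "b \<in> carrier C \<Longrightarrow> \<gamma> (twist C b) = twist C' (\<gamma> b)"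
  and \<gamma>_mult [simp]: "b \<in> carrier C \<Longrightarrow> c \<in> carrier C \<Longrightarrow> \<gamma> (b \<otimes>\<^bsub>C\<^esub> c) = \<gamma> b \<otimes>\<^bsub>C'\<^esub> \<gamma> c"
  and \<gamma>_unit [simp]: "\<gamma> \<one>\<^bsub>C\<^esub> = \<one>\<^bsub>C'\<^esub>"
  and \<gamma>_counit [simp]: "b \<in> carrier C \<Longrightarrow> counit C' (\<gamma> b) = counit C b"
  and \<gamma>_comult_map: "b \<in> carrier C \<Longrightarrow> comult C' (\<gamma> b) = tensor_map K C' C' \<gamma> \<gamma> (comult C b)"
  using \<gamma>_bialgebra_map by (simp_all add: hom_bialgebra_map_def)

lemma \<gamma>_untwist [simp]: "b \<in> carrier C \<Longrightarrow> \<gamma> (untwist C b) = untwist C' (\<gamma> b)"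
  by (rule D'.C.untwist_eq[symmetric]) (simp_all flip: \<gamma>_twist)

lemma \<gamma>_comult [simp]: "b \<in> carrier C \<Longrightarrow>
    comult C' (\<gamma> b) = sw K C C (tensor K C' C') (comult C b) (\<lambda>x y. tens K C' C' (\<gamma> x) (\<gamma> y))"
  unfolding \<gamma>_comult_map by (intro D.H.tensor_map_sw) simp_all

lemma twisted_simps:
  "carrier (twisted_module K A C C' \<gamma> M) = carrier M"
  "module K (twisted_module K A C C' \<gamma> M) = module K M"
  "linear_map K (twisted_module K A C C' \<gamma> M) W f = linear_map K M W f"
  "linear_map K W (twisted_module K A C C' \<gamma> M) f' = linear_map K W M f'"
  "tensor K (twisted_module K A C C' \<gamma> M) W = tensor K M W"
  "tensor K W (twisted_module K A C C' \<gamma> M) = tensor K W M"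
  "tens K (twisted_module K A C C' \<gamma> M) W = tens K M W"
  "tens K W (twisted_module K A C C' \<gamma> M) = tens K W M"
  "sw K (twisted_module K A C C' \<gamma> M) W' U' X f'' = sw K M W' U' X f''"
  "sw K W'' (twisted_module K A C C' \<gamma> M) U'' X'' g'' = sw K W'' M U'' X'' g''"
  "twist (twisted_module K A C C' \<gamma> M) = twist M"
  "act (twisted_module K A C C' \<gamma> M) a m = act M (twist A a) m"
  "coact (twisted_module K A C C' \<gamma> M) m = sw K M C (tensor K M C') (coact M m) (\<lambda>m0 m1. tens K M C' m0 (untwist C' (\<gamma> m1)))"
  by (unfold twisted_module_def) simp_all

lemma twisted_doi_hopf_module:
  assumes "doi_hopf_module K H A rhoA C actC M"
  shows "doi_hopf_module K H A rhoA C' actC' (twisted_module K A C C' \<gamma> M)"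
proof -
  interpret M: doi_hopf_module K H A rhoA C actC M by fact
  show ?thesis
    unfolding twisted_module_def
    by (rule D'.doi_hopf_moduleI[where t' = "twist M" and a' = "\<lambda>a. act M (twist A a)" and u = "untwist M" and
          r' = "\<lambda>m. sw K M C (tensor K M C') (coact M m) (\<lambda>m0 m1. tens K M C' m0 (untwist C' (\<gamma> m1)))"])
      (simp_all add: bilinear_mapI M.M.act_mult M.M.sw_coact_coassoc)
qed

end

section \<open>Kernels and tensor products\<close>

lemma subspace_projection_ex:
  assumes "field K" "module K V" "submodule U K V"
  shows "\<exists>p. linear_map K V V p \<and> (\<forall>x\<in>carrier V. p x \<in> U) \<and> (\<forall>x\<in>U. p x = x)"
  by (rule subspace_projection[OF assms]) blast

lemma submodule_image:
  assumes "module K V" "module K W" "linear_map K V W f"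
  shows "submodule (f ` carrier V) K W"
proof -
  interpret V: module K V by fact
  interpret W: module K W by fact
  note l = linear_mapD[OF assms(3)]
  have neg: "\<ominus>\<^bsub>W\<^esub> f x = f (\<ominus>\<^bsub>V\<^esub> x)" if "x \<in> carrier V" for x
    using linear_map_minus[OF assms V.zero_closed that] linear_map_zero[OF assms] l(1) that
    by (simp add: V.minus_eq W.minus_eq)
  show ?thesis
  proof (rule W.submoduleI)
    show "\<zero>\<^bsub>W\<^esub> \<in> f ` carrier V" using linear_map_zero[OF assms] by (metis V.zero_closed image_eqI)
    show "f ` carrier V \<subseteq> carrier W" using l(1) by blast
    show "\<ominus>\<^bsub>W\<^esub> a \<in> f ` carrier V" if "a \<in> f ` carrier V" for a
      using that neg by auto
    show "a \<oplus>\<^bsub>W\<^esub> b \<in> f ` carrier V" if ab: "a \<in> f ` carrier V" "b \<in> f ` carrier V" for a b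
    proof -
      obtain x y where "x \<in> carrier V" "y \<in> carrier V" "a = f x" "b = f y" using ab by blast
      then show ?thesis using l(2)[of x y] by (metis V.a_closed image_eqI)
    qed
    show "k \<odot>\<^bsub>W\<^esub> a \<in> f ` carrier V" if ka: "k \<in> carrier K" "a \<in> f ` carrier V" for k a
    proof -
      obtain x where "x \<in> carrier V" "a = f x" using ka(2) by blast
      then show ?thesis using l(3)[of k x] ka(1) by (metis V.smult_closed image_eqI)
    qed
  qed
qed

lemma linear_left_inverse:
  assumes "field K" "module K V" "module K W" "linear_map K V W f" "inj_on f (carrier V)"
  obtains g where "linear_map K W V g" "\<And>x. x \<in> carrier V \<Longrightarrow> g (f x) = x"
proof -
  interpret V: module K V by fact
  interpret W: module K W by fact
  note l = linear_mapD[OF assms(4)]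
  from subspace_projection_ex[OF assms(1,3) submodule_image[OF assms(2-4)]]
  obtain p where p: "linear_map K W W p" "\<And>x. x \<in> carrier W \<Longrightarrow> p x \<in> f ` carrier V" "\<And>x. x \<in> f ` carrier V \<Longrightarrow> p x = x"
    by blast
  define g where "g w = inv_into (carrier V) f (p w)" for w
  have gc: "g w \<in> carrier V" and fg: "f (g w) = p w" if "w \<in> carrier W" for w
    using p(2)[OF that] unfolding g_def by (auto simp: inv_into_into f_inv_into_f)
  have eqI: "x = y" if "x \<in> carrier V" "y \<in> carrier V" "f x = f y" for x y
    using inj_onD[OF assms(5) that(3,1,2)] .
  show ?thesis
  proof
    show "linear_map K W V g"
    proof (rule linear_mapI)
      fix x y assume "x \<in> carrier W" "y \<in> carrier W"
      then show "g (x \<oplus>\<^bsub>W\<^esub> y) = g x \<oplus>\<^bsub>V\<^esub> g y"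
        by (intro eqI) (simp_all add: gc fg l linear_mapD[OF p(1)])
    next
      fix a x assume "a \<in> carrier K" "x \<in> carrier W"
      then show "g (a \<odot>\<^bsub>W\<^esub> x) = a \<odot>\<^bsub>V\<^esub> g x"
        by (intro eqI) (simp_all add: gc fg l linear_mapD[OF p(1)])
    qed (rule gc)
    show "g (f x) = x" if "x \<in> carrier V" for x
      using that by (intro eqI) (simp_all add: gc fg l p)
  qed
qed

text \<open>Here \<open>p\<close> is a projection onto the equalizer of \<open>L\<close> and \<open>R\<close>. Since \<open>id - p\<close> vanishes on it, \<open>id - p\<close>
  factors through \<open>L - R\<close>, as \<open>s \<circ> (L - R)\<close> say; this is the last equation, written without
  subtraction. Being an identity between linear maps, it survives tensoring with any space.\<close>
lemma kernel_splitting: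
  assumes "field K" "module K V" "module K W" "linear_map K V W L" "linear_map K V W R"
  obtains p s where "linear_map K V V p" "linear_map K W V s"
    "\<And>x. x \<in> carrier V \<Longrightarrow> L (p x) = R (p x)" "\<And>x. x \<in> carrier V \<Longrightarrow> L x = R x \<Longrightarrow> p x = x"
    "\<And>x. x \<in> carrier V \<Longrightarrow> x \<oplus>\<^bsub>V\<^esub> s (R x) = p x \<oplus>\<^bsub>V\<^esub> s (L x)"
proof -
  interpret K: field K by fact
  interpret V: module K V by fact
  interpret W: module K W by fact
  let ?S = "{x \<in> carrier V. L x = R x}"
  from subspace_projection_ex[OF assms(1,2) submodule_kernel[OF assms(2-5)]]
  obtain p where p: "linear_map K V V p" "\<And>x. x \<in> carrier V \<Longrightarrow> p x \<in> ?S" "\<And>x. x \<in> ?S \<Longrightarrow> p x = x"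
    by blast
  note lp = linear_mapD[OF p(1)] and lL = linear_mapD[OF assms(4)] and lR = linear_mapD[OF assms(5)]
  \<comment> \<open>\<open>c = id - p\<close>, written with the scalar \<open>-1\<close> so that its linearity is immediate.\<close>
  obtain c where c: "linear_map K V V c" "\<And>x. x \<in> ?S \<Longrightarrow> c x = \<zero>\<^bsub>V\<^esub>" "\<And>x. x \<in> carrier V \<Longrightarrow> p x \<oplus>\<^bsub>V\<^esub> c x = x"
  proof
    let ?c = "\<lambda>x. x \<oplus>\<^bsub>V\<^esub> (\<ominus>\<^bsub>K\<^esub> \<one>\<^bsub>K\<^esub>) \<odot>\<^bsub>V\<^esub> p x"
    show "linear_map K V V ?c"
      by (intro linear_map_add linear_map_smult assms(2) p(1)) (auto intro: linear_mapI)
    show "?c x = \<zero>\<^bsub>V\<^esub>" if "x \<in> ?S" for x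
      using that p(3)[OF that] V.smult_l_minus[OF K.one_closed, of x] by (simp add: V.r_neg)
    show "p x \<oplus>\<^bsub>V\<^esub> ?c x = x" if "x \<in> carrier V" for x
      using that lp(1)[OF that] V.smult_l_minus[OF K.one_closed, of "p x"]
        V.a_ac by (simp add: V.r_neg V.a_lcomm[of "p x"])
  qed
  note lc = linear_mapD[OF c(1)]
  define f where "f x = L x \<oplus>\<^bsub>W\<^esub> (\<ominus>\<^bsub>K\<^esub> \<one>\<^bsub>K\<^esub>) \<odot>\<^bsub>W\<^esub> R x" for x
  have f: "linear_map K V W f"
    unfolding f_def by (intro linear_map_add linear_map_smult assms) simp
  note lf = linear_mapD[OF f]
  have f': "f x = L x \<ominus>\<^bsub>W\<^esub> R x" if "x \<in> carrier V" for x
    using that W.smult_l_minus[OF K.one_closed, of "R x"] by (simp add: f_def lR W.minus_eq)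
  have f0: "f x = \<zero>\<^bsub>W\<^esub> \<longleftrightarrow> L x = R x" if "x \<in> carrier V" for x
    using module_minus_eq_zero[OF assms(3)] lL lR that by (simp add: f')
  \<comment> \<open>\<open>c\<close> is constant on the fibres of \<open>f\<close>, so \<open>s\<close> can be defined by choosing preimages.\<close>
  have key: "c x = c y" if "x \<in> carrier V" "y \<in> carrier V" "f x = f y" for x y
  proof -
    have "f (x \<ominus>\<^bsub>V\<^esub> y) = \<zero>\<^bsub>W\<^esub>"
      using that linear_map_minus[OF assms(2,3) f that(1,2)] module_minus_eq_zero[OF assms(3), of "f y" "f y"] lf by simp
    then have "c (x \<ominus>\<^bsub>V\<^esub> y) = \<zero>\<^bsub>V\<^esub>" using that f0 by (intro c(2)) simp
    then show ?thesis
      using linear_map_minus[OF assms(2,2) c(1) that(1,2)] module_minus_eq_zero[OF assms(2)] lc that by simp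
  qed
  from subspace_projection_ex[OF assms(1,3) submodule_image[OF assms(2,3) f]]
  obtain q where q: "linear_map K W W q" "\<And>x. x \<in> carrier W \<Longrightarrow> q x \<in> f ` carrier V" "\<And>x. x \<in> f ` carrier V \<Longrightarrow> q x = x"
    by blast
  note lq = linear_mapD[OF q(1)]
  define h where "h w = inv_into (carrier V) f (q w)" for w
  have hc: "h w \<in> carrier V" and fh: "f (h w) = q w" if "w \<in> carrier W" for w
    using q(2)[OF that] unfolding h_def by (auto simp: inv_into_into f_inv_into_f)
  define s where "s w = c (h w)" for w
  have s: "linear_map K W V s"
  proof (rule linear_mapI)
    fix x y assume "x \<in> carrier W" "y \<in> carrier W"
    then show "s (x \<oplus>\<^bsub>W\<^esub> y) = s x \<oplus>\<^bsub>V\<^esub> s y"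
      unfolding s_def by (subst lc(2)[symmetric]) (auto intro!: key simp: hc fh lf lq)
  next
    fix a x assume "a \<in> carrier K" "x \<in> carrier W"
    then show "s (a \<odot>\<^bsub>W\<^esub> x) = a \<odot>\<^bsub>V\<^esub> s x"
      unfolding s_def by (subst lc(3)[symmetric]) (auto intro!: key simp: hc fh lf lq)
  qed (simp add: s_def hc lc)
  have sf: "s (f x) = c x" if "x \<in> carrier V" for x
    unfolding s_def using that by (intro key) (auto simp: hc fh lf q)
  show ?thesis
  proof
    fix x assume x: "x \<in> carrier V"
    have "s (f x) = s (L x) \<ominus>\<^bsub>V\<^esub> s (R x)"
      using x linear_map_minus[OF assms(3,2) s] lL lR by (simp add: f')
    then have "x = p x \<oplus>\<^bsub>V\<^esub> (s (L x) \<ominus>\<^bsub>V\<^esub> s (R x))" using c(3)[OF x] sf[OF x] by simp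
    then have "x \<oplus>\<^bsub>V\<^esub> s (R x) = p x \<oplus>\<^bsub>V\<^esub> (s (L x) \<ominus>\<^bsub>V\<^esub> s (R x)) \<oplus>\<^bsub>V\<^esub> s (R x)" by simp
    also have "\<dots> = p x \<oplus>\<^bsub>V\<^esub> s (L x)"
      using x lp(1) lL(1) lR(1) linear_mapD(1)[OF s] by (simp add: V.minus_eq V.a_assoc V.l_neg)
    finally show "x \<oplus>\<^bsub>V\<^esub> s (R x) = p x \<oplus>\<^bsub>V\<^esub> s (L x)" .
  qed (use p s in auto)
qed

context ground_field
begin

lemma sw_add:
  assumes "module K U"
    and f: "\<And>a b. a \<in> carrier V \<Longrightarrow> b \<in> carrier W \<Longrightarrow> f a b \<in> carrier U"
    and g: "\<And>a b. a \<in> carrier V \<Longrightarrow> b \<in> carrier W \<Longrightarrow> g a b \<in> carrier U"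
  shows "sw K V W U X (\<lambda>a b. f a b \<oplus>\<^bsub>U\<^esub> g a b) = sw K V W U X f \<oplus>\<^bsub>U\<^esub> sw K V W U X g"
proof -
  interpret U: module K U by fact
  note e = free_eval_linear[OF K_field assms(1), of _ "carrier V \<times> carrier W"]
  have l: "linear_map K (free_module K (carrier V \<times> carrier W)) U (\<lambda>r.
      free_eval K U (\<lambda>p. f (fst p) (snd p)) r \<oplus>\<^bsub>U\<^esub> free_eval K U (\<lambda>p. g (fst p) (snd p)) r)"
    by (intro linear_map_add assms(1) e) (use f g in auto)
  show ?thesis unfolding sw_def
    by (rule free_ext[OF K_field assms(1) e l _ tensor_rep_closed])
      (use f g in \<open>auto simp: free_eval_gen[OF K_field assms(1)]\<close>)
qed

lemma cancel_right:
  assumes "module K V" "x \<in> carrier V" "y \<in> carrier V" "z \<in> carrier V" "x \<oplus>\<^bsub>V\<^esub> z = y \<oplus>\<^bsub>V\<^esub> z"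
  shows "x = y"
proof -
  interpret V: module K V by fact
  show ?thesis using V.add.right_cancel[of z x y] assms(2-5) by simp
qed

text \<open>Tensoring over a field preserves equalizers: with \<open>p\<close> and \<open>s\<close> from a splitting, \<open>(s \<otimes> id)\<close> applied to
  \<open>eq\<close> shows that \<open>(id - p) \<otimes> id\<close> kills \<open>Y\<close>.\<close>
lemma splitting_tensor_left:
  assumes [simp]: "module K V" "module K W" "module K Z" and L: "linear_map K V W L" and R: "linear_map K V W R"
    and p: "linear_map K V V p" and s: "linear_map K W V s"
    and split: "\<And>x. x \<in> carrier V \<Longrightarrow> x \<oplus>\<^bsub>V\<^esub> s (R x) = p x \<oplus>\<^bsub>V\<^esub> s (L x)"
    and Y: "Y \<in> carrier (tensor K V Z)"
    and eq: "sw K V Z (tensor K W Z) Y (\<lambda>v z. tens K W Z (L v) z) = sw K V Z (tensor K W Z) Y (\<lambda>v z. tens K W Z (R v) z)"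
  shows "sw K V Z (tensor K V Z) Y (\<lambda>v z. tens K V Z (p v) z) = Y"
proof -
  note [simp] = linear_rules[OF L] linear_rules[OF R] linear_rules[OF p] linear_rules[OF s]
  let ?T = "tensor K V Z"
  have add: "tens K V Z (x \<oplus>\<^bsub>V\<^esub> y) z = tens K V Z x z \<oplus>\<^bsub>?T\<^esub> tens K V Z y z"
    if "x \<in> carrier V" "y \<in> carrier V" "z \<in> carrier Z" for x y z
    by (rule linear_mapD(2)[OF bilinear_mapD(2)[OF tens_bilinear]]) (use that in simp_all)
  have "sw K W Z ?T (sw K V Z (tensor K W Z) Y (\<lambda>v z. tens K W Z (L v) z)) (\<lambda>w z. tens K V Z (s w) z)
    = sw K W Z ?T (sw K V Z (tensor K W Z) Y (\<lambda>v z. tens K W Z (R v) z)) (\<lambda>w z. tens K V Z (s w) z)"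
    using eq by simp
  then have sLR: "sw K V Z ?T Y (\<lambda>v z. tens K V Z (s (L v)) z) = sw K V Z ?T Y (\<lambda>v z. tens K V Z (s (R v)) z)"
    by simp
  have "sw K V Z ?T Y (\<lambda>v z. tens K V Z (p v) z) \<oplus>\<^bsub>?T\<^esub> sw K V Z ?T Y (\<lambda>v z. tens K V Z (s (L v)) z)
    = sw K V Z ?T Y (\<lambda>v z. tens K V Z (p v \<oplus>\<^bsub>V\<^esub> s (L v)) z)"
    by (subst sw_add[symmetric]) (simp_all add: add cong: sw_cong)
  also have "\<dots> = sw K V Z ?T Y (\<lambda>v z. tens K V Z (v \<oplus>\<^bsub>V\<^esub> s (R v)) z)"
    by (rule sw_cong) (simp_all add: split)
  also have "\<dots> = sw K V Z ?T Y (\<lambda>v z. tens K V Z v z) \<oplus>\<^bsub>?T\<^esub> sw K V Z ?T Y (\<lambda>v z. tens K V Z (s (R v)) z)"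
    by (subst sw_add[symmetric]) (simp_all add: add cong: sw_cong)
  finally show ?thesis
    using cancel_right[of ?T "sw K V Z ?T Y (\<lambda>v z. tens K V Z (p v) z)" Y "sw K V Z ?T Y (\<lambda>v z. tens K V Z (s (R v)) z)"] Y sLR
    by simp
qed

text \<open>Reduced to the previous lemma by flipping the two tensor factors.\<close>
lemma splitting_tensor_right:
  assumes [simp]: "module K V" "module K W" "module K Z" and L: "linear_map K V W L" and R: "linear_map K V W R"
    and p: "linear_map K V V p" and s: "linear_map K W V s"
    and split: "\<And>x. x \<in> carrier V \<Longrightarrow> x \<oplus>\<^bsub>V\<^esub> s (R x) = p x \<oplus>\<^bsub>V\<^esub> s (L x)"
    and Y: "Y \<in> carrier (tensor K Z V)"
    and eq: "sw K Z V (tensor K Z W) Y (\<lambda>z v. tens K Z W z (L v)) = sw K Z V (tensor K Z W) Y (\<lambda>z v. tens K Z W z (R v))"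
  shows "sw K Z V (tensor K Z V) Y (\<lambda>z v. tens K Z V z (p v)) = Y"
proof -
  note [simp] = linear_rules[OF L] linear_rules[OF R] linear_rules[OF p] linear_rules[OF s]
  have "sw K V Z (tensor K V Z) (sw K Z V (tensor K V Z) Y (\<lambda>z v. tens K V Z v z)) (\<lambda>v z. tens K V Z (p v) z)
    = sw K Z V (tensor K V Z) Y (\<lambda>z v. tens K V Z v z)"
  proof (rule splitting_tensor_left[OF _ _ _ L R p s split])
    have "sw K Z W (tensor K W Z) (sw K Z V (tensor K Z W) Y (\<lambda>z v. tens K Z W z (L v))) (\<lambda>z w. tens K W Z w z)
      = sw K Z W (tensor K W Z) (sw K Z V (tensor K Z W) Y (\<lambda>z v. tens K Z W z (R v))) (\<lambda>z w. tens K W Z w z)"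
      using eq by simp
    then show "sw K V Z (tensor K W Z) (sw K Z V (tensor K V Z) Y (\<lambda>z v. tens K V Z v z)) (\<lambda>v z. tens K W Z (L v) z)
      = sw K V Z (tensor K W Z) (sw K Z V (tensor K V Z) Y (\<lambda>z v. tens K V Z v z)) (\<lambda>v z. tens K W Z (R v) z)"
      by simp
  qed simp_all
  then have "sw K V Z (tensor K Z V) (sw K V Z (tensor K V Z) (sw K Z V (tensor K V Z) Y (\<lambda>z v. tens K V Z v z)) (\<lambda>v z. tens K V Z (p v) z)) (\<lambda>v z. tens K Z V z v)
    = sw K V Z (tensor K Z V) (sw K Z V (tensor K V Z) Y (\<lambda>z v. tens K V Z v z)) (\<lambda>v z. tens K Z V z v)" by simp
  then show ?thesis using Y by simp
qed

end

section \<open>The cotensor functor\<close>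

context doi_hopf_datum
begin

text \<open>All conditions on \<open>h\<close> hold after composition with \<open>i\<close>. In the condition on the coaction it is \<open>i \<otimes> id\<close>
  that has to be cancelled, which a linear left inverse of \<open>i\<close> does.\<close>
lemma doi_hopf_hom_corestrict:
  assumes V: "doi_hopf_module K H A rhoA C actC V" and P: "doi_hopf_module K H A rhoA C actC P"
    and Q: "doi_hopf_module K H A rhoA C actC Q"
    and i: "doi_hopf_hom K A C V P i" "inj_on i (carrier V)"
    and h: "\<And>x. x \<in> carrier Q \<Longrightarrow> h x \<in> carrier V" "doi_hopf_hom K A C Q P (\<lambda>x. i (h x))"
  shows "doi_hopf_hom K A C Q V h"
proof -
  interpret V: doi_hopf_module K H A rhoA C actC V by fact
  interpret P: doi_hopf_module K H A rhoA C actC P by fact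
  interpret Q: doi_hopf_module K H A rhoA C actC Q by fact
  note I = doi_hopf_homD[OF i(1) V.M.M.module_space P.M.M.module_space]
  note IH = doi_hopf_homD[OF h(2) Q.M.M.module_space P.M.M.module_space]
  obtain g where g: "linear_map K P V g" "\<And>x. x \<in> carrier V \<Longrightarrow> g (i x) = x"
    using linear_left_inverse[OF H.K_field V.M.M.module_space P.M.M.module_space I(1) i(2)] by blast
  note [simp] = H.linear_rules[OF g(1)] H.linear_rules[OF I(1)] g(2) h(1)
  have hl: "linear_map K Q V h"
    by (rule iffD1[OF linear_map_cong[OF Q.M.M.module_space] linear_map_comp[OF IH(1) g(1)]]) simp
  note [simp] = H.linear_rules[OF hl]
  have eqI: "x = y" if "x \<in> carrier V" "y \<in> carrier V" "i x = i y" for x y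
    using inj_onD[OF i(2) that(3,1,2)] .
  show ?thesis
  proof (rule doi_hopf_homI)
    fix x assume x: "x \<in> carrier Q"
    show "h (twist Q x) = twist V (h x)" using x IH(2) I(2) by (intro eqI) simp_all
    show "h (act Q a x) = act V a (h x)" if "a \<in> carrier A" for a
      using x that IH(3) I(3) by (intro eqI) simp_all
    have "sw K P C (tensor K V C) (coact P (i (h x))) (\<lambda>p c. tens K V C (g p) c) = coact V (h x)"
      using x I(4)[of "h x"] by simp
    then show "coact V (h x) = sw K Q C (tensor K V C) (coact Q x) (\<lambda>x. tens K V C (h x))"
      using x IH(4)[of x] by simp
  qed (simp_all add: hl)
qed

end

text \<open>With \<open>cotensor_right\<close>, the pair of maps \<open>N \<otimes> C \<rightarrow> N \<otimes> C' \<otimes> C\<close> whose equalizer is the cotensor product.\<close>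
definition cotensor_left ::
  "('k, 'z) ring_scheme \<Rightarrow> ('k, 'c, 'x) hom_coalgebra_scheme \<Rightarrow> ('k, 'd, 'y) hom_coalgebra_scheme
    \<Rightarrow> ('c \<Rightarrow> 'd) \<Rightarrow> ('k, 'a, 'd, 'n) doi_hopf_module \<Rightarrow> ('k, 'n, 'c) tensor \<Rightarrow> ('k, ('k, 'n, 'd) tensor, 'c) tensor" where
  "cotensor_left K C C' \<gamma> N X = (let T = tensor K (tensor K N C') C in
     sw K N C T X (\<lambda>n c. sw K C C T (comult C c) (\<lambda>c1 c2. tens K (tensor K N C') C (tens K N C' (twist N n) (\<gamma> c1)) c2)))"

definition cotensor_right ::
  "('k, 'z) ring_scheme \<Rightarrow> ('k, 'c, 'x) hom_coalgebra_scheme \<Rightarrow> ('k, 'd, 'y) hom_coalgebra_scheme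
    \<Rightarrow> ('k, 'a, 'd, 'n) doi_hopf_module \<Rightarrow> ('k, 'n, 'c) tensor \<Rightarrow> ('k, ('k, 'n, 'd) tensor, 'c) tensor" where
  "cotensor_right K C C' N X = (let T = tensor K (tensor K N C') C in
     sw K N C T X (\<lambda>n c. sw K N C' T (coact N n) (\<lambda>n0 n1. tens K (tensor K N C') C (tens K N C' n0 n1) (twist C c))))"

context monoidal_doi_hopf_morphism
begin

abbreviation "G \<equiv> cotensor_functor K rhoA C actC C' \<gamma>"
abbreviation "P \<equiv> cofree_module K H A rhoA C actC"

lemma cofree_simps [simp]:
  "carrier (P N) = carrier (tensor K N C)"
  "module K (P N) = module K (tensor K N C)"
  "linear_map K (P N) W f = linear_map K (tensor K N C) W f"
  "linear_map K W (P N) f' = linear_map K W (tensor K N C) f'"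
  "tensor K (P N) W = tensor K (tensor K N C) W"
  "tensor K W' (P N) = tensor K W' (tensor K N C)"
  "tens K (P N) W = tens K (tensor K N C) W"
  "tens K W' (P N) = tens K W' (tensor K N C)"
  "sw K (P N) W' U' X f'' = sw K (tensor K N C) W' U' X f''"
  "sw K W'' (P N) U'' X'' g'' = sw K W'' (tensor K N C) U'' X'' g''"
  "twist (P N) X' = sw K N C (tensor K N C) X' (\<lambda>n c. tens K N C (twist N n) (twist C c))"
  "act (P N) a X' = sw K A H (tensor K N C) (rhoA a) (\<lambda>a0 a1. sw K N C (tensor K N C) X' (\<lambda>n c. tens K N C (act N a0 n) (actC a1 c)))"
  "coact (P N) X' = sw K N C (tensor K (tensor K N C) C) X' (\<lambda>n c. sw K C C (tensor K (tensor K N C) C) (comult C c)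
      (\<lambda>c1 c2. tens K (tensor K N C) C (tens K N C (twist N n) c1) (untwist C c2)))"
  by (unfold cofree_module_def Let_def) simp_all

lemma cotensor_maps_linear:
  assumes "doi_hopf_module K H A rhoA C' actC' N"
  shows "linear_map K (tensor K N C) (tensor K (tensor K N C') C) (cotensor_left K C C' \<gamma> N)"
    and "linear_map K (tensor K N C) (tensor K (tensor K N C') C) (cotensor_right K C C' N)"
proof -
  interpret N: doi_hopf_module K H A rhoA C' actC' N by fact
  show "linear_map K (tensor K N C) (tensor K (tensor K N C') C) (cotensor_left K C C' \<gamma> N)"
    unfolding cotensor_left_def[abs_def] Let_def by simp
  show "linear_map K (tensor K N C) (tensor K (tensor K N C') C) (cotensor_right K C C' N)"
    unfolding cotensor_right_def[abs_def] Let_def by simp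
qed

lemma cotensor_carrier:
  assumes "doi_hopf_module K H A rhoA C' actC' N"
  shows "carrier (cotensor K C C' \<gamma> N) = {X \<in> carrier (tensor K N C). cotensor_left K C C' \<gamma> N X = cotensor_right K C C' N X}"
proof -
  interpret N: doi_hopf_module K H A rhoA C' actC' N by fact
  let ?T = "tensor K (tensor K N C') C"
  have "sweedler K ?T X (\<lambda>n c. sweedler K ?T (comult C c) (\<lambda>c1 c2. tens K (tensor K N C') C (tens K N C' (twist N n) (\<gamma> c1)) c2))
      = cotensor_left K C C' \<gamma> N X"
    "sweedler K ?T X (\<lambda>n c. sweedler K ?T (coact N n) (\<lambda>n0 n1. tens K (tensor K N C') C (tens K N C' n0 n1) (twist C c)))
      = cotensor_right K C C' N X" if X: "X \<in> carrier (tensor K N C)" for X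
    unfolding cotensor_left_def cotensor_right_def Let_def
    using X by (intro D.H.sweedler_to_sw[of N C, OF _ _ _ _ D.H.sweedler_to_sw[of C C]]
        D.H.sweedler_to_sw[of N C, OF _ _ _ _ D.H.sweedler_to_sw[of N C']]; simp)+
  then show ?thesis by (auto simp: cotensor_def tensor3_def tens3_def)
qed

lemma cotensor_projection:
  assumes N: "doi_hopf_module K H A rhoA C' actC' N"
  obtains p s where "linear_map K (tensor K N C) (tensor K N C) p"
    "linear_map K (tensor K N C) (cotensor K C C' \<gamma> N) p"
    "linear_map K (tensor K (tensor K N C') C) (tensor K N C) s"
    "\<And>x. x \<in> carrier (tensor K N C) \<Longrightarrow> cotensor_left K C C' \<gamma> N x = cotensor_right K C C' N x \<Longrightarrow> p x = x"
    "\<And>x. x \<in> carrier (tensor K N C) \<Longrightarrow> x \<oplus>\<^bsub>tensor K N C\<^esub> s (cotensor_right K C C' N x) = p x \<oplus>\<^bsub>tensor K N C\<^esub> s (cotensor_left K C C' \<gamma> N x)"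
proof -
  interpret N: doi_hopf_module K H A rhoA C' actC' N by fact
  let ?T = "tensor K N C" and ?W = "tensor K (tensor K N C') C" and ?G = "cotensor K C C' \<gamma> N"
  let ?L = "cotensor_left K C C' \<gamma> N" and ?R = "cotensor_right K C C' N"
  note lin = cotensor_maps_linear[OF N]
  have mT: "module K ?T" and mW: "module K ?W" by simp_all
  obtain p s where p: "linear_map K ?T ?T p" and s: "linear_map K ?W ?T s"
    and ps: "\<And>x. x \<in> carrier ?T \<Longrightarrow> ?L (p x) = ?R (p x)" "\<And>x. x \<in> carrier ?T \<Longrightarrow> ?L x = ?R x \<Longrightarrow> p x = x"
      "\<And>x. x \<in> carrier ?T \<Longrightarrow> x \<oplus>\<^bsub>?T\<^esub> s (?R x) = p x \<oplus>\<^bsub>?T\<^esub> s (?L x)"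
    using kernel_splitting[OF D.H.K_field mT mW lin] by blast
  have "linear_map K ?T ?G p"
    by (rule linear_mapI) (simp_all add: cotensor_carrier[OF N] linear_mapD[OF p] ps, simp_all add: cotensor_def)
  then show ?thesis using that p s ps by blast
qed

lemma cotensor_subspace:
  assumes N: "doi_hopf_module K H A rhoA C' actC' N"
  shows "module K (cotensor K C C' \<gamma> N)"
    and "linear_map K (cotensor K C C' \<gamma> N) (tensor K N C) (\<lambda>x. x)"
proof -
  interpret N: doi_hopf_module K H A rhoA C' actC' N by fact
  let ?T = "tensor K N C" and ?W = "tensor K (tensor K N C') C" and ?G = "cotensor K C C' \<gamma> N"
  have mT: "module K ?T" and mW: "module K ?W" by simp_all
  have GT: "?G = ?T\<lparr>carrier := carrier ?G\<rparr>" by (simp add: cotensor_def)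
  have sub: "submodule (carrier ?G) K ?T"
    unfolding cotensor_carrier[OF N] by (rule submodule_kernel[OF mT mW cotensor_maps_linear[OF N]])
  show "module K ?G"
    using submodule.submodule_is_module[OF sub mT] GT by simp
  show "linear_map K ?G ?T (\<lambda>x. x)"
    by (rule linear_mapI) (auto simp: cotensor_def)
qed

lemma cotensor_carrier_functor [simp]: "carrier (G N) = carrier (cotensor K C C' \<gamma> N)"
  by (simp add: cotensor_functor_def Let_def)

text \<open>Each structure map \<open>t\<close> of \<open>P(N)\<close> lifts to a map \<open>T\<close> with \<open>L t = T L\<close> and \<open>R t = T R\<close>, hence preserves the
  equalizer of \<open>L\<close> and \<open>R\<close>. For the coaction this shows that its values are equalized by \<open>L \<otimes> id\<close> and
  \<open>R \<otimes> id\<close>, so they lie in \<open>G(N) \<otimes> C\<close> since tensoring preserves equalizers. The map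
  \<open>G(N) \<otimes> C \<rightarrow> (N \<otimes> C) \<otimes> C\<close> is injective because the projection \<open>p\<close> gives it a left inverse.\<close>
lemma cotensor_doi_hopf_module:
  assumes N: "doi_hopf_module K H A rhoA C' actC' N"
  shows "doi_hopf_module K H A rhoA C actC (G N)" and "doi_hopf_hom K A C (G N) (P N) (\<lambda>x. x)"
proof -
  interpret N: doi_hopf_module K H A rhoA C' actC' N by fact
  note P = D.cofree_doi_hopf_module[OF N.M.hom_left_module_axioms]
  interpret P: doi_hopf_module K H A rhoA C actC "P N" by (rule P)
  note exch = D.H.sw_exchange[where V = N and W = C and V' = A and W' = H and X = x and Y = "rhoA a" for x a]
    D.H.sw_exchange[where V = C and W = C and V' = A and W' = H and X = "comult C c" and Y = "rhoA a" for c a]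
    D.H.sw_exchange[where V = C and W = C and V' = H and W' = H and X = "comult C c" and Y = "comult H h" for c h]
    D.H.sw_exchange[where V = N and W = C and V' = H and W' = H and X = x and Y = "comult H h" for x h]
    D.H.sw_exchange[where V = N and W = C' and V' = A and W' = H and X = "coact N n" and Y = "rhoA a" for n a]
    D.H.sw_exchange[where V = N and W = C' and V' = H and W' = H and X = "coact N n" and Y = "comult H h" for n h]
    D.H.sw_exchange[where V = N and W = C' and V' = C and W' = C and X = "coact N n" and Y = "comult C c" for n c]
  let ?T = "tensor K N C" and ?W = "tensor K (tensor K N C') C" and ?G = "cotensor K C C' \<gamma> N"
  let ?L = "cotensor_left K C C' \<gamma> N" and ?R = "cotensor_right K C C' N"
  note defs = cotensor_left_def cotensor_right_def Let_def
  note lin = cotensor_maps_linear[OF N]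
  have mT: "module K ?T" and mW: "module K ?W" by simp_all
  obtain p s where p: "linear_map K ?T ?T p" and g: "linear_map K ?T ?G p" and s: "linear_map K ?W ?T s"
    and ps: "\<And>x. x \<in> carrier ?T \<Longrightarrow> ?L x = ?R x \<Longrightarrow> p x = x"
      "\<And>x. x \<in> carrier ?T \<Longrightarrow> x \<oplus>\<^bsub>?T\<^esub> s (?R x) = p x \<oplus>\<^bsub>?T\<^esub> s (?L x)"
    using cotensor_projection[OF N] by blast
  note mG [simp] = cotensor_subspace(1)[OF N] and i = cotensor_subspace(2)[OF N]
  have Gc: "x \<in> carrier ?T" "?L x = ?R x" if "x \<in> carrier ?G" for x
    using that by (simp_all add: cotensor_carrier[OF N])
  note [simp] = D.H.linear_rules[OF i] D.H.linear_rules[OF g] D.H.linear_rules[OF p]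
  have pP: "p x = x" if "x \<in> carrier ?T" "?L x = ?R x" for x using ps(1) that .
  have closed: "?L (twist (P N) x) = ?R (twist (P N) x)"
    "?L (untwist (P N) x) = ?R (untwist (P N) x)"
    "a \<in> carrier A \<Longrightarrow> ?L (act (P N) a x) = ?R (act (P N) a x)"
    "sw K ?T C (tensor K ?T C) (coact (P N) x) (\<lambda>y c. tens K ?T C (p y) c) = coact (P N) x"
    if x: "x \<in> carrier ?G" for x a
  proof -
    note x' = Gc[OF x]
    let ?t = "\<lambda>n d c. tens K (tensor K N C') C (tens K N C' n d) c"
    show "?L (twist (P N) x) = ?R (twist (P N) x)"
      using arg_cong[OF x'(2)[unfolded defs], of "\<lambda>Y. sw K (tensor K N C') C ?W Y (\<lambda>v c. sw K N C' ?W v (\<lambda>n d. ?t (twist N n) (twist C' d) (twist C c)))"] x'(1)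
      by (simp add: defs)
    have u: "untwist (P N) x = sw K N C ?T x (\<lambda>n c. tens K N C (untwist N n) (untwist C c))"
      by (rule P.M.M.untwist_eq) (use x' in simp_all)
    show "?L (untwist (P N) x) = ?R (untwist (P N) x)"
      unfolding u
      using arg_cong[OF x'(2)[unfolded defs], of "\<lambda>Y. sw K (tensor K N C') C ?W Y (\<lambda>v c. sw K N C' ?W v (\<lambda>n d. ?t (untwist N n) (untwist C' d) (untwist C c)))"] x'(1)
      by (simp add: defs)
    \<comment> \<open>The action lifts to \<open>n \<otimes> d \<otimes> c \<mapsto> \<alpha>(a\<^sub>0) \<cdot> n \<otimes> a\<^sub>1\<^sub>1 \<cdot> d \<otimes> a\<^sub>1\<^sub>2 \<cdot> c\<close>.\<close>
    show "?L (act (P N) a x) = ?R (act (P N) a x)" if a: "a \<in> carrier A"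
      using arg_cong[OF x'(2)[unfolded defs], of "\<lambda>Y. sw K (tensor K N C') C ?W Y (\<lambda>v c. sw K N C' ?W v (\<lambda>n d. sw K A H ?W (rhoA a) (\<lambda>a0 a1. sw K H H ?W (comult H a1) (\<lambda>h1 h2.
          ?t (act N (twist A a0) n) (actC' h1 d) (actC h2 c)))))"] x'(1) a
      by (simp add: defs exch D.A.sw_coact_coassoc)
    show "sw K ?T C (tensor K ?T C) (coact (P N) x) (\<lambda>y c. tens K ?T C (p y) c) = coact (P N) x"
    proof (rule D.H.splitting_tensor_left[OF mT mW D.C.module_space lin p s ps(2)])
      show "sw K ?T C (tensor K ?W C) (coact (P N) x) (\<lambda>v z. tens K ?W C (?L v) z) = sw K ?T C (tensor K ?W C) (coact (P N) x) (\<lambda>v z. tens K ?W C (?R v) z)"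
        \<comment> \<open>The coaction lifts to \<open>n \<otimes> d \<otimes> c \<mapsto> \<alpha>(n) \<otimes> \<alpha>(d) \<otimes> c\<^sub>1 \<otimes> \<alpha>\<^sup>-\<^sup>2(c\<^sub>2)\<close>.\<close>
        using arg_cong[OF x'(2)[unfolded defs], of "\<lambda>Y. sw K (tensor K N C') C (tensor K ?W C) Y (\<lambda>v c. sw K N C' (tensor K ?W C) v (\<lambda>n d. sw K C C (tensor K ?W C) (comult C c) (\<lambda>c1 c2.
          tens K ?W C (?t (twist N n) (twist C' d) c1) (untwist C (untwist C c2)))))"] x'(1)
        by (simp add: defs exch D.C.sw_coassoc)
    qed (use x' in simp_all)
  qed
  have i': "linear_map K ?G (P N) (\<lambda>x. x)" and g': "linear_map K (P N) ?G p"
    using i g by (simp_all only: cofree_simps)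
  note sub = D.doi_hopf_submodule[OF P mG i' g']
  have on_G: "p x = x" "p (twist (P N) x) = twist (P N) x" "p (untwist (P N) x) = untwist (P N) x"
      "a \<in> carrier A \<Longrightarrow> p (act (P N) a x) = act (P N) a x"
      "sw K (P N) C (tensor K (P N) C) (coact (P N) x) (\<lambda>y c. tens K (P N) C (p y) c) = coact (P N) x"
      "tensor_map K N C (twist N) (twist C) x = p (twist (P N) x)"
      "a \<in> carrier A \<Longrightarrow> sweedler K (tensor K N C) (rhoA a) (\<lambda>a0 a1. tensor_map K N C (act N a0) (actC a1) x) = p (act (P N) a x)"
    if x: "x \<in> carrier ?G" for x a
  proof -
    note x' = Gc[OF x]
    have pfix: "p (twist (P N) x) = twist (P N) x" "p (untwist (P N) x) = untwist (P N) x"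
       "a \<in> carrier A \<Longrightarrow> p (act (P N) a x) = act (P N) a x" for a
      using closed(1-3)[OF x] x' P.M.M.twist_rules(1)[of x] P.M.M.untwist_in[of x] P.M.act_rules(1)[of a x]
      by (simp_all only: pP cofree_simps(1))
    show "p x = x" using x' by (rule pP)
    show "p (twist (P N) x) = twist (P N) x" "p (untwist (P N) x) = untwist (P N) x"
      "a \<in> carrier A \<Longrightarrow> p (act (P N) a x) = act (P N) a x" by (rule pfix; assumption?)+
    show "sw K (P N) C (tensor K (P N) C) (coact (P N) x) (\<lambda>y c. tens K (P N) C (p y) c) = coact (P N) x"
      using closed(4)[OF x] by (simp only: cofree_simps)
    show "tensor_map K N C (twist N) (twist C) x = p (twist (P N) x)"
      unfolding pfix(1) using x' by (simp add: D.H.tensor_map_sw)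
    show "sweedler K (tensor K N C) (rhoA a) (\<lambda>a0 a1. tensor_map K N C (act N a0) (actC a1) x) = p (act (P N) a x)"
      if a: "a \<in> carrier A"
      by (subst pfix(3)[OF a], unfold cofree_simps, intro D.H.sweedler_to_sw D.H.tensor_map_sw) (use a x' in simp_all)
  qed
  have coact_G: "inv_into (carrier (tensor K ?G C)) (tensor_map K (tensor K N C) C (\<lambda>Y. Y) (\<lambda>c. c))
      (sweedler K (tensor3 K N C C) x (\<lambda>n c. sweedler K (tensor3 K N C C) (comult C c) (\<lambda>c1 c2. tens3 K N C C (twist N n) c1 (untwist C c2))))
     = sw K (P N) C (tensor K ?G C) (coact (P N) x) (\<lambda>y c. tens K ?G C (p y) c)"
    if x: "x \<in> carrier ?G" for x
  proof -
    note x' = Gc[OF x]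
    let ?v = "sweedler K (tensor3 K N C C) x (\<lambda>n c. sweedler K (tensor3 K N C C) (comult C c) (\<lambda>c1 c2. tens3 K N C C (twist N n) c1 (untwist C c2)))"
    let ?i = "tensor_map K (tensor K N C) C (\<lambda>Y. Y) (\<lambda>c. c)"
    let ?z = "sw K (P N) C (tensor K ?G C) (coact (P N) x) (\<lambda>y c. tens K ?G C (p y) c)"
    have v: "?v = coact (P N) x"
      unfolding tensor3_def tens3_def cofree_simps using x'
      by (intro D.H.sweedler_to_sw[of N C, OF _ _ _ _ D.H.sweedler_to_sw[of C C]]) simp_all
    have il: "?i y = sw K ?G C (tensor K ?T C) y (\<lambda>v c. tens K ?T C v c)" if "y \<in> carrier (tensor K ?G C)" for y
      using that by (intro D.H.tensor_map_sw) (simp_all add: i)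
    have "inj_on ?i (carrier (tensor K ?G C))"
    proof (rule inj_on_inverseI[where g = "\<lambda>y. sw K ?T C (tensor K ?G C) y (\<lambda>v c. tens K ?G C (p v) c)"])
      fix y assume y: "y \<in> carrier (tensor K ?G C)"
      have "sw K ?G C (tensor K ?G C) y (\<lambda>v c. tens K ?G C (p v) c) = sw K ?G C (tensor K ?G C) y (\<lambda>v c. tens K ?G C v c)"
        by (rule D.H.sw_cong) (use Gc pP in simp_all)
      then show "sw K ?T C (tensor K ?G C) (?i y) (\<lambda>v c. tens K ?G C (p v) c) = y"
        using y by (simp add: il)
    qed
    moreover have "?z \<in> carrier (tensor K ?G C)" by simp
    moreover have "?i ?z = ?v"
      unfolding v using il[of ?z] closed(4)[OF x] x' by simp
    ultimately show "inv_into (carrier (tensor K ?G C)) ?i ?v = ?z" by (rule inv_into_f_eq)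
  qed
  show "doi_hopf_module K H A rhoA C actC (G N)" "doi_hopf_hom K A C (G N) (P N) (\<lambda>x. x)"
    unfolding cotensor_functor_def Let_def
    by (rule sub; (rule on_G coact_G; assumption))+
qed

end

section \<open>Functoriality, and the induction functor\<close>

context monoidal_doi_hopf_datum
begin

lemma doi_hopf_tensor_hom:
  assumes M: "doi_hopf_module K H A rhoA C actC M" and N: "doi_hopf_module K H A rhoA C actC N"
    and M': "doi_hopf_module K H A rhoA C actC M'" and N': "doi_hopf_module K H A rhoA C actC N'"
    and f: "doi_hopf_hom K A C M M' f" and g: "doi_hopf_hom K A C N N' g"
  shows "doi_hopf_hom K A C (doi_hopf_tensor K A C M N) (doi_hopf_tensor K A C M' N')
    (\<lambda>X. sw K M N (tensor K M' N') X (\<lambda>m n. tens K M' N' (f m) (g n)))"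
proof -
  interpret M: doi_hopf_module K H A rhoA C actC M by fact
  interpret N: doi_hopf_module K H A rhoA C actC N by fact
  interpret M': doi_hopf_module K H A rhoA C actC M' by fact
  interpret N': doi_hopf_module K H A rhoA C actC N' by fact
  note F = doi_hopf_homD[OF f M.M.M.module_space M'.M.M.module_space]
  note G = doi_hopf_homD[OF g N.M.M.module_space N'.M.M.module_space]
  note [simp] = H.linear_rules[OF F(1)] H.linear_rules[OF G(1)]
  show ?thesis
    by (rule doi_hopf_homI, unfold tensor_simps)
      (simp_all add: tensor_structure[OF M N] tensor_structure[OF M' N'] F(2-4) G(2-4))
qed

lemma doi_hopf_tensor_iso:
  assumes "doi_hopf_iso K H A rhoA C actC M M'" "doi_hopf_iso K H A rhoA C actC N N'"
  shows "doi_hopf_iso K H A rhoA C actC (doi_hopf_tensor K A C M N) (doi_hopf_tensor K A C M' N')"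
proof -
  from assms have M: "doi_hopf_module K H A rhoA C actC M" and N: "doi_hopf_module K H A rhoA C actC N"
    and M': "doi_hopf_module K H A rhoA C actC M'" and N': "doi_hopf_module K H A rhoA C actC N'"
    by (simp_all add: doi_hopf_iso_def)
  interpret M: doi_hopf_module K H A rhoA C actC M by fact
  interpret N: doi_hopf_module K H A rhoA C actC N by fact
  interpret M': doi_hopf_module K H A rhoA C actC M' by fact
  interpret N': doi_hopf_module K H A rhoA C actC N' by fact
  obtain f f' where f: "doi_hopf_hom K A C M M' f" "doi_hopf_hom K A C M' M f'"
    "\<And>m. m \<in> carrier M \<Longrightarrow> f' (f m) = m" "\<And>m. m \<in> carrier M' \<Longrightarrow> f (f' m) = m"
    using assms(1) unfolding doi_hopf_iso_def by blast
  obtain g g' where g: "doi_hopf_hom K A C N N' g" "doi_hopf_hom K A C N' N g'"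
    "\<And>m. m \<in> carrier N \<Longrightarrow> g' (g m) = m" "\<And>m. m \<in> carrier N' \<Longrightarrow> g (g' m) = m"
    using assms(2) unfolding doi_hopf_iso_def by blast
  note [simp] = H.linear_rules[OF doi_hopf_homD(1)[OF f(1) M.M.M.module_space M'.M.M.module_space]]
    H.linear_rules[OF doi_hopf_homD(1)[OF f(2) M'.M.M.module_space M.M.M.module_space]]
    H.linear_rules[OF doi_hopf_homD(1)[OF g(1) N.M.M.module_space N'.M.M.module_space]]
    H.linear_rules[OF doi_hopf_homD(1)[OF g(2) N'.M.M.module_space N.M.M.module_space]]
  show ?thesis
    unfolding doi_hopf_iso_def
    by (intro conjI tensor_doi_hopf_module M N M' N', intro exI conjI,
        rule doi_hopf_tensor_hom[OF M N M' N' f(1) g(1)], rule doi_hopf_tensor_hom[OF M' N' M N f(2) g(2)])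
      (simp_all add: f(3,4) g(3,4))
qed

end

lemma doi_hopf_iso_sym: "doi_hopf_iso K H A rhoA C actC M N \<Longrightarrow> doi_hopf_iso K H A rhoA C actC N M"
  unfolding doi_hopf_iso_def by blast

context doi_hopf_datum
begin

lemma doi_hopf_iso_refl:
  assumes "doi_hopf_module K H A rhoA C actC M"
  shows "doi_hopf_iso K H A rhoA C actC M M"
proof -
  interpret M: doi_hopf_module K H A rhoA C actC M by fact
  have "doi_hopf_hom K A C M M (\<lambda>x. x)" by (rule doi_hopf_homI) simp_all
  then show ?thesis using assms unfolding doi_hopf_iso_def by blast
qed

lemma doi_hopf_iso_trans:
  assumes "doi_hopf_iso K H A rhoA C actC M N" "doi_hopf_iso K H A rhoA C actC N P"
  shows "doi_hopf_iso K H A rhoA C actC M P"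
proof -
  from assms have M: "doi_hopf_module K H A rhoA C actC M" and N: "doi_hopf_module K H A rhoA C actC N"
    and P: "doi_hopf_module K H A rhoA C actC P"
    by (simp_all add: doi_hopf_iso_def)
  obtain f f' where f: "doi_hopf_hom K A C M N f" "doi_hopf_hom K A C N M f'"
    "\<And>m. m \<in> carrier M \<Longrightarrow> f' (f m) = m" "\<And>m. m \<in> carrier N \<Longrightarrow> f (f' m) = m"
    using assms(1) unfolding doi_hopf_iso_def by blast
  obtain g g' where g: "doi_hopf_hom K A C N P g" "doi_hopf_hom K A C P N g'"
    "\<And>m. m \<in> carrier N \<Longrightarrow> g' (g m) = m" "\<And>m. m \<in> carrier P \<Longrightarrow> g (g' m) = m"
    using assms(2) unfolding doi_hopf_iso_def by blast
  have cl: "f m \<in> carrier N" if "m \<in> carrier M" for m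
    using f(1) that by (auto simp: doi_hopf_hom_def linear_map_def)
  have cl': "g' m \<in> carrier N" if "m \<in> carrier P" for m
    using g(2) that by (auto simp: doi_hopf_hom_def linear_map_def)
  show ?thesis
    unfolding doi_hopf_iso_def
    by (intro conjI M P, intro exI conjI, rule doi_hopf_hom_compose[OF M N P f(1) g(1)],
        rule doi_hopf_hom_compose[OF P N M g(2) f(2)])
      (simp_all add: f(3,4) g(3,4) cl cl')
qed

end

context monoidal_doi_hopf_morphism
begin

lemma cofree_hom:
  assumes N: "doi_hopf_module K H A rhoA C' actC' N" and N': "doi_hopf_module K H A rhoA C' actC' N'"
    and f: "doi_hopf_hom K A C' N N' f"
  shows "doi_hopf_hom K A C (P N) (P N') (\<lambda>X. sw K N C (tensor K N' C) X (\<lambda>n c. tens K N' C (f n) c))"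
proof -
  interpret N: doi_hopf_module K H A rhoA C' actC' N by fact
  interpret N': doi_hopf_module K H A rhoA C' actC' N' by fact
  note F = D'.doi_hopf_homD[OF f N.M.M.module_space N'.M.M.module_space]
  note [simp] = D.H.linear_rules[OF F(1)]
  show ?thesis
    by (rule D.doi_hopf_homI, unfold cofree_simps) (simp_all add: F(2-4))
qed

lemma cotensor_hom:
  assumes N: "doi_hopf_module K H A rhoA C' actC' N" and N': "doi_hopf_module K H A rhoA C' actC' N'"
    and f: "doi_hopf_hom K A C' N N' f"
  shows "doi_hopf_hom K A C (G N) (G N') (\<lambda>X. sw K N C (tensor K N' C) X (\<lambda>n c. tens K N' C (f n) c))"
proof -
  interpret N: doi_hopf_module K H A rhoA C' actC' N by fact
  interpret N': doi_hopf_module K H A rhoA C' actC' N' by fact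
  note F = D'.doi_hopf_homD[OF f N.M.M.module_space N'.M.M.module_space]
  note [simp] = D.H.linear_rules[OF F(1)]
  let ?F = "\<lambda>X. sw K N C (tensor K N' C) X (\<lambda>n c. tens K N' C (f n) c)"
  note PN = D.cofree_doi_hopf_module[OF N.M.hom_left_module_axioms]
  note PN' = D.cofree_doi_hopf_module[OF N'.M.hom_left_module_axioms]
  note GN = cotensor_doi_hopf_module[OF N] and GN' = cotensor_doi_hopf_module[OF N']
  have mem: "?F X \<in> carrier (G N')" if X: "X \<in> carrier (G N)" for X
  proof -
    let ?W = "tensor K (tensor K N' C') C"
    have X: "X \<in> carrier (tensor K N C)" "cotensor_left K C C' \<gamma> N X = cotensor_right K C C' N X"
      using X by (simp_all add: cotensor_carrier[OF N])
    show ?thesis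
      using X(1) arg_cong[OF X(2)[unfolded cotensor_left_def cotensor_right_def Let_def], of "\<lambda>Y. sw K (tensor K N C') C ?W Y (\<lambda>v c. sw K N C' ?W v (\<lambda>n d.
        tens K (tensor K N' C') C (tens K N' C' (f n) d) c))"]
      by (simp add: cotensor_carrier[OF N'] cotensor_left_def cotensor_right_def Let_def F)
  qed
  show ?thesis
    by (rule D.doi_hopf_hom_corestrict[where i = "\<lambda>x. x" and h = ?F, OF GN'(1) PN' GN(1) GN'(2)])
      (use mem D.doi_hopf_hom_compose[OF GN(1) PN PN' GN(2) cofree_hom[OF N N' f]] in \<open>simp_all only: inj_on_id2\<close>)
qed

lemma cotensor_iso:
  assumes "doi_hopf_iso K H A rhoA C' actC' N N'"
  shows "doi_hopf_iso K H A rhoA C actC (G N) (G N')"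
proof -
  from assms have N: "doi_hopf_module K H A rhoA C' actC' N" and N': "doi_hopf_module K H A rhoA C' actC' N'"
    by (simp_all add: doi_hopf_iso_def)
  interpret N: doi_hopf_module K H A rhoA C' actC' N by fact
  interpret N': doi_hopf_module K H A rhoA C' actC' N' by fact
  obtain f f' where f: "doi_hopf_hom K A C' N N' f" "doi_hopf_hom K A C' N' N f'"
    "\<And>m. m \<in> carrier N \<Longrightarrow> f' (f m) = m" "\<And>m. m \<in> carrier N' \<Longrightarrow> f (f' m) = m"
    using assms(1) unfolding doi_hopf_iso_def by blast
  note [simp] = D.H.linear_rules[OF D'.doi_hopf_homD(1)[OF f(1) N.M.M.module_space N'.M.M.module_space]]
    D.H.linear_rules[OF D'.doi_hopf_homD(1)[OF f(2) N'.M.M.module_space N.M.M.module_space]]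
  show ?thesis
    unfolding doi_hopf_iso_def
    by (intro conjI cotensor_doi_hopf_module(1) N N', intro exI conjI, rule cotensor_hom[OF N N' f(1)],
        rule cotensor_hom[OF N' N f(2)])
      (simp_all add: f(3,4) cotensor_carrier[OF N] cotensor_carrier[OF N'])
qed

end

lemma the_elem_image_const:
  assumes "Y \<noteq> {}" "\<And>X. X \<in> Y \<Longrightarrow> h X = c"
  shows "the_elem (h ` Y) = c"
proof -
  have "h ` Y = {c}" using assms by force
  then show ?thesis by simp
qed

context monoidal_doi_hopf_morphism
begin

abbreviation "F \<equiv> induction_functor K A rhoA C' actC' \<gamma>"

text \<open>The map \<open>b \<otimes> m \<mapsto> \<alpha>\<^sup>-\<^sup>1(b \<cdot> m)\<close> respects the balancing relations because
  \<open>\<alpha>(b) \<cdot> (a \<cdot> m) = (b a) \<cdot> \<alpha>(m)\<close>. Its inverse is \<open>m \<mapsto> 1 \<otimes> m\<close>, since \<open>b \<otimes> m\<close> and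
  \<open>1 \<otimes> \<alpha>\<^sup>-\<^sup>1(b \<cdot> m)\<close> differ by a relation. The structure maps of \<open>F(M)\<close>, defined on representatives, are
  therefore those transported from the twisted module.\<close>
lemma induction_iso_twisted:
  assumes M: "doi_hopf_module K H A rhoA C actC M"
  shows "doi_hopf_iso K H A rhoA C' actC' (F M) (twisted_module K A C C' \<gamma> M)"
proof -
  interpret M: doi_hopf_module K H A rhoA C actC M by fact
  note tw = twisted_doi_hopf_module[OF M]
  interpret tw: doi_hopf_module K H A rhoA C' actC' "twisted_module K A C C' \<gamma> M" by (rule tw)
  let ?T = "tensor K A M" and ?F = "balanced_tensor K A M" and ?R = "balanced_relations K A M"
    and ?cls = "balanced_class K A M" and ?M = "twisted_module K A C C' \<gamma> M"
  let ?e = "\<lambda>X. sw K A M M X (\<lambda>b m. act M (untwist A b) (untwist M m))"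
  let ?S = "{tens K A M (b \<otimes>\<^bsub>A\<^esub> a) (twist M m) \<ominus>\<^bsub>?T\<^esub> tens K A M (twist A b) (act M a m) | a b m.
          a \<in> carrier A \<and> b \<in> carrier A \<and> m \<in> carrier M}"
  have mT: "module K ?T" by simp
  interpret T: module K ?T by (rule mT)
  have mM: "module K M" by simp
  have S: "?S \<subseteq> carrier ?T" by auto
  have subR: "submodule ?R K ?T" unfolding balanced_relations_def by (rule span_in_submodule[OF mT S])
  interpret Q: submodule_of K ?T ?R by (intro submodule_of.intro submodule_of_axioms.intro mT subR)
  have mF [simp]: "module K ?F" unfolding balanced_tensor_def by (rule Q.quotient_module)
  have cls: "linear_map K ?T ?F ?cls"
    using Q.projection_linear by (simp only: balanced_tensor_def balanced_class_def[abs_def])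
  note [simp] = D.H.linear_rules[OF cls]
  have Fc: "carrier ?F = ?cls ` carrier ?T"
    by (simp add: balanced_tensor_def balanced_class_def[abs_def] Q.quotient_carrier)
  have e: "linear_map K ?T M ?e" by simp
  have ker: "?R \<subseteq> {X \<in> carrier ?T. ?e X = \<zero>\<^bsub>M\<^esub>}"
    unfolding balanced_relations_def
  proof (rule span_in_least[OF submodule_kernel[OF mT mM e]])
    show "linear_map K ?T M (\<lambda>_. \<zero>\<^bsub>M\<^esub>)" by (rule linear_mapI) auto
    have "?e (tens K A M (b \<otimes>\<^bsub>A\<^esub> a) (twist M m) \<ominus>\<^bsub>?T\<^esub> tens K A M (twist A b) (act M a m)) = \<zero>\<^bsub>M\<^esub>"
      if "a \<in> carrier A" "b \<in> carrier A" "m \<in> carrier M" for a b m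
      using that by (subst linear_map_minus[OF mT mM e]) (simp_all add: module_minus_eq_zero[OF mM] M.M.act_mult)
    then show "?S \<subseteq> {X \<in> carrier ?T. ?e X = \<zero>\<^bsub>M\<^esub>}" by auto
  qed
  have cls_e: "?e X = ?e X'" if "X \<in> carrier ?T" "X' \<in> carrier ?T" "?cls X = ?cls X'" for X X'
  proof -
    have "X \<ominus>\<^bsub>?T\<^esub> X' \<in> ?R" using Q.coset_eq_iff[OF that(1,2)] that(3) by (simp add: balanced_class_def)
    then have "?e (X \<ominus>\<^bsub>?T\<^esub> X') = \<zero>\<^bsub>M\<^esub>" using ker by blast
    then show ?thesis
      using that linear_map_minus[OF mT mM e that(1,2)] module_minus_eq_zero[OF mM] linear_mapD(1)[OF e] by simp
  qed
  define g where "g m = ?cls (tens K A M \<one>\<^bsub>A\<^esub> m)" for m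
  have g: "linear_map K M ?F g" unfolding g_def[abs_def] by simp
  have cls_g: "?cls X = g (?e X)" if X: "X \<in> carrier ?T" for X
  proof (rule D.H.tensor_ext[OF _ _ mF X cls linear_map_comp[OF e g]])
    fix b m assume b: "b \<in> carrier A" and m: "m \<in> carrier M"
    \<comment> \<open>The relation for \<open>1\<close>, \<open>\<alpha>\<^sup>-\<^sup>1(b)\<close> and \<open>\<alpha>\<^sup>-\<^sup>1(m)\<close>.\<close>
    have "tens K A M (\<one>\<^bsub>A\<^esub> \<otimes>\<^bsub>A\<^esub> untwist A b) (twist M (untwist M m)) \<ominus>\<^bsub>?T\<^esub> tens K A M (twist A \<one>\<^bsub>A\<^esub>) (act M (untwist A b) (untwist M m)) \<in> ?R"
      unfolding balanced_relations_def
      by (rule subsetD[OF span_in_superset]) (use b m in \<open>blast intro: D.A.unit_closed D.A.untwist_in M.M.M.untwist_in\<close>)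
    then show "?cls (tens K A M b m) = g (?e (tens K A M b m))"
      using b m Q.coset_eq_iff[of "tens K A M b m" "tens K A M \<one>\<^bsub>A\<^esub> (act M (untwist A b) (untwist M m))"]
      by (simp add: balanced_class_def g_def)
  qed simp_all
  note [simp] = D.H.linear_rules[OF g]
  have e_g: "?e (tens K A M \<one>\<^bsub>A\<^esub> m) = m" if "m \<in> carrier M" for m using that by simp
  have inj: "inj_on g (carrier M)"
  proof (rule inj_onI)
    fix x y assume "x \<in> carrier M" "y \<in> carrier M" "g x = g y"
    then show "x = y" unfolding g_def using cls_e[of "tens K A M \<one>\<^bsub>A\<^esub> x" "tens K A M \<one>\<^bsub>A\<^esub> y"] by simp
  qed
  obtain f where f: "linear_map K ?F M f" "\<And>m. m \<in> carrier M \<Longrightarrow> f (g m) = m"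
    using linear_left_inverse[OF D.H.K_field mM mF g inj] by blast
  note [simp] = D.H.linear_rules[OF f(1)]
  have f_cls: "f (?cls X) = ?e X" if "X \<in> carrier ?T" for X
    using that by (simp only: cls_g f(2) linear_mapD(1)[OF e])
  have gf: "g (f Y) = Y" if "Y \<in> carrier ?F" for Y
    using that by (auto simp only: Fc f_cls cls_g[symmetric])
  have coset: "Y \<noteq> {}" "\<And>X. X \<in> Y \<Longrightarrow> X \<in> carrier ?T \<and> f Y = ?e X" if Y: "Y \<in> carrier ?F" for Y
  proof -
    obtain Z where Z: "Z \<in> carrier ?T" "Y = ?cls Z" using Y by (auto simp only: Fc)
    show "Y \<noteq> {}" using Q.N.a_rcos_self[OF Z(1)] Z(2) by (auto simp: balanced_class_def)
    fix X assume "X \<in> Y"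
    then have X: "X \<in> ?R +>\<^bsub>?T\<^esub> Z" using Z by (simp add: balanced_class_def)
    then have "X \<in> carrier ?T" "?cls Z = ?cls X"
      using Q.N.a_elemrcos_carrier[OF Z(1)] Q.N.a_repr_independence'[OF X Z(1)] by (simp_all add: balanced_class_def)
    then show "X \<in> carrier ?T \<and> f Y = ?e X" using f_cls Z by simp
  qed
  have f': "linear_map K ?F ?M f" and g': "linear_map K ?M ?F g"
    using f(1) g by (simp_all add: twisted_module_def)
  have t_F: "the_elem ((\<lambda>X. ?cls (tensor_map K A M (twist A) (twist M) X)) ` Y) = g (twist ?M (f Y))"
    if Y: "Y \<in> carrier ?F" for Y
    using coset[OF Y]
    by (intro the_elem_image_const) (auto simp: twisted_simps D.H.tensor_map_sw[of A M] cls_g)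
  have a_F: "the_elem ((\<lambda>X. ?cls (tensor_map K A M (\<lambda>b. twist A a \<otimes>\<^bsub>A\<^esub> b) (twist M) X)) ` Y) = g (act ?M a (f Y))"
    if Y: "Y \<in> carrier ?F" and a: "a \<in> carrier A" for Y a
    using coset[OF Y] a
    by (intro the_elem_image_const) (auto simp: twisted_simps D.H.tensor_map_sw[of A M] cls_g M.M.act_mult)
  have r_F: "the_elem ((\<lambda>X. sweedler K (tensor K ?F C') X (\<lambda>b m. sweedler K (tensor K ?F C') (rhoA b) (\<lambda>b0 b1.
              sweedler K (tensor K ?F C') (coact M m) (\<lambda>m0 m1.
                tens K ?F C' (?cls (tens K A M b0 m0)) (untwist C' (untwist C' (actC' b1 (\<gamma> m1)))))))) ` Y)
     = sw K ?M C' (tensor K ?F C') (coact ?M (f Y)) (\<lambda>y c. tens K ?F C' (g y) c)"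
    if Y: "Y \<in> carrier ?F" for Y
  proof (rule the_elem_image_const)
    show "Y \<noteq> {}" using coset(1)[OF Y] .
    fix X assume "X \<in> Y"
    note X = coset(2)[OF Y this]
    have "sweedler K (tensor K ?F C') X (\<lambda>b m. sweedler K (tensor K ?F C') (rhoA b) (\<lambda>b0 b1.
              sweedler K (tensor K ?F C') (coact M m) (\<lambda>m0 m1.
                tens K ?F C' (?cls (tens K A M b0 m0)) (untwist C' (untwist C' (actC' b1 (\<gamma> m1)))))))
       = sw K A M (tensor K ?F C') X (\<lambda>b m. sw K A H (tensor K ?F C') (rhoA b) (\<lambda>b0 b1.
              sw K M C (tensor K ?F C') (coact M m) (\<lambda>m0 m1.
                tens K ?F C' (g (act M (untwist A b0) (untwist M m0))) (untwist C' (untwist C' (actC' b1 (\<gamma> m1)))))))"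
      using X by (intro D.H.sweedler_to_sw[of A M, OF _ _ _ _ D.H.sweedler_to_sw[of A H, OF _ _ _ _ D.H.sweedler_to_sw[of M C]]]) (simp_all add: cls_g)
    also have "\<dots> = sw K ?M C' (tensor K ?F C') (coact ?M (f Y)) (\<lambda>y c. tens K ?F C' (g y) c)"
      using X by (simp add: twisted_simps)
    finally show "sweedler K (tensor K ?F C') X (\<lambda>b m. sweedler K (tensor K ?F C') (rhoA b) (\<lambda>b0 b1.
              sweedler K (tensor K ?F C') (coact M m) (\<lambda>m0 m1.
                tens K ?F C' (?cls (tens K A M b0 m0)) (untwist C' (untwist C' (actC' b1 (\<gamma> m1)))))))
      = sw K ?M C' (tensor K ?F C') (coact ?M (f Y)) (\<lambda>y c. tens K ?F C' (g y) c)" .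
  qed
  have fg: "f (g x) = x" if "x \<in> carrier ?M" for x using f(2)[of x] that by (simp only: twisted_simps)
  note sub = D'.doi_hopf_submodule[OF tw mF f' g']
  have leg: "sw K ?M C' (tensor K ?M C') (coact ?M (f Y)) (\<lambda>y c. tens K ?M C' (f (g y)) c) = coact ?M (f Y)"
    if "Y \<in> carrier ?F" for Y
  proof -
    have "sw K ?M C' (tensor K ?M C') (coact ?M (f Y)) (\<lambda>y c. tens K ?M C' (f (g y)) c)
      = sw K ?M C' (tensor K ?M C') (coact ?M (f Y)) (\<lambda>y c. tens K ?M C' y c)"
      by (rule D.H.sw_cong) (simp_all only: fg)
    also have "\<dots> = coact ?M (f Y)"
      by (rule D.H.sw_id) (use that linear_mapD(1)[OF f'] in simp_all)
    finally show ?thesis .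
  qed
  have cl: "f Y \<in> carrier ?M" "twist ?M (f Y) \<in> carrier ?M" "untwist ?M (f Y) \<in> carrier ?M"
    "a \<in> carrier A \<Longrightarrow> act ?M a (f Y) \<in> carrier ?M" if "Y \<in> carrier ?F" for Y a
    using linear_mapD(1)[OF f' that] by (simp_all add: tw.M.M.untwist_in)
  have FM: "doi_hopf_module K H A rhoA C' actC' (F M)" "doi_hopf_hom K A C' (F M) ?M f"
    unfolding induction_functor_def Let_def
    by (rule sub; (intro gf fg leg t_F a_F r_F cl; assumption))+
  have "bij_betw f (carrier ?F) (carrier ?M)"
    by (rule bij_betw_byWitness[of _ g]) (use gf fg cl(1) linear_mapD(1)[OF g'] in auto)
  then show ?thesis
    by (intro D'.doi_hopf_isoI[OF FM(1) tw FM(2)]) (simp add: induction_functor_def Let_def)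
qed

end

section \<open>The cotensor product of the target coalgebra\<close>

context monoidal_doi_hopf_datum
begin

lemma self_simps [simp]:
  "carrier (doi_hopf_self K A rhoA C actC) = carrier C"
  "module K (doi_hopf_self K A rhoA C actC) = module K C"
  "linear_map K (doi_hopf_self K A rhoA C actC) W f = linear_map K C W f"
  "linear_map K W (doi_hopf_self K A rhoA C actC) f' = linear_map K W C f'"
  "tensor K (doi_hopf_self K A rhoA C actC) W = tensor K C W"
  "tensor K W (doi_hopf_self K A rhoA C actC) = tensor K W C"
  "tens K (doi_hopf_self K A rhoA C actC) W = tens K C W"
  "tens K W (doi_hopf_self K A rhoA C actC) = tens K W C"
  "sw K (doi_hopf_self K A rhoA C actC) W' U' X f'' = sw K C W' U' X f''"
  "sw K W'' (doi_hopf_self K A rhoA C actC) U'' X'' g'' = sw K W'' C U'' X'' g''"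
  "twist (doi_hopf_self K A rhoA C actC) = twist C"
  by (unfold doi_hopf_self_def) simp_all

lemma self_structure:
  assumes "c \<in> carrier C"
  shows "a \<in> carrier A \<Longrightarrow> act (doi_hopf_self K A rhoA C actC) a c = sw K A H C (rhoA a) (\<lambda>a0 a1. counit A a0 \<odot>\<^bsub>C\<^esub> actC a1 c)"
    and "coact (doi_hopf_self K A rhoA C actC) c = sw K C C (tensor K C C) (comult C c) (\<lambda>x y. tens K C C x (untwist C y))"
  unfolding doi_hopf_self_def make_simps using assms
  by (intro H.sweedler_sw' H.tensor_map_sw; simp)+

end

context ground_field
begin

lemma smult_commute:
  assumes "module K U" "k \<in> carrier K" "l \<in> carrier K" "u \<in> carrier U"
  shows "k \<odot>\<^bsub>U\<^esub> (l \<odot>\<^bsub>U\<^esub> u) = l \<odot>\<^bsub>U\<^esub> (k \<odot>\<^bsub>U\<^esub> u)"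
proof -
  interpret U: module K U by fact
  show ?thesis using assms(2-) by (simp add: U.smult_assoc1[symmetric] U.R.m_comm)
qed

end

context monoidal_doi_hopf_morphism
begin

text \<open>The map \<open>\<epsilon> \<otimes> id\<close> is a morphism on all of \<open>C' \<otimes> C\<close>. On the cotensor product it is injective: applying
  \<open>n \<otimes> d \<otimes> c \<mapsto> \<epsilon>(n) d \<otimes> \<alpha>\<^sup>-\<^sup>1(c)\<close> to the two sides of the defining equation recovers \<open>X\<close> from its
  image.\<close>
lemma cotensor_self_iso:
  "doi_hopf_iso K H A rhoA C actC (G (doi_hopf_self K A rhoA C' actC')) (doi_hopf_self K A rhoA C actC)"
proof -
  let ?N = "doi_hopf_self K A rhoA C' actC'" and ?C = "doi_hopf_self K A rhoA C actC"
  note N = D'.self_doi_hopf_module and C = D.self_doi_hopf_module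
  interpret N: doi_hopf_module K H A rhoA C' actC' ?N by (rule N)
  note PN = D.cofree_doi_hopf_module[OF N.M.hom_left_module_axioms]
  note GN = cotensor_doi_hopf_module[OF N]
  note self = D.self_structure D'.self_structure
  let ?f = "\<lambda>X. sw K C' C C X (\<lambda>d c. counit C' d \<odot>\<^bsub>C\<^esub> c)"
  let ?g = "\<lambda>c. sw K C C (tensor K C' C) (comult C c) (\<lambda>c1 c2. tens K C' C (\<gamma> c1) (untwist C c2))"
  let ?W = "tensor K (tensor K C' C') C"
  note comm = D.H.smult_commute[where k = "counit A a" and l = "counit H h" for a h]
    D.H.smult_commute[where k = "counit C' d" and l = "counit A a" for a d]
    D.H.smult_commute[where k = "counit C' d" and l = "counit H h" for h d]
  note exch = D.H.sw_exchange[where V = C' and W = C and V' = A and W' = H and X = x and Y = "rhoA a" for x a]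
  have f: "doi_hopf_hom K A C (P ?N) ?C ?f"
    by (rule D.doi_hopf_homI, unfold cofree_simps D.self_simps D'.self_simps)
      (simp_all add: self exch comm)
  have hom: "doi_hopf_hom K A C (G ?N) ?C ?f"
    by (rule D.doi_hopf_hom_compose[OF GN(1) PN C GN(2) f])
  have G: "carrier (G ?N) = {X \<in> carrier (tensor K C' C).
     sw K C' C ?W X (\<lambda>n c. sw K C C ?W (comult C c) (\<lambda>c1 c2. tens K (tensor K C' C') C (tens K C' C' (twist C' n) (\<gamma> c1)) c2))
     = sw K C' C ?W X (\<lambda>n c. sw K C' C' ?W (comult C' n) (\<lambda>x y. tens K (tensor K C' C') C (tens K C' C' x (untwist C' y)) (twist C c)))}"
    unfolding cotensor_carrier_functor cotensor_carrier[OF N]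
    by (rule Collect_cong) (simp add: cotensor_left_def cotensor_right_def Let_def self cong: conj_cong)
  have gf: "?g (?f X) = X" if "X \<in> carrier (G ?N)" for X
  proof -
    have X: "X \<in> carrier (tensor K C' C)" and eq: "sw K C' C ?W X (\<lambda>n c. sw K C C ?W (comult C c) (\<lambda>c1 c2. tens K (tensor K C' C') C (tens K C' C' (twist C' n) (\<gamma> c1)) c2))
     = sw K C' C ?W X (\<lambda>n c. sw K C' C' ?W (comult C' n) (\<lambda>x y. tens K (tensor K C' C') C (tens K C' C' x (untwist C' y)) (twist C c)))"
      using that by (auto simp only: G)
    show ?thesis
      using X arg_cong[OF eq, of "\<lambda>Y. sw K (tensor K C' C') C (tensor K C' C) Y (\<lambda>v c. sw K C' C' (tensor K C' C) v (\<lambda>n d.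
          counit C' n \<odot>\<^bsub>tensor K C' C\<^esub> tens K C' C d (untwist C c)))"]
      by simp
  qed
  have gG: "?g c \<in> carrier (G ?N)" if "c \<in> carrier C" for c
    unfolding G using that by (simp add: D.C.sw_coassoc)
  have fg: "?f (?g c) = c" if "c \<in> carrier C" for c
    using that by simp
  have "bij_betw ?f (carrier (G ?N)) (carrier ?C)"
    by (rule bij_betw_byWitness[of _ ?g]) (use gf gG fg in auto)
  then show ?thesis by (rule D.doi_hopf_isoI[OF GN(1) C hom])
qed

end

section \<open>Translation by a comodule\<close>

context ground_field
begin

lemma sw_inner_right [simp]:
  assumes [simp]: "module K M" "module K V" "module K W" and a: "a \<in> carrier M" "b \<in> carrier (tensor K V W)"
  shows "sw K V W (tensor K M (tensor K V W)) b (\<lambda>v w. tens K M (tensor K V W) a (tens K V W v w)) = tens K M (tensor K V W) a b"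
proof -
  have "tens K M (tensor K V W) a (sw K V W (tensor K V W) b (\<lambda>v w. tens K V W v w))
    = sw K V W (tensor K M (tensor K V W)) b (\<lambda>v w. tens K M (tensor K V W) a (tens K V W v w))"
    using a by (intro tens_sw) simp_all
  then show ?thesis using a by simp
qed

lemma sw_inner_left [simp]:
  assumes [simp]: "module K M" "module K V" "module K W" and a: "a \<in> carrier M" "b \<in> carrier (tensor K V W)"
  shows "sw K V W (tensor K (tensor K V W) M) b (\<lambda>v w. tens K (tensor K V W) M (tens K V W v w) a) = tens K (tensor K V W) M b a"
proof -
  have "tens K (tensor K V W) M (sw K V W (tensor K V W) b (\<lambda>v w. tens K V W v w)) a
    = sw K V W (tensor K (tensor K V W) M) b (\<lambda>v w. tens K (tensor K V W) M (tens K V W v w) a)"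
    using a by (intro tens_sw) simp_all
  then show ?thesis using a by simp
qed

lemma sw_inner_left_left [simp]:
  assumes [simp]: "module K V" "module K W" "module K M" "module K N"
    and a: "b \<in> carrier (tensor K V W)" "m \<in> carrier M" "n \<in> carrier N"
  shows "sw K V W (tensor K (tensor K (tensor K V W) M) N) b (\<lambda>v w.
      tens K (tensor K (tensor K V W) M) N (tens K (tensor K V W) M (tens K V W v w) m) n)
    = tens K (tensor K (tensor K V W) M) N (tens K (tensor K V W) M b m) n"
proof -
  have "tens K (tensor K (tensor K V W) M) N (tens K (tensor K V W) M (sw K V W (tensor K V W) b (\<lambda>v w. tens K V W v w)) m) n
    = sw K V W (tensor K (tensor K (tensor K V W) M) N) b (\<lambda>v w.
      tens K (tensor K (tensor K V W) M) N (tens K (tensor K V W) M (tens K V W v w) m) n)"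
    by (rule linear_sw[where g = "\<lambda>x. tens K (tensor K (tensor K V W) M) N (tens K (tensor K V W) M x m) n"]) (use a in simp_all)
  then show ?thesis using a by simp
qed

end

text \<open>The Hom-version of the map \<open>m \<otimes> d \<mapsto> m\<^sub>0 \<otimes> m\<^sub>1 d\<close>, for a comodule \<open>M\<close> and an action \<open>\<mu>\<close> of \<open>C\<close> on \<open>D\<close>, which
  is invertible when \<open>C\<close> has an antipode. The factor \<open>V\<close> is only carried along; it moves from \<open>D\<close> to \<open>M\<close>
  as required by the source and target of the map \<open>\<Phi>\<close>.\<close>
definition translate ::
  "('k, 'z) ring_scheme \<Rightarrow> ('k, 'c, 'x) module_scheme \<Rightarrow> ('k, 'm, 'y) module_scheme \<Rightarrow> ('m \<Rightarrow> ('k, 'm, 'c) tensor)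
    \<Rightarrow> ('k, 'v, 'u) module_scheme \<Rightarrow> ('k, 'd, 'q) module_scheme \<Rightarrow> ('c \<Rightarrow> 'd \<Rightarrow> 'd)
    \<Rightarrow> ('k, 'm, ('k, 'v, 'd) tensor) tensor \<Rightarrow> ('k, ('k, 'm, 'v) tensor, 'd) tensor" where
  "translate K C M r V D \<mu> Y = (let T = tensor K (tensor K M V) D in
     sw K M (tensor K V D) T Y (\<lambda>m w. sw K V D T w (\<lambda>v d. sw K M C T (r m) (\<lambda>m0 m1.
       tens K (tensor K M V) D (tens K M V m0 v) (\<mu> m1 d)))))"

text \<open>Two inverse twists on either leg compensate for those created by the calculations
  \<open>m\<^sub>0\<^sub>0 \<otimes> S(m\<^sub>0\<^sub>1) (m\<^sub>1 d)\<close> and \<open>m\<^sub>0\<^sub>0 \<otimes> m\<^sub>0\<^sub>1 (S(m\<^sub>1) d)\<close>.\<close>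
definition untranslate ::
  "('k, 'z) ring_scheme \<Rightarrow> ('k, 'c, 'x) module_scheme \<Rightarrow> ('k, 'm, 'y) hom_space_scheme \<Rightarrow> ('m \<Rightarrow> ('k, 'm, 'c) tensor)
    \<Rightarrow> ('k, 'v, 'u) module_scheme \<Rightarrow> ('k, 'd, 'q) hom_space_scheme \<Rightarrow> ('c \<Rightarrow> 'd \<Rightarrow> 'd)
    \<Rightarrow> ('k, ('k, 'm, 'v) tensor, 'd) tensor \<Rightarrow> ('k, 'm, ('k, 'v, 'd) tensor) tensor" where
  "untranslate K C M r V D \<nu> Z = (let T = tensor K M (tensor K V D) in
     sw K (tensor K M V) D T Z (\<lambda>u d. sw K M V T u (\<lambda>m v. sw K M C T (r m) (\<lambda>m0 m1.
       tens K M (tensor K V D) (untwist M (untwist M m0)) (tens K V D v (untwist D (untwist D (\<nu> m1 d))))))))"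

text \<open>What the pair \<open>\<mu>(c, d) = c d\<close>, \<open>\<nu>(c, d) = S(c) d\<close> satisfies for an antipode \<open>S\<close>, and the pair
  \<open>\<mu>(c, d) = d c\<close>, \<open>\<nu>(c, d) = d S(c)\<close> for a twisted antipode. It is all that inverting a translation takes,
  so both sides can be treated at once.\<close>
definition cancelling_pair ::
  "('k, 'z) ring_scheme \<Rightarrow> ('k, 'c, 'x) hom_coalgebra_scheme \<Rightarrow> ('k, 'd, 'y) hom_space_scheme
    \<Rightarrow> ('c \<Rightarrow> 'd \<Rightarrow> 'd) \<Rightarrow> ('c \<Rightarrow> 'd \<Rightarrow> 'd) \<Rightarrow> bool" where
  "cancelling_pair K C D \<mu> \<nu> \<longleftrightarrow>
     bilinear_map K C D D \<mu> \<and> bilinear_map K C D D \<nu> \<and>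
     (\<forall>c\<in>carrier C. \<forall>d\<in>carrier D. \<mu> (twist C c) (twist D d) = twist D (\<mu> c d)) \<and>
     (\<forall>c\<in>carrier C. \<forall>d\<in>carrier D.
        sw K C C D (comult C c) (\<lambda>x y. \<nu> x (\<mu> (untwist C y) d)) = counit C c \<odot>\<^bsub>D\<^esub> twist D (twist D d) \<and>
        sw K C C D (comult C c) (\<lambda>x y. \<mu> x (\<nu> (untwist C y) d)) = counit C c \<odot>\<^bsub>D\<^esub> twist D (twist D d))"

context hom_right_comodule
begin

lemma translate_linear:
  assumes D: "hom_space K D" and V [simp]: "module K V" and \<mu>: "bilinear_map K C D D \<mu>"
  shows "linear_map K (tensor K M (tensor K V D)) (tensor K (tensor K M V) D) (translate K C M coactM V D \<mu>)"
    and "linear_map K (tensor K (tensor K M V) D) (tensor K M (tensor K V D)) (untranslate K C M coactM V D \<mu>)"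
proof -
  interpret D: hom_space K D by fact
  note [simp] = C.bilinear_rules[OF \<mu>]
  show "linear_map K (tensor K M (tensor K V D)) (tensor K (tensor K M V) D) (translate K C M coactM V D \<mu>)"
    unfolding translate_def[abs_def] Let_def by simp
  show "linear_map K (tensor K (tensor K M V) D) (tensor K M (tensor K V D)) (untranslate K C M coactM V D \<mu>)"
    unfolding untranslate_def[abs_def] Let_def by simp
qed

lemma untranslate_translate:
  assumes D: "hom_space K D" and V [simp]: "module K V" and pair: "cancelling_pair K C D \<mu> \<nu>"
    and Y: "Y \<in> carrier (tensor K M (tensor K V D))"
  shows "untranslate K C M coactM V D \<nu> (translate K C M coactM V D \<mu> Y) = Y"
proof -
  interpret D: hom_space K D by fact
  from pair have \<mu>: "bilinear_map K C D D \<mu>" and \<nu>: "bilinear_map K C D D \<nu>"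
    and key: "\<And>c d. c \<in> carrier C \<Longrightarrow> d \<in> carrier D \<Longrightarrow>
      sw K C C D (comult C c) (\<lambda>x y. \<nu> x (\<mu> (untwist C y) d)) = counit C c \<odot>\<^bsub>D\<^esub> twist D (twist D d)"
    by (auto simp: cancelling_pair_def)
  note [simp] = C.bilinear_rules[OF \<mu>] C.bilinear_rules[OF \<nu>]
  let ?U = "tensor K M (tensor K V D)"
  have key': "sw K C C ?U (comult C c) (\<lambda>x y. tens K M (tensor K V D) m (tens K V D v (untwist D (untwist D (\<nu> x (\<mu> (untwist C y) d))))))
      = counit C c \<odot>\<^bsub>?U\<^esub> tens K M (tensor K V D) m (tens K V D v d)"
    if "c \<in> carrier C" "d \<in> carrier D" "m \<in> carrier M" "v \<in> carrier V" for c d m v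
  proof -
    have "tens K M (tensor K V D) m (tens K V D v (untwist D (untwist D (sw K C C D (comult C c) (\<lambda>x y. \<nu> x (\<mu> (untwist C y) d))))))
      = counit C c \<odot>\<^bsub>?U\<^esub> tens K M (tensor K V D) m (tens K V D v d)"
      using that by (simp only: key) (simp add: that)
    then show ?thesis using that by simp
  qed
  show ?thesis using Y by (simp add: translate_def untranslate_def Let_def sw_coact_coassoc key')
qed

lemma translate_untranslate:
  assumes D: "hom_space K D" and V [simp]: "module K V" and pair: "cancelling_pair K C D \<mu> \<nu>"
    and Z: "Z \<in> carrier (tensor K (tensor K M V) D)"
  shows "translate K C M coactM V D \<mu> (untranslate K C M coactM V D \<nu> Z) = Z"
proof -
  interpret D: hom_space K D by fact
  from pair have \<mu>: "bilinear_map K C D D \<mu>" and \<nu>: "bilinear_map K C D D \<nu>"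
    and tw: "\<And>c d. c \<in> carrier C \<Longrightarrow> d \<in> carrier D \<Longrightarrow> \<mu> (twist C c) (twist D d) = twist D (\<mu> c d)"
    and key: "\<And>c d. c \<in> carrier C \<Longrightarrow> d \<in> carrier D \<Longrightarrow>
      sw K C C D (comult C c) (\<lambda>x y. \<mu> x (\<nu> (untwist C y) d)) = counit C c \<odot>\<^bsub>D\<^esub> twist D (twist D d)"
    by (auto simp: cancelling_pair_def)
  note [simp] = C.bilinear_rules[OF \<mu>] C.bilinear_rules[OF \<nu>]
  let ?U = "tensor K (tensor K M V) D"
  have tw': "\<mu> (untwist C c) (untwist D d) = untwist D (\<mu> c d)" if "c \<in> carrier C" "d \<in> carrier D" for c d
    by (rule D.untwist_eq[symmetric]) (use that tw[of "untwist C c" "untwist D d"] in simp_all)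
  have key': "sw K C C ?U (comult C c) (\<lambda>x y. tens K (tensor K M V) D u (untwist D (untwist D (\<mu> x (\<nu> (untwist C y) d)))))
      = counit C c \<odot>\<^bsub>?U\<^esub> tens K (tensor K M V) D u d"
    if "c \<in> carrier C" "d \<in> carrier D" "u \<in> carrier (tensor K M V)" for c d u
  proof -
    have "tens K (tensor K M V) D u (untwist D (untwist D (sw K C C D (comult C c) (\<lambda>x y. \<mu> x (\<nu> (untwist C y) d)))))
      = counit C c \<odot>\<^bsub>?U\<^esub> tens K (tensor K M V) D u d"
      using that by (simp only: key) (simp add: that)
    then show ?thesis using that by simp
  qed
  show ?thesis using Z by (simp add: translate_def untranslate_def Let_def sw_coact_coassoc tw' key')
qed

end

text \<open>\<open>C\<close> acts on \<open>D\<close> through \<open>g\<close>, by left or by right multiplication. The projection formulas use this for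
  the identity and the twist of \<open>C\<close> and for \<open>\<gamma>\<close>. On the left an antipode is the right notion of
  inverse and on the right a twisted antipode, so this property of \<open>S\<close> is a hypothesis of the two lemmas.\<close>

locale algebra_map_with_inverse = C: hom_bialgebra K C + D: hom_algebra K D
  for K :: "('k, 'z) ring_scheme"
  and C :: "('k, 'c, 'x) hom_coalgebra_scheme"
  and D :: "('k, 'd, 'y) hom_space_scheme" +
  fixes g :: "'c \<Rightarrow> 'd" and S :: "'c \<Rightarrow> 'c"
  assumes g_linear: "linear_map K C D g"
    and g_twist: "c \<in> carrier C \<Longrightarrow> g (twist C c) = twist D (g c)"
    and g_mult: "b \<in> carrier C \<Longrightarrow> c \<in> carrier C \<Longrightarrow> g (b \<otimes>\<^bsub>C\<^esub> c) = g b \<otimes>\<^bsub>D\<^esub> g c"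
    and g_unit: "g \<one>\<^bsub>C\<^esub> = \<one>\<^bsub>D\<^esub>"
    and S_linear: "linear_map K C C S"
    and S_twist: "c \<in> carrier C \<Longrightarrow> S (twist C c) = twist C (S c)"
begin

lemmas g_rules [simp] = C.linear_rules[OF g_linear]
lemmas S_rules [simp] = C.linear_rules[OF S_linear]

lemma g_untwist: "c \<in> carrier C \<Longrightarrow> g (untwist C c) = untwist D (g c)"
  by (rule D.untwist_eq[symmetric]) (simp_all flip: g_twist)

lemma S_untwist: "c \<in> carrier C \<Longrightarrow> S (untwist C c) = untwist C (S c)"
  by (rule C.untwist_eq[symmetric]) (simp_all flip: S_twist)

lemma D_assoc: "\<lbrakk>a \<in> carrier D; b \<in> carrier D; c \<in> carrier D\<rbrakk> \<Longrightarrow> a \<otimes>\<^bsub>D\<^esub> (b \<otimes>\<^bsub>D\<^esub> c) = (untwist D a \<otimes>\<^bsub>D\<^esub> b) \<otimes>\<^bsub>D\<^esub> twist D c"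
  using D.hom_assoc[of "untwist D a" b c] by simp

lemma left_cancelling_pair:
  assumes S: "\<And>c. c \<in> carrier C \<Longrightarrow> sw K C C C (comult C c) (\<lambda>x y. S x \<otimes>\<^bsub>C\<^esub> y) = counit C c \<odot>\<^bsub>C\<^esub> \<one>\<^bsub>C\<^esub>"
    "\<And>c. c \<in> carrier C \<Longrightarrow> sw K C C C (comult C c) (\<lambda>x y. x \<otimes>\<^bsub>C\<^esub> S y) = counit C c \<odot>\<^bsub>C\<^esub> \<one>\<^bsub>C\<^esub>"
  shows "cancelling_pair K C D (\<lambda>c d. g c \<otimes>\<^bsub>D\<^esub> d) (\<lambda>c d. g (S c) \<otimes>\<^bsub>D\<^esub> d)"
proof -
  have "sw K C C D (comult C c) (\<lambda>x y. g (S x) \<otimes>\<^bsub>D\<^esub> (g (untwist C y) \<otimes>\<^bsub>D\<^esub> d)) = counit C c \<odot>\<^bsub>D\<^esub> twist D (twist D d)"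
    "sw K C C D (comult C c) (\<lambda>x y. g x \<otimes>\<^bsub>D\<^esub> (g (S (untwist C y)) \<otimes>\<^bsub>D\<^esub> d)) = counit C c \<odot>\<^bsub>D\<^esub> twist D (twist D d)"
    if "c \<in> carrier C" "d \<in> carrier D" for c d
    using that arg_cong[OF S(1)[OF that(1)], of "\<lambda>b. untwist D (g b) \<otimes>\<^bsub>D\<^esub> twist D d"]
      arg_cong[OF S(2)[OF that(1)], of "\<lambda>b. untwist D (g b) \<otimes>\<^bsub>D\<^esub> twist D d"]
    by (simp_all add: D_assoc g_untwist S_untwist g_mult g_unit)
  then show ?thesis by (simp add: cancelling_pair_def bilinear_mapI g_twist S_twist)
qed

lemma right_cancelling_pair:
  assumes S: "\<And>c. c \<in> carrier C \<Longrightarrow> sw K C C C (comult C c) (\<lambda>x y. S y \<otimes>\<^bsub>C\<^esub> x) = counit C c \<odot>\<^bsub>C\<^esub> \<one>\<^bsub>C\<^esub>"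
    "\<And>c. c \<in> carrier C \<Longrightarrow> sw K C C C (comult C c) (\<lambda>x y. y \<otimes>\<^bsub>C\<^esub> S x) = counit C c \<odot>\<^bsub>C\<^esub> \<one>\<^bsub>C\<^esub>"
  shows "cancelling_pair K C D (\<lambda>c d. d \<otimes>\<^bsub>D\<^esub> g c) (\<lambda>c d. d \<otimes>\<^bsub>D\<^esub> g (S c))"
proof -
  have "sw K C C D (comult C c) (\<lambda>x y. (d \<otimes>\<^bsub>D\<^esub> g (untwist C y)) \<otimes>\<^bsub>D\<^esub> g (S x)) = counit C c \<odot>\<^bsub>D\<^esub> twist D (twist D d)"
    "sw K C C D (comult C c) (\<lambda>x y. (d \<otimes>\<^bsub>D\<^esub> g (S (untwist C y))) \<otimes>\<^bsub>D\<^esub> g x) = counit C c \<odot>\<^bsub>D\<^esub> twist D (twist D d)"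
    if "c \<in> carrier C" "d \<in> carrier D" for c d
    using that arg_cong[OF S(2)[OF that(1)], of "\<lambda>b. twist D d \<otimes>\<^bsub>D\<^esub> untwist D (g b)"]
      arg_cong[OF S(1)[OF that(1)], of "\<lambda>b. twist D d \<otimes>\<^bsub>D\<^esub> untwist D (g b)"]
    by (simp_all add: D.mult_assoc_left g_untwist S_untwist g_mult g_unit)
  then show ?thesis by (simp add: cancelling_pair_def bilinear_mapI g_twist S_twist)
qed

end

section \<open>The projection formulas\<close>

context hom_right_comodule
begin

text \<open>The composite of two translations, so the two inverse translations, in the opposite order, give a
  left inverse.\<close>
lemma double_translate_inj:
  fixes N :: "('k, 'n, 'u) module_scheme"
  assumes D: "hom_space K D" and E: "hom_space K E" and N [simp]: "module K N"
    and pairs: "cancelling_pair K C D \<mu> \<mu>'" "cancelling_pair K C E \<nu> \<nu>'"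
  shows "inj_on (\<lambda>Y. sw K (tensor K M (tensor K N E)) D (tensor K (tensor K (tensor K M N) E) D)
      (translate K C M coactM (tensor K N E) D \<mu> Y)
      (\<lambda>u d. tens K (tensor K (tensor K M N) E) D (translate K C M coactM N E \<nu> u) d))
    (carrier (tensor K M (tensor K (tensor K N E) D)))"
proof -
  interpret D: hom_space K D by fact
  interpret E: hom_space K E by fact
  have bl: "bilinear_map K C D D \<mu>" "bilinear_map K C D D \<mu>'" "bilinear_map K C E E \<nu>" "bilinear_map K C E E \<nu>'"
    using pairs by (auto simp: cancelling_pair_def)
  have VE: "module K (tensor K N E)" by simp
  note [simp] = C.linear_rules[OF translate_linear(1)[OF D VE bl(1)]] C.linear_rules[OF translate_linear(2)[OF D VE bl(2)]]
    C.linear_rules[OF translate_linear(1)[OF E N bl(3)]] C.linear_rules[OF translate_linear(2)[OF E N bl(4)]]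
    untranslate_translate[OF D VE pairs(1)] untranslate_translate[OF E N pairs(2)]
  show ?thesis
    by (rule inj_on_inverseI[where g = "\<lambda>Z. untranslate K C M coactM (tensor K N E) D \<mu>' (sw K (tensor K (tensor K M N) E) D
          (tensor K (tensor K M (tensor K N E)) D) Z (\<lambda>u d. tens K (tensor K M (tensor K N E)) D (untranslate K C M coactM N E \<nu>' u) d))"])
      simp
qed

end

context monoidal_doi_hopf_morphism
begin

lemma cotensor_functor_simps [simp]:
  "module K (G N) = module K (cotensor K C C' \<gamma> N)"
  "linear_map K (G N) W f = linear_map K (cotensor K C C' \<gamma> N) W f"
  "linear_map K W (G N) f' = linear_map K W (cotensor K C C' \<gamma> N) f'"
  "tensor K (G N) W = tensor K (cotensor K C C' \<gamma> N) W"
  "tensor K W (G N) = tensor K W (cotensor K C C' \<gamma> N)"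
  "tens K (G N) W = tens K (cotensor K C C' \<gamma> N) W"
  "tens K W (G N) = tens K W (cotensor K C C' \<gamma> N)"
  "sw K (G N) W' U' X f'' = sw K (cotensor K C C' \<gamma> N) W' U' X f''"
  "sw K W'' (G N) U'' X'' g'' = sw K W'' (cotensor K C C' \<gamma> N) U'' X'' g''"
  by (unfold cotensor_functor_def Let_def) simp_all

declare twisted_simps [simp]

text \<open>The morphism \<open>\<Phi>\<close>: a translation, followed by a twist on the factor \<open>M\<close> and two inverse twists on \<open>C\<close>.\<close>
definition left_transfer ::
  "('k, 'a, 'c, 'm) doi_hopf_module \<Rightarrow> ('k, 'a, 'd, 'n) doi_hopf_module
    \<Rightarrow> ('k, 'm, ('k, 'n, 'c) tensor) tensor \<Rightarrow> ('k, ('k, 'm, 'n) tensor, 'c) tensor" where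
  "left_transfer M N Y = (let T = tensor K (tensor K M N) C in
     sw K M (tensor K N C) T Y (\<lambda>m w. sw K N C T w (\<lambda>n c. sw K M C T (coact M m) (\<lambda>m0 m1.
       tens K (tensor K M N) C (tens K M N (twist M m0) n) (untwist C (untwist C (m1 \<otimes>\<^bsub>C\<^esub> c)))))))"

text \<open>Linearity over \<open>A\<close> is the compatibility of the comultiplication of \<open>A\<close> with the multiplication of \<open>C\<close>.
  Colinearity is the multiplicativity of the comultiplication of \<open>C\<close> and the coassociativity of \<open>M\<close>.\<close>
lemma left_transfer_hom:
  assumes M: "doi_hopf_module K H A rhoA C actC M" and N: "doi_hopf_module K H A rhoA C' actC' N"
  shows "doi_hopf_hom K A C (doi_hopf_tensor K A C M (P N))
    (P (doi_hopf_tensor K A C' (twisted_module K A C C' \<gamma> M) N)) (left_transfer M N)"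
proof -
  interpret M: doi_hopf_module K H A rhoA C actC M by fact
  interpret N: doi_hopf_module K H A rhoA C' actC' N by fact
  note PN = D.cofree_doi_hopf_module[OF N.M.hom_left_module_axioms]
  note Mt = twisted_doi_hopf_module[OF M]
  note ops = D.tensor_structure[OF M PN, unfolded cofree_simps] D'.tensor_structure[OF Mt N, unfolded twisted_simps]
  let ?X = "doi_hopf_tensor K A C M (P N)"
    and ?Y = "P (doi_hopf_tensor K A C' (twisted_module K A C C' \<gamma> M) N)"
  let ?U = "tensor K (tensor K M N) C"
  note exch = D.H.sw_exchange[where V = C and W = C and V' = M and W' = C and X = "comult C c" and Y = "coact M m" for c m]
    D.H.sw_exchange[where V = M and W = C and V' = N and W' = C and X = "coact M m" and Y = w for m w]
  note exchA = D.H.sw_exchange[where V = A and W = H and V' = M and W' = C and X = "rhoA a" and Y = "coact M m" for a m]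
    D.H.sw_exchange[where V = A and W = A and V' = M and W' = C and X = "comult A a" and Y = "coact M m" for a m]
    D.H.sw_exchange[where V = A and W = H and V' = M and W' = "tensor K N C" and X = "rhoA a" and Y = x for a x]
    D.H.sw_exchange[where V = A and W = A and V' = M and W' = "tensor K N C" and X = "comult A a" and Y = x for a x]
    D.H.sw_exchange[where V = A and W = H and V' = N and W' = C and X = "rhoA a" and Y = x for a x]
    D.H.sw_exchange[where V = A and W = A and V' = N and W' = C and X = "comult A a" and Y = x for a x]
  have E: "sw K A A ?U (comult A b) (\<lambda>a1 a2. sw K A H ?U (rhoA a2) (\<lambda>a20 a21. sw K A H ?U (rhoA a1) (\<lambda>a10 a11.
        tens K (tensor K M N) C (tens K M N (twist M (act M a10 m)) (act N a20 n)) (untwist C (untwist C (actC a11 c \<otimes>\<^bsub>C\<^esub> actC a21 d))))))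
      = sw K A H ?U (rhoA b) (\<lambda>a0 a1. sw K A A ?U (comult A a0) (\<lambda>a01 a02.
        tens K (tensor K M N) C (tens K M N (twist M (act M a01 m)) (act N a02 n)) (untwist C (untwist C (actC (twist H (twist H a1)) (c \<otimes>\<^bsub>C\<^esub> d))))))"
    if "b \<in> carrier A" "m \<in> carrier M" "n \<in> carrier N" "c \<in> carrier C" "d \<in> carrier C" for b m n c d
    by (rule trans[OF D.H.sw_cong[OF refl D.H.sw_exchange] D.sw_monoidal_mult[symmetric]]) (use that in simp_all)
  show ?thesis
  proof (rule D.doi_hopf_homI)
    fix Y assume "Y \<in> carrier ?X"
    then have Y: "Y \<in> carrier (tensor K M (tensor K N C))" by simp
    show "left_transfer M N (twist ?X Y) = twist ?Y (left_transfer M N Y)"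
      unfolding cofree_simps D.tensor_simps D'.tensor_simps twisted_simps
      using Y by (simp add: ops left_transfer_def Let_def)
    show "coact ?Y (left_transfer M N Y)
      = sw K ?X C (tensor K ?Y C)
          (coact ?X Y) (\<lambda>x y. tens K ?Y C (left_transfer M N x) y)"
      unfolding cofree_simps D.tensor_simps D'.tensor_simps twisted_simps
      using Y by (simp add: ops left_transfer_def Let_def exch M.M.sw_coact_coassoc)
    fix a assume a: "a \<in> carrier A"
    show "left_transfer M N (act ?X a Y) = act ?Y a (left_transfer M N Y)"
      unfolding cofree_simps D.tensor_simps D'.tensor_simps twisted_simps
      using Y a E by (simp add: ops left_transfer_def Let_def exchA)
  next
    show "linear_map K ?X ?Y (left_transfer M N)"
      unfolding left_transfer_def[abs_def] Let_def by simp
  qed (simp_all add: ops)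
qed

text \<open>With \<open>\<mu>(c, d) = \<alpha>(c) d\<close> and \<open>\<nu>(c, d) = \<gamma>(c) d\<close> this is the map \<open>\<Theta>\<close> up to twists of the factors. It
  translates first along \<open>C\<close> and then, below it, along \<open>C'\<close>.\<close>
definition double_translate ::
  "('k, 'a, 'c, 'm) doi_hopf_module \<Rightarrow> ('k, 'a, 'd, 'n) doi_hopf_module \<Rightarrow> ('c \<Rightarrow> 'c \<Rightarrow> 'c) \<Rightarrow> ('c \<Rightarrow> 'd \<Rightarrow> 'd)
    \<Rightarrow> ('k, 'm, ('k, ('k, 'n, 'd) tensor, 'c) tensor) tensor \<Rightarrow> ('k, ('k, ('k, 'm, 'n) tensor, 'd) tensor, 'c) tensor" where
  "double_translate M N \<mu> \<nu> Y = sw K (tensor K M (tensor K N C')) C (tensor K (tensor K (tensor K M N) C') C)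
     (translate K C M (coact M) (tensor K N C') C \<mu> Y)
     (\<lambda>u d. tens K (tensor K (tensor K M N) C') C (translate K C M (coact M) N C' \<nu> u) d)"

text \<open>The bijection \<open>\<Phi>\<close> carries the equalizer of \<open>id \<otimes> L\<close> and \<open>id \<otimes> R\<close> onto the equalizer of \<open>L'\<close> and \<open>R'\<close>: by
  \<open>left\<close> and \<open>right\<close> the conditions on \<open>\<Phi> Y\<close> and on \<open>Y\<close> correspond under the injective map \<open>post \<circ> \<Theta>\<close>. The first equalizer is
  \<open>M \<otimes> G(N)\<close> because tensoring preserves equalizers. The maps \<open>B\<close> and \<open>post\<close> collect twists and flips of the
  single factors; leaving them and the translations open serves both projection formulas.\<close>
lemma transfer_bijective:
  assumes M: "doi_hopf_module K H A rhoA C actC M" and N: "doi_hopf_module K H A rhoA C' actC' N"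
    and Q: "doi_hopf_module K H A rhoA C' actC' Q"
    and pairs: "cancelling_pair K C C \<mu> \<mu>'" "cancelling_pair K C C \<nu> \<nu>'" "cancelling_pair K C C' \<kappa> \<kappa>'"
    and inj_post: "inj_on post (carrier (tensor K (tensor K (tensor K M N) C') C))"
    and left: "\<And>Y. Y \<in> carrier (tensor K M (tensor K N C)) \<Longrightarrow> cotensor_left K C C' \<gamma> Q (\<Phi> Y)
      = post (double_translate M N \<nu> \<kappa> (sw K M (tensor K N C) (tensor K M (tensor K (tensor K N C') C)) Y
          (\<lambda>m w. tens K M (tensor K (tensor K N C') C) m (cotensor_left K C C' \<gamma> N w))))"
    and right: "\<And>Y. Y \<in> carrier (tensor K M (tensor K N C)) \<Longrightarrow> cotensor_right K C C' Q (\<Phi> Y)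
      = post (double_translate M N \<nu> \<kappa> (sw K M (tensor K N C) (tensor K M (tensor K (tensor K N C') C)) Y
          (\<lambda>m w. tens K M (tensor K (tensor K N C') C) m (cotensor_right K C C' N w))))"
    and \<Phi>: "\<And>Y. Y \<in> carrier (tensor K M (tensor K N C)) \<Longrightarrow> \<Phi> Y = B (translate K C M (coact M) N C \<mu> Y)"
    and B: "bij_betw B (carrier (tensor K (tensor K M N) C)) (carrier (tensor K Q C))"
  shows "bij_betw (\<lambda>X. \<Phi> (sw K M (cotensor K C C' \<gamma> N) (tensor K M (tensor K N C)) X (\<lambda>m w. tens K M (tensor K N C) m w)))
    (carrier (tensor K M (cotensor K C C' \<gamma> N))) (carrier (G Q))"
proof -
  interpret M: doi_hopf_module K H A rhoA C actC M by fact
  interpret N: doi_hopf_module K H A rhoA C' actC' N by fact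
  note [simp] = cotensor_subspace(1)[OF N]
  let ?T = "tensor K N C" and ?W = "tensor K (tensor K N C') C" and ?G = "cotensor K C C' \<gamma> N"
  let ?U = "tensor K (tensor K M N) C" and ?WQ = "tensor K (tensor K (tensor K M N) C') C"
  define L R where "L = cotensor_left K C C' \<gamma> N" and "R = cotensor_right K C C' N"
  have linL: "linear_map K ?T ?W L" and linR: "linear_map K ?T ?W R"
    using cotensor_maps_linear[OF N] by (simp_all only: L_def R_def)
  obtain p s where p: "linear_map K ?T ?T p" and pG: "linear_map K ?T ?G p" and s: "linear_map K ?W ?T s"
    and ps: "\<And>x. x \<in> carrier ?T \<Longrightarrow> L x = R x \<Longrightarrow> p x = x"
      "\<And>x. x \<in> carrier ?T \<Longrightarrow> x \<oplus>\<^bsub>?T\<^esub> s (R x) = p x \<oplus>\<^bsub>?T\<^esub> s (L x)"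
    using cotensor_projection[OF N] unfolding L_def R_def by blast
  have G: "w \<in> carrier ?T" "L w = R w" if "w \<in> carrier ?G" for w
    using that by (simp_all add: cotensor_carrier[OF N] L_def R_def)
  note [simp] = D.H.linear_rules[OF linL] D.H.linear_rules[OF linR] D.H.linear_rules[OF p] D.H.linear_rules[OF pG]
    D.H.linear_rules[OF cotensor_subspace(2)[OF N]]
  have bl: "bilinear_map K C C C \<mu>" "bilinear_map K C C C \<mu>'" "bilinear_map K C C C \<nu>" "bilinear_map K C C' C' \<kappa>"
    using pairs by (auto simp: cancelling_pair_def)
  have mN: "module K N" and mV: "module K (tensor K N C')" by simp_all
  note [simp] = D.H.linear_rules[OF M.M.translate_linear(1)[OF D.C.hom_space_axioms mV bl(3)]]
    D.H.linear_rules[OF M.M.translate_linear(1)[OF D'.C.hom_space_axioms mN bl(4)]]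
  define LM where "LM Y = sw K M ?T (tensor K M ?W) Y (\<lambda>m w. tens K M ?W m (L w))" for Y
  define RM where "RM Y = sw K M ?T (tensor K M ?W) Y (\<lambda>m w. tens K M ?W m (R w))" for Y
  let ?\<Theta> = "double_translate M N \<nu> \<kappa>"
  have inj\<Theta>: "inj_on ?\<Theta> (carrier (tensor K M ?W))"
    unfolding double_translate_def[abs_def]
    by (rule M.M.double_translate_inj[OF D.C.hom_space_axioms D'.C.hom_space_axioms mN pairs(2,3)])
  have LMc: "LM Y \<in> carrier (tensor K M ?W)" "RM Y \<in> carrier (tensor K M ?W)" for Y
    by (simp_all add: LM_def RM_def)
  have \<Theta>c: "?\<Theta> Y \<in> carrier ?WQ" for Y
    by (simp add: double_translate_def)
  define tr untr where "tr = translate K C M (coact M) N C \<mu>" and "untr = untranslate K C M (coact M) N C \<mu>'"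
  have lin_tr: "linear_map K (tensor K M ?T) ?U tr" "linear_map K ?U (tensor K M ?T) untr"
    unfolding tr_def untr_def
    by (rule M.M.translate_linear[OF D.C.hom_space_axioms mN bl(1)] M.M.translate_linear[OF D.C.hom_space_axioms mN bl(2)])+
  have tr_inv: "Y \<in> carrier (tensor K M ?T) \<Longrightarrow> untr (tr Y) = Y" "Z \<in> carrier ?U \<Longrightarrow> tr (untr Z) = Z" for Y Z
    unfolding tr_def untr_def
    by (rule M.M.untranslate_translate[OF D.C.hom_space_axioms mN pairs(1)]
        M.M.translate_untranslate[OF D.C.hom_space_axioms mN pairs(1)]; assumption)+
  have "bij_betw tr (carrier (tensor K M ?T)) (carrier ?U)"
    by (rule bij_betw_byWitness[of _ untr]) (use tr_inv linear_mapD(1)[OF lin_tr(1)] linear_mapD(1)[OF lin_tr(2)] in auto)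
  then have "bij_betw (B \<circ> tr) (carrier (tensor K M ?T)) (carrier (tensor K Q C))"
    by (rule bij_betw_trans[OF _ B])
  then have bij\<Phi>: "bij_betw \<Phi> (carrier (tensor K M ?T)) (carrier (tensor K Q C))"
    by (rule iffD2[OF bij_betw_cong, rotated]) (simp add: \<Phi> tr_def)
  have mem: "\<Phi> Y \<in> carrier (G Q) \<longleftrightarrow> LM Y = RM Y" if Y: "Y \<in> carrier (tensor K M ?T)" for Y
  proof -
    have "\<Phi> Y \<in> carrier (tensor K Q C)" using bij_betwE[OF bij\<Phi>] Y by blast
    then have "\<Phi> Y \<in> carrier (G Q) \<longleftrightarrow> post (?\<Theta> (LM Y)) = post (?\<Theta> (RM Y))"
      by (simp add: cotensor_carrier[OF Q] left[OF Y] right[OF Y] LM_def RM_def L_def R_def)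
    also have "\<dots> \<longleftrightarrow> LM Y = RM Y"
      using inj_on_eq_iff[OF inj_post \<Theta>c \<Theta>c] inj_on_eq_iff[OF inj\<Theta> LMc] by metis
    finally show ?thesis .
  qed
  let ?i = "\<lambda>X. sw K M ?G (tensor K M ?T) X (\<lambda>m w. tens K M ?T m w)"
  let ?i' = "\<lambda>Y. sw K M ?T (tensor K M ?G) Y (\<lambda>m w. tens K M ?G m (p w))"
  have ic: "?i X \<in> carrier (tensor K M ?T)" for X by (simp add: G)
  have i_LM: "LM (?i X) = RM (?i X)" if "X \<in> carrier (tensor K M ?G)" for X
    using that by (simp add: LM_def RM_def G cong: D.H.sw_cong)
  have i'i: "?i' (?i X) = X" if "X \<in> carrier (tensor K M ?G)" for X
    using that by (simp add: G ps(1) cong: D.H.sw_cong)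
  have ii': "?i (?i' Y) = Y" if "Y \<in> carrier (tensor K M ?T)" "LM Y = RM Y" for Y
  proof -
    have "?i (?i' Y) = sw K M ?T (tensor K M ?T) Y (\<lambda>m w. tens K M ?T m (p w))"
      using that(1) by (simp add: G)
    also have "\<dots> = Y"
      by (rule D.H.splitting_tensor_right[OF _ _ _ linL linR p s ps(2) that(1) that(2)[unfolded LM_def RM_def]]) simp_all
    finally show ?thesis .
  qed
  have i'c: "?i' Y \<in> carrier (tensor K M ?G)" for Y by simp
  show ?thesis
  proof (rule bij_betw_imageI)
    show "inj_on (\<lambda>X. \<Phi> (?i X)) (carrier (tensor K M ?G))"
    proof (rule inj_onI)
      fix X X' assume X: "X \<in> carrier (tensor K M ?G)" and X': "X' \<in> carrier (tensor K M ?G)" and "\<Phi> (?i X) = \<Phi> (?i X')"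
      then have "?i X = ?i X'" using inj_on_eq_iff[OF bij_betw_imp_inj_on[OF bij\<Phi>] ic ic] by blast
      then have "?i' (?i X) = ?i' (?i X')" by simp
      then show "X = X'" by (simp only: i'i[OF X] i'i[OF X'])
    qed
    show "(\<lambda>X. \<Phi> (?i X)) ` carrier (tensor K M ?G) = carrier (G Q)"
    proof (intro equalityI subsetI)
      fix Z assume Z: "Z \<in> carrier (G Q)"
      then have "Z \<in> carrier (tensor K Q C)" by (simp add: cotensor_carrier[OF Q])
      then obtain Y where Y: "Y \<in> carrier (tensor K M ?T)" "Z = \<Phi> Y"
        using bij_betw_imp_surj_on[OF bij\<Phi>] by blast
      then have "?i (?i' Y) = Y" using ii' mem Z by blast
      then show "Z \<in> (\<lambda>X. \<Phi> (?i X)) ` carrier (tensor K M ?G)" using Y(2) i'c[of Y] by (metis (no_types, lifting) image_eqI)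
    next
      fix Z assume "Z \<in> (\<lambda>X. \<Phi> (?i X)) ` carrier (tensor K M ?G)"
      then obtain X where X: "X \<in> carrier (tensor K M ?G)" "Z = \<Phi> (?i X)" by blast
      then show "Z \<in> carrier (G Q)" using mem[OF ic[of X]] i_LM[OF X(1)] by blast
    qed
  qed
qed

text \<open>The map \<open>\<Phi>\<close> restricted to \<open>M \<otimes> G(N)\<close>. It is a morphism into \<open>P(M' \<otimes> N)\<close> with image \<open>G(M' \<otimes> N)\<close>, hence one
  into \<open>G(M' \<otimes> N)\<close>.\<close>
lemma left_projection_formula:
  assumes M: "doi_hopf_module K H A rhoA C actC M" and N: "doi_hopf_module K H A rhoA C' actC' N"
    and S: "antipode K C S"
  shows "doi_hopf_iso K H A rhoA C actC (doi_hopf_tensor K A C M (G N))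
    (G (doi_hopf_tensor K A C' (twisted_module K A C C' \<gamma> M) N))"
proof -
  interpret M: doi_hopf_module K H A rhoA C actC M by fact
  interpret N: doi_hopf_module K H A rhoA C' actC' N by fact
  let ?Mt = "twisted_module K A C C' \<gamma> M"
  let ?Q = "doi_hopf_tensor K A C' ?Mt N"
  note PN = D.cofree_doi_hopf_module[OF N.M.hom_left_module_axioms]
  note Mt = twisted_doi_hopf_module[OF M]
  note Q = D'.tensor_doi_hopf_module[OF Mt N]
  interpret Q: doi_hopf_module K H A rhoA C' actC' ?Q by (rule Q)
  note PQ = D.cofree_doi_hopf_module[OF Q.M.hom_left_module_axioms]
  note GN = cotensor_doi_hopf_module[OF N] and GQ = cotensor_doi_hopf_module[OF Q]
  note X0 = D.tensor_doi_hopf_module[OF M GN(1)] and X1 = D.tensor_doi_hopf_module[OF M PN]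
  note [simp] = cotensor_subspace(1)[OF N]
  note Qops = D'.tensor_structure[OF Mt N, unfolded twisted_simps]
  let ?T = "tensor K N C" and ?W = "tensor K (tensor K N C') C" and ?G = "cotensor K C C' \<gamma> N"
  let ?U = "tensor K (tensor K M N) C" and ?WQ = "tensor K (tensor K (tensor K M N) C') C"
  let ?Phi = "left_transfer M N"
  have S': "linear_map K C C S" "\<And>c. c \<in> carrier C \<Longrightarrow> S (twist C c) = twist C (S c)"
    using S by (simp_all add: antipode_def)
  note [simp] = D.H.linear_rules[OF S'(1)]
  have I: "algebra_map_with_inverse K C C (\<lambda>c. c) S" and T: "algebra_map_with_inverse K C C (twist C) S"
    and \<gamma>: "algebra_map_with_inverse K C C' \<gamma> S"
    by unfold_locales (simp_all add: S' \<gamma>_linear)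
  have anti: "sw K C C C (comult C c) (\<lambda>x y. S x \<otimes>\<^bsub>C\<^esub> y) = counit C c \<odot>\<^bsub>C\<^esub> \<one>\<^bsub>C\<^esub>"
    "sw K C C C (comult C c) (\<lambda>x y. x \<otimes>\<^bsub>C\<^esub> S y) = counit C c \<odot>\<^bsub>C\<^esub> \<one>\<^bsub>C\<^esub>" if "c \<in> carrier C" for c
    using S that by (simp_all add: antipode_def D.H.sweedler_sw'[of C C])
  note pair = algebra_map_with_inverse.left_cancelling_pair
  have pairs: "cancelling_pair K C C (\<lambda>c d. c \<otimes>\<^bsub>C\<^esub> d) (\<lambda>c d. S c \<otimes>\<^bsub>C\<^esub> d)"
    "cancelling_pair K C C (\<lambda>c d. twist C c \<otimes>\<^bsub>C\<^esub> d) (\<lambda>c d. twist C (S c) \<otimes>\<^bsub>C\<^esub> d)"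
    "cancelling_pair K C C' (\<lambda>c d. \<gamma> c \<otimes>\<^bsub>C'\<^esub> d) (\<lambda>c d. \<gamma> (S c) \<otimes>\<^bsub>C'\<^esub> d)"
    by (rule pair[OF I] pair[OF T] pair[OF \<gamma>]; erule anti)+
  note exch = D.H.sw_exchange[where V = C and W = C and V' = M and W' = C and X = "comult C c" and Y = "coact M m" for c m]
    D.H.sw_exchange[where V = M and W = C and V' = N and W' = C and X = "coact M m" and Y = w for m w]
    D.H.sw_exchange[where V = N and W = C' and V' = M and W' = C and X = "coact N n" and Y = "coact M m" for n m]
    D.H.sw_exchange[where V = N and W = C' and V' = C and W' = C and X = "coact N n" and Y = "comult C c" for n c]
  \<comment> \<open>The twists by which \<open>\<Theta>\<close> and \<open>\<Phi>\<close> differ from the translations: one on \<open>M\<close>, two inverse ones on \<open>C'\<close>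
    and on \<open>C\<close>.\<close>
  define post where "post Z = sw K (tensor K (tensor K M N) C') C ?WQ Z (\<lambda>x c. sw K (tensor K M N) C' ?WQ x (\<lambda>u d. sw K M N ?WQ u (\<lambda>m n.
      tens K (tensor K (tensor K M N) C') C (tens K (tensor K M N) C' (tens K M N (twist M m) n) (untwist C' (untwist C' d))) (untwist C (untwist C c)))))" for Z
  let ?B = "\<lambda>Z. sw K (tensor K M N) C ?U Z (\<lambda>u c. sw K M N ?U u (\<lambda>m n. tens K (tensor K M N) C (tens K M N (twist M m) n) (untwist C (untwist C c))))"
  let ?B' = "\<lambda>Z. sw K (tensor K M N) C ?U Z (\<lambda>u c. sw K M N ?U u (\<lambda>m n. tens K (tensor K M N) C (tens K M N (untwist M m) n) (twist C (twist C c))))"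
  let ?i = "\<lambda>X. sw K M ?G (tensor K M ?T) X (\<lambda>m w. tens K M ?T m w)"
  have "bij_betw (\<lambda>X. ?Phi (?i X)) (carrier (tensor K M ?G)) (carrier (G ?Q))"
  proof (rule transfer_bijective[OF M N Q pairs])
    show "inj_on post (carrier ?WQ)"
      by (rule inj_on_inverseI[where g = "\<lambda>Z. sw K (tensor K (tensor K M N) C') C ?WQ Z (\<lambda>x c. sw K (tensor K M N) C' ?WQ x (\<lambda>u d. sw K M N ?WQ u (\<lambda>m n.
        tens K (tensor K (tensor K M N) C') C (tens K (tensor K M N) C' (tens K M N (untwist M m) n) (twist C' (twist C' d))) (twist C (twist C c)))))"])
        (simp add: post_def)
    show "bij_betw ?B (carrier ?U) (carrier (tensor K ?Q C))"
      unfolding D'.tensor_simps twisted_simps by (rule bij_betw_byWitness[of _ ?B']) auto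
    fix Y assume Y: "Y \<in> carrier (tensor K M ?T)"
    show "?Phi Y = ?B (translate K C M (coact M) N C (\<lambda>c d. c \<otimes>\<^bsub>C\<^esub> d) Y)"
      using Y by (simp add: left_transfer_def translate_def Let_def)
    show "cotensor_left K C C' \<gamma> ?Q (?Phi Y) = post (double_translate M N (\<lambda>c d. twist C c \<otimes>\<^bsub>C\<^esub> d) (\<lambda>c d. \<gamma> c \<otimes>\<^bsub>C'\<^esub> d)
        (sw K M ?T (tensor K M ?W) Y (\<lambda>m w. tens K M ?W m (cotensor_left K C C' \<gamma> N w))))"
      "cotensor_right K C C' ?Q (?Phi Y) = post (double_translate M N (\<lambda>c d. twist C c \<otimes>\<^bsub>C\<^esub> d) (\<lambda>c d. \<gamma> c \<otimes>\<^bsub>C'\<^esub> d)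
        (sw K M ?T (tensor K M ?W) Y (\<lambda>m w. tens K M ?W m (cotensor_right K C C' N w))))"
      unfolding cotensor_left_def cotensor_right_def Let_def D'.tensor_simps twisted_simps post_def double_translate_def
      using Y by (simp_all add: Qops left_transfer_def translate_def Let_def exch M.M.sw_coact_coassoc)
  qed
  then have bij: "bij_betw (\<lambda>X. ?Phi (?i X)) (carrier (doi_hopf_tensor K A C M (G N))) (carrier (G ?Q))"
    unfolding D.tensor_simps cotensor_functor_simps .
  have "doi_hopf_hom K A C M M (\<lambda>x. x)" by (rule D.doi_hopf_homI) simp_all
  from D.doi_hopf_tensor_hom[OF M GN(1) M PN this GN(2)]
  have i: "doi_hopf_hom K A C (doi_hopf_tensor K A C M (G N)) (doi_hopf_tensor K A C M (P N)) ?i"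
    unfolding cofree_simps cotensor_functor_simps .
  have hom: "doi_hopf_hom K A C (doi_hopf_tensor K A C M (G N)) (P ?Q) (\<lambda>X. ?Phi (?i X))"
    by (rule D.doi_hopf_hom_compose[OF X0 X1 PQ i left_transfer_hom[OF M N]])
  have hom': "doi_hopf_hom K A C (doi_hopf_tensor K A C M (G N)) (G ?Q) (\<lambda>X. ?Phi (?i X))"
    by (rule D.doi_hopf_hom_corestrict[where i = "\<lambda>x. x", OF GQ(1) PQ X0 GQ(2) inj_on_id2 _ hom])
      (use bij_betwE[OF bij] in blast)
  then show ?thesis using bij by (rule D.doi_hopf_isoI[OF X0 GQ(1)])
qed

text \<open>The mirror image \<open>(n \<otimes> c) \<otimes> m \<mapsto> (n \<otimes> \<alpha>(m\<^sub>0)) \<otimes> \<alpha>\<^sup>-\<^sup>2(c m\<^sub>1)\<close> of \<open>\<Phi>\<close>.\<close>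
definition right_transfer ::
  "('k, 'a, 'c, 'm) doi_hopf_module \<Rightarrow> ('k, 'a, 'd, 'n) doi_hopf_module
    \<Rightarrow> ('k, ('k, 'n, 'c) tensor, 'm) tensor \<Rightarrow> ('k, ('k, 'n, 'm) tensor, 'c) tensor" where
  "right_transfer M N Y = (let T = tensor K (tensor K N M) C in
     sw K (tensor K N C) M T Y (\<lambda>w m. sw K N C T w (\<lambda>n c. sw K M C T (coact M m) (\<lambda>m0 m1.
       tens K (tensor K N M) C (tens K N M n (twist M m0)) (untwist C (untwist C (c \<otimes>\<^bsub>C\<^esub> m1)))))))"

lemma right_transfer_hom:
  assumes M: "doi_hopf_module K H A rhoA C actC M" and N: "doi_hopf_module K H A rhoA C' actC' N"
  shows "doi_hopf_hom K A C (doi_hopf_tensor K A C (P N) M)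
    (P (doi_hopf_tensor K A C' N (twisted_module K A C C' \<gamma> M))) (right_transfer M N)"
proof -
  interpret M: doi_hopf_module K H A rhoA C actC M by fact
  interpret N: doi_hopf_module K H A rhoA C' actC' N by fact
  note PN = D.cofree_doi_hopf_module[OF N.M.hom_left_module_axioms]
  note Mt = twisted_doi_hopf_module[OF M]
  note ops = D.tensor_structure[OF PN M, unfolded cofree_simps] D'.tensor_structure[OF N Mt, unfolded twisted_simps]
  let ?X = "doi_hopf_tensor K A C (P N) M"
    and ?Y = "P (doi_hopf_tensor K A C' N (twisted_module K A C C' \<gamma> M))"
  let ?U = "tensor K (tensor K N M) C"
  note exch = D.H.sw_exchange[where V = M and W = C and V' = C and W' = C and X = "coact M m" and Y = "comult C c" for c m]
    D.H.sw_exchange[where V = M and W = C and V' = N and W' = C and X = "coact M m" and Y = w for m w]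
  note exchA = D.H.sw_exchange[where V = A and W = H and V' = M and W' = C and X = "rhoA a" and Y = "coact M m" for a m]
    D.H.sw_exchange[where V = A and W = A and V' = M and W' = C and X = "comult A a" and Y = "coact M m" for a m]
    D.H.sw_exchange[where V = A and W = H and V' = "tensor K N C" and W' = M and X = "rhoA a" and Y = x for a x]
    D.H.sw_exchange[where V = A and W = A and V' = "tensor K N C" and W' = M and X = "comult A a" and Y = x for a x]
    D.H.sw_exchange[where V = A and W = H and V' = N and W' = C and X = "rhoA a" and Y = x for a x]
    D.H.sw_exchange[where V = A and W = A and V' = N and W' = C and X = "comult A a" and Y = x for a x]
  have E: "sw K A A ?U (comult A b) (\<lambda>a1 a2. sw K A H ?U (rhoA a1) (\<lambda>a10 a11. sw K A H ?U (rhoA a2) (\<lambda>a20 a21.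
        tens K (tensor K N M) C (tens K N M (act N a10 n) (twist M (act M a20 m))) (untwist C (untwist C (actC a11 c \<otimes>\<^bsub>C\<^esub> actC a21 d))))))
      = sw K A H ?U (rhoA b) (\<lambda>a0 a1. sw K A A ?U (comult A a0) (\<lambda>a01 a02.
        tens K (tensor K N M) C (tens K N M (act N a01 n) (twist M (act M a02 m))) (untwist C (untwist C (actC (twist H (twist H a1)) (c \<otimes>\<^bsub>C\<^esub> d))))))"
    if "b \<in> carrier A" "m \<in> carrier M" "n \<in> carrier N" "c \<in> carrier C" "d \<in> carrier C" for b m n c d
    by (rule D.sw_monoidal_mult[symmetric]) (use that in simp_all)
  show ?thesis
  proof (rule D.doi_hopf_homI)
    fix Y assume "Y \<in> carrier ?X"
    then have Y: "Y \<in> carrier (tensor K (tensor K N C) M)" by simp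
    show "right_transfer M N (twist ?X Y) = twist ?Y (right_transfer M N Y)"
      unfolding cofree_simps D.tensor_simps D'.tensor_simps twisted_simps
      using Y by (simp add: ops right_transfer_def Let_def)
    show "coact ?Y (right_transfer M N Y)
      = sw K ?X C (tensor K ?Y C)
          (coact ?X Y) (\<lambda>x y. tens K ?Y C (right_transfer M N x) y)"
      unfolding cofree_simps D.tensor_simps D'.tensor_simps twisted_simps
      using Y by (simp add: ops right_transfer_def Let_def exch M.M.sw_coact_coassoc)
    fix a assume a: "a \<in> carrier A"
    show "right_transfer M N (act ?X a Y) = act ?Y a (right_transfer M N Y)"
      unfolding cofree_simps D.tensor_simps D'.tensor_simps twisted_simps
      using Y a E by (simp add: ops right_transfer_def Let_def exchA)
  next
    show "linear_map K ?X ?Y (right_transfer M N)"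
      unfolding right_transfer_def[abs_def] Let_def by simp
  qed (simp_all add: ops)
qed

text \<open>The flip \<open>M \<otimes> P(N) \<rightarrow> P(N) \<otimes> M\<close>, which in general is not a morphism, brings the bijectivity into the form treated
  by \<open>transfer_bijective\<close>; here \<open>B\<close> and \<open>post\<close> flip \<open>M\<close> and \<open>N\<close> back.\<close>
lemma right_projection_formula:
  assumes M: "doi_hopf_module K H A rhoA C actC M" and N: "doi_hopf_module K H A rhoA C' actC' N"
    and S: "twisted_antipode K C S"
  shows "doi_hopf_iso K H A rhoA C actC (doi_hopf_tensor K A C (G N) M)
    (G (doi_hopf_tensor K A C' N (twisted_module K A C C' \<gamma> M)))"
proof -
  interpret M: doi_hopf_module K H A rhoA C actC M by fact
  interpret N: doi_hopf_module K H A rhoA C' actC' N by fact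
  let ?Mt = "twisted_module K A C C' \<gamma> M"
  let ?Q = "doi_hopf_tensor K A C' N ?Mt"
  note PN = D.cofree_doi_hopf_module[OF N.M.hom_left_module_axioms]
  note Mt = twisted_doi_hopf_module[OF M]
  note Q = D'.tensor_doi_hopf_module[OF N Mt]
  interpret Q: doi_hopf_module K H A rhoA C' actC' ?Q by (rule Q)
  note PQ = D.cofree_doi_hopf_module[OF Q.M.hom_left_module_axioms]
  note GN = cotensor_doi_hopf_module[OF N] and GQ = cotensor_doi_hopf_module[OF Q]
  note X0 = D.tensor_doi_hopf_module[OF GN(1) M] and X1 = D.tensor_doi_hopf_module[OF PN M]
  note [simp] = cotensor_subspace(1)[OF N]
  note Qops = D'.tensor_structure[OF N Mt, unfolded twisted_simps]
  let ?T = "tensor K N C" and ?W = "tensor K (tensor K N C') C" and ?G = "cotensor K C C' \<gamma> N"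
  let ?U = "tensor K (tensor K M N) C" and ?WM = "tensor K (tensor K (tensor K M N) C') C"
  let ?V = "tensor K (tensor K N M) C" and ?WN = "tensor K (tensor K (tensor K N M) C') C"
  let ?Phi = "\<lambda>Y. right_transfer M N (sw K M ?T (tensor K ?T M) Y (\<lambda>m w. tens K ?T M w m))"
  have S': "linear_map K C C S" "\<And>c. c \<in> carrier C \<Longrightarrow> S (twist C c) = twist C (S c)"
    using S by (simp_all add: twisted_antipode_def)
  note [simp] = D.H.linear_rules[OF S'(1)]
  have I: "algebra_map_with_inverse K C C (\<lambda>c. c) S" and T: "algebra_map_with_inverse K C C (twist C) S"
    and \<gamma>: "algebra_map_with_inverse K C C' \<gamma> S"
    by unfold_locales (simp_all add: S' \<gamma>_linear)
  have anti: "sw K C C C (comult C c) (\<lambda>x y. S y \<otimes>\<^bsub>C\<^esub> x) = counit C c \<odot>\<^bsub>C\<^esub> \<one>\<^bsub>C\<^esub>"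
    "sw K C C C (comult C c) (\<lambda>x y. y \<otimes>\<^bsub>C\<^esub> S x) = counit C c \<odot>\<^bsub>C\<^esub> \<one>\<^bsub>C\<^esub>" if "c \<in> carrier C" for c
    using S that by (simp_all add: twisted_antipode_def D.H.sweedler_sw'[of C C])
  note pair = algebra_map_with_inverse.right_cancelling_pair
  have pairs: "cancelling_pair K C C (\<lambda>c d. d \<otimes>\<^bsub>C\<^esub> c) (\<lambda>c d. d \<otimes>\<^bsub>C\<^esub> S c)"
    "cancelling_pair K C C (\<lambda>c d. d \<otimes>\<^bsub>C\<^esub> twist C c) (\<lambda>c d. d \<otimes>\<^bsub>C\<^esub> twist C (S c))"
    "cancelling_pair K C C' (\<lambda>c d. d \<otimes>\<^bsub>C'\<^esub> \<gamma> c) (\<lambda>c d. d \<otimes>\<^bsub>C'\<^esub> \<gamma> (S c))"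
    by (rule pair[OF I] pair[OF T] pair[OF \<gamma>]; erule anti)+
  note exch = D.H.sw_exchange[where V = M and W = C and V' = C and W' = C and X = "coact M m" and Y = "comult C c" for c m]
    D.H.sw_exchange[where V = M and W = C and V' = N and W' = C and X = "coact M m" and Y = w for m w]
    D.H.sw_exchange[where V = N and W = C' and V' = M and W' = C and X = "coact N n" and Y = "coact M m" for n m]
    D.H.sw_exchange[where V = N and W = C' and V' = C and W' = C and X = "coact N n" and Y = "comult C c" for n c]
  define post where "post Z = sw K (tensor K (tensor K M N) C') C ?WN Z (\<lambda>x c. sw K (tensor K M N) C' ?WN x (\<lambda>u d. sw K M N ?WN u (\<lambda>m n.
      tens K (tensor K (tensor K N M) C') C (tens K (tensor K N M) C' (tens K N M n (twist M m)) (untwist C' (untwist C' d))) (untwist C (untwist C c)))))" for Z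
  let ?B = "\<lambda>Z. sw K (tensor K M N) C ?V Z (\<lambda>u c. sw K M N ?V u (\<lambda>m n. tens K (tensor K N M) C (tens K N M n (twist M m)) (untwist C (untwist C c))))"
  let ?B' = "\<lambda>Z. sw K (tensor K N M) C ?U Z (\<lambda>u c. sw K N M ?U u (\<lambda>n m. tens K (tensor K M N) C (tens K M N (untwist M m) n) (twist C (twist C c))))"
  let ?i = "\<lambda>X. sw K M ?G (tensor K M ?T) X (\<lambda>m w. tens K M ?T m w)"
  have "bij_betw (\<lambda>X. ?Phi (?i X)) (carrier (tensor K M ?G)) (carrier (G ?Q))"
  proof (rule transfer_bijective[OF M N Q pairs])
    show "inj_on post (carrier ?WM)"
      by (rule inj_on_inverseI[where g = "\<lambda>Z. sw K (tensor K (tensor K N M) C') C ?WM Z (\<lambda>x c. sw K (tensor K N M) C' ?WM x (\<lambda>u d. sw K N M ?WM u (\<lambda>n m.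
        tens K (tensor K (tensor K M N) C') C (tens K (tensor K M N) C' (tens K M N (untwist M m) n) (twist C' (twist C' d))) (twist C (twist C c)))))"])
        (simp add: post_def)
    show "bij_betw ?B (carrier ?U) (carrier (tensor K ?Q C))"
      unfolding D'.tensor_simps twisted_simps by (rule bij_betw_byWitness[of _ ?B']) auto
    fix Y assume Y: "Y \<in> carrier (tensor K M ?T)"
    show "?Phi Y = ?B (translate K C M (coact M) N C (\<lambda>c d. d \<otimes>\<^bsub>C\<^esub> c) Y)"
      using Y by (simp add: right_transfer_def translate_def Let_def)
    show "cotensor_left K C C' \<gamma> ?Q (?Phi Y) = post (double_translate M N (\<lambda>c d. d \<otimes>\<^bsub>C\<^esub> twist C c) (\<lambda>c d. d \<otimes>\<^bsub>C'\<^esub> \<gamma> c)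
        (sw K M ?T (tensor K M ?W) Y (\<lambda>m w. tens K M ?W m (cotensor_left K C C' \<gamma> N w))))"
      "cotensor_right K C C' ?Q (?Phi Y) = post (double_translate M N (\<lambda>c d. d \<otimes>\<^bsub>C\<^esub> twist C c) (\<lambda>c d. d \<otimes>\<^bsub>C'\<^esub> \<gamma> c)
        (sw K M ?T (tensor K M ?W) Y (\<lambda>m w. tens K M ?W m (cotensor_right K C C' N w))))"
      unfolding cotensor_left_def cotensor_right_def Let_def D'.tensor_simps twisted_simps post_def double_translate_def
      using Y by (simp_all add: Qops right_transfer_def translate_def Let_def exch M.M.sw_coact_coassoc)
  qed
  then have bij0: "bij_betw (\<lambda>X. ?Phi (?i X)) (carrier (tensor K M ?G)) (carrier (G ?Q))" .
  let ?f = "\<lambda>X. sw K ?G M (tensor K M ?G) X (\<lambda>w m. tens K M ?G m w)"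
  let ?j = "\<lambda>X. sw K ?G M (tensor K ?T M) X (\<lambda>w m. tens K ?T M w m)"
  have Gc: "w \<in> carrier ?T" if "w \<in> carrier ?G" for w
    using that by (simp add: cotensor_carrier[OF N])
  note [simp] = cotensor_subspace(1)[OF N] D.H.linear_rules[OF cotensor_subspace(2)[OF N]]
  have "bij_betw ?f (carrier (tensor K ?G M)) (carrier (tensor K M ?G))"
    by (rule bij_betw_byWitness[of _ "\<lambda>X. sw K M ?G (tensor K ?G M) X (\<lambda>m w. tens K ?G M w m)"]) auto
  then have "bij_betw ((\<lambda>X. ?Phi (?i X)) \<circ> ?f) (carrier (tensor K ?G M)) (carrier (G ?Q))"
    by (rule bij_betw_trans[OF _ bij0])
  moreover have "?Phi (?i (?f X)) = right_transfer M N (?j X)" if "X \<in> carrier (tensor K ?G M)" for X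
    using that by (simp add: Gc)
  ultimately have bij: "bij_betw (\<lambda>X. right_transfer M N (?j X)) (carrier (doi_hopf_tensor K A C (G N) M)) (carrier (G ?Q))"
    unfolding D.tensor_simps cotensor_functor_simps by (simp cong: bij_betw_cong)
  have "doi_hopf_hom K A C M M (\<lambda>x. x)" by (rule D.doi_hopf_homI) simp_all
  from D.doi_hopf_tensor_hom[OF GN(1) M PN M GN(2) this]
  have j: "doi_hopf_hom K A C (doi_hopf_tensor K A C (G N) M) (doi_hopf_tensor K A C (P N) M) ?j"
    unfolding cofree_simps cotensor_functor_simps .
  have hom: "doi_hopf_hom K A C (doi_hopf_tensor K A C (G N) M) (P ?Q) (\<lambda>X. right_transfer M N (?j X))"
    by (rule D.doi_hopf_hom_compose[OF X0 X1 PQ j right_transfer_hom[OF M N]])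
  have hom': "doi_hopf_hom K A C (doi_hopf_tensor K A C (G N) M) (G ?Q) (\<lambda>X. right_transfer M N (?j X))"
    by (rule D.doi_hopf_hom_corestrict[where i = "\<lambda>x. x", OF GQ(1) PQ X0 GQ(2) inj_on_id2 _ hom])
      (use bij_betwE[OF bij] in blast)
  then show ?thesis using bij by (rule D.doi_hopf_isoI[OF X0 GQ(1)])
qed

end

theorem theorem2p8:
  fixes K :: "('k, 'z) ring_scheme"
    and H :: "('k, 'h) hom_coalgebra"
    and A :: "('k, 'a) hom_coalgebra"
    and rhoA :: "'a \<Rightarrow> ('k, 'a, 'h) tensor"
    and C :: "('k, 'c) hom_coalgebra"
    and actC :: "'h \<Rightarrow> 'c \<Rightarrow> 'c"
    and C' :: "('k, 'd) hom_coalgebra"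
    and actC' :: "'h \<Rightarrow> 'd \<Rightarrow> 'd"
    and \<gamma> :: "'c \<Rightarrow> 'd"
  assumes "monoidal_doi_hopf_morphism K H A rhoA C actC C' actC' \<gamma>"
  shows
    "doi_hopf_iso K H A rhoA C actC
       (cotensor_functor K rhoA C actC C' \<gamma> (doi_hopf_self K A rhoA C' actC'))
       (doi_hopf_self K A rhoA C actC) \<and>
     (\<forall>(M :: ('k, 'a, 'c, 'm) doi_hopf_module) (N :: ('k, 'a, 'd, 'n) doi_hopf_module).
       doi_hopf_module K H A rhoA C actC M \<and> doi_hopf_module K H A rhoA C' actC' N \<longrightarrow>
       (hom_hopf_algebra K C \<longrightarrow>
         doi_hopf_iso K H A rhoA C actC
           (doi_hopf_tensor K A C M (cotensor_functor K rhoA C actC C' \<gamma> N))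
           (cotensor_functor K rhoA C actC C' \<gamma>
             (doi_hopf_tensor K A C' (induction_functor K A rhoA C' actC' \<gamma> M) N))) \<and>
       ((\<exists>S. twisted_antipode K C S) \<longrightarrow>
         doi_hopf_iso K H A rhoA C actC
           (doi_hopf_tensor K A C (cotensor_functor K rhoA C actC C' \<gamma> N) M)
           (cotensor_functor K rhoA C actC C' \<gamma>
             (doi_hopf_tensor K A C' N (induction_functor K A rhoA C' actC' \<gamma> M)))))"
proof -
  interpret monoidal_doi_hopf_morphism K H A rhoA C actC C' actC' \<gamma> by fact
  show ?thesis
  proof (intro conjI allI impI; (elim conjE)?)
    show "doi_hopf_iso K H A rhoA C actC (G (doi_hopf_self K A rhoA C' actC')) (doi_hopf_self K A rhoA C actC)"
      by (rule cotensor_self_iso)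
  next
    fix M :: "('k, 'a, 'c, 'm) doi_hopf_module" and N :: "('k, 'a, 'd, 'n) doi_hopf_module"
    assume M: "doi_hopf_module K H A rhoA C actC M" and N: "doi_hopf_module K H A rhoA C' actC' N"
    note F = induction_iso_twisted[OF M] and refl = D'.doi_hopf_iso_refl[OF N]
    show "doi_hopf_iso K H A rhoA C actC (doi_hopf_tensor K A C M (G N)) (G (doi_hopf_tensor K A C' (F M) N))"
      if hopf: "hom_hopf_algebra K C"
    proof -
      obtain S where "antipode K C S" using hom_hopf_algebra.antipode_exists[OF hopf] by blast
      then show ?thesis
        by (rule D.doi_hopf_iso_trans[OF left_projection_formula[OF M N]
              doi_hopf_iso_sym[OF cotensor_iso[OF D'.doi_hopf_tensor_iso[OF F refl]]]])
    qed
    show "doi_hopf_iso K H A rhoA C actC (doi_hopf_tensor K A C (G N) M) (G (doi_hopf_tensor K A C' N (F M)))"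
      if twisted: "\<exists>S. twisted_antipode K C S"
    proof -
      obtain S where "twisted_antipode K C S" using twisted by blast
      then show ?thesis
        by (rule D.doi_hopf_iso_trans[OF right_projection_formula[OF M N]
              doi_hopf_iso_sym[OF cotensor_iso[OF D'.doi_hopf_tensor_iso[OF refl F]]]])
    qed
  qed
qed

end
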